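(* Let $d\ge1$, $r_1,\dots,r_d\in\mathbb{Z}$, and let $(U_n)_{n\ge0}$ be a sequence of integers with $U_n=r_1U_{n-1}+\cdots+r_dU_{n-d}$ for all $n\ge d$. Let $C(x)=x^d-r_1x^{d-1}-\cdots-r_d=\prod_{i=0}^{d-1}(x-\alpha_i)$ and assume $\Delta=\prod_{0\le i<j<d}(\alpha_i-\alpha_j)^2\neq0$. Let $K=\mathbb{Q}(\alpha_0,\dots,\alpha_{d-1})$ be the splitting field of $C$, $m=[K:\mathbb{Q}]$, and $\Delta_K$ the discriminant of $K$. Then for every $t\in\mathbb{N}_+$ with $m\mid t$, the sequence $\big(r_d\,\Delta\,\operatorname{rad}(\Delta_K)\,U_{n^t}\big)_{n\ge1}$ satisfies the Dold condition.
   Context: A sequence of integers $(A_n)_{n\ge1}$ satisfies the Dold condition if $n\mid\sum_{d\mid n}\mu(d)A_{n/d}$ for every $n\in\mathbb{N}_+$ ($\mu$ the Möbius function). For a nonzero integer $a$, $\operatorname{rad}(a)$ denotes the product of the distinct primes dividing $a$. *)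

theory Defs
  imports
    Complex_Main
    "HOL-Computational_Algebra.Polynomial"
    "HOL-Computational_Algebra.Squarefree"
    "Jordan_Normal_Form.Determinant"
begin

definition moebius_mu :: "nat \<Rightarrow> int" where
  "moebius_mu n = (if squarefree n then (- 1) ^ card (prime_factors n) else 0)"

text \<open>The value \<open>A 0\<close> is irrelevant: the sequence is \<open>A 1, A 2, \<dots>\<close>.\<close>

definition dold_condition :: "(nat \<Rightarrow> int) \<Rightarrow> bool" where
  "dold_condition A \<longleftrightarrow>
     (\<forall>n\<ge>1. int n dvd (\<Sum>d | d dvd n. moebius_mu d * A (n div d)))"

definition rad :: "int \<Rightarrow> int" where
  "rad a = \<Prod>(prime_factors a)"

text \<open>Number fields are represented as subfields of the complex numbers. The field
  generated by a set \<open>S\<close> is \<open>complex_subfield hull S\<close>; it contains the rationals, so it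
  is \<open>\<rat>(S)\<close>.\<close>

definition complex_subfield :: "complex set \<Rightarrow> bool" where
  "complex_subfield F \<longleftrightarrow>
     0 \<in> F \<and> 1 \<in> F \<and>
     (\<forall>x\<in>F. \<forall>y\<in>F. x + y \<in> F \<and> x * y \<in> F) \<and>
     (\<forall>x\<in>F. - x \<in> F \<and> inverse x \<in> F)"

global_interpretation rat_vs: vector_space "\<lambda>(q::rat) (x::complex). of_rat q * x"
  by unfold_locales (simp_all add: algebra_simps of_rat_add of_rat_mult)

global_interpretation int_mod: Modules.module "\<lambda>(k::int) (x::complex). of_int k * x"
  by unfold_locales (simp_all add: algebra_simps)

text \<open>The trace over \<open>\<rat>\<close> of the endomorphism \<open>y \<mapsto> x * y\<close> of \<open>K\<close>, for \<open>K\<close> of finite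
  degree; it does not depend on the chosen basis.\<close>

definition field_trace :: "complex set \<Rightarrow> complex \<Rightarrow> rat" where
  "field_trace K x =
     (let B = (SOME B. rat_vs.independent B \<and> rat_vs.span B = K)
      in \<Sum>b\<in>B. rat_vs.representation B (x * b) b)"

definition ring_of_integers :: "complex set \<Rightarrow> complex set" where
  "ring_of_integers K = {x \<in> K. algebraic_int x}"

definition integral_basis :: "complex set \<Rightarrow> complex list \<Rightarrow> bool" where
  "integral_basis K bs \<longleftrightarrow>
     distinct bs \<and> int_mod.independent (set bs) \<and>
     int_mod.span (set bs) = ring_of_integers K"

text \<open>The determinant below is an integer that is the same for all integral bases.\<close>

definition field_discriminant :: "complex set \<Rightarrow> int" where
  "field_discriminant K =
     (SOME D. \<exists>bs. integral_basis K bs \<and>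
        of_int D = det (mat (length bs) (length bs)
                          (\<lambda>(i, j). field_trace K (bs ! i * bs ! j))))"

end

theory Submission
  imports Defs "Jordan_Normal_Form.Char_Poly" "HOL-Algebra.Multiplicative_Group"
begin

text \<open>
  The Dold condition follows from the congruences \<open>A (p\<^sup>l\<^sup>+\<^sup>1 s) \<equiv> A (p\<^sup>l s)\<close> modulo \<open>p\<^sup>l\<^sup>+\<^sup>1\<close>. By Lagrange
  interpolation \<open>\<Delta> U\<^sub>n\<close> is a combination of \<open>n\<close>-th powers of the roots of \<open>C\<close> whose coefficients are
  integers of \<open>K\<close>, so the congruences reduce to powers of a single integer \<open>x\<close> of \<open>K\<close>. Let \<open>N\<close> be the
  radical of \<open>p\<close> in the ring of integers. For \<open>f\<close> with coefficients in that ring, the polynomial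
  \<open>\<Prod>\<^sub>\<sigma> (Y - \<sigma> f)\<close> has coefficients in \<open>\<int>[X]\<close> and vanishes at \<open>f\<close>; applying the Frobenius map modulo \<open>p\<close>
  shows that \<open>\<Prod>\<^sub>\<sigma> (z\<^sub>\<sigma>\<^sup>p - \<sigma> z\<^sub>\<sigma>)\<close> lies in \<open>N\<close> for every choice of the \<open>z\<^sub>\<sigma>\<close>. Since \<open>\<sigma>\<^sup>t = 1\<close> for
  \<open>m\<close> dividing \<open>t\<close>, the difference of \<open>x\<close> to the power \<open>p\<^sup>t\<close> and \<open>x\<close> is a telescoping sum of
  multiples of such factors for every \<open>\<sigma>\<close>, so its \<open>m\<close>-th power, and hence the difference itself, lies in \<open>N\<close>.
  If \<open>p\<close> does not divide the discriminant, then \<open>N\<close> is generated by \<open>p\<close>, and the congruence lifts to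
  powers of \<open>p\<close>. Otherwise \<open>m\<close>-th powers of elements of \<open>N\<close> are still divisible by \<open>p\<close>, which gives the
  congruences modulo \<open>p\<^sup>l\<close>; the missing factor \<open>p\<close> is supplied by the radical of the discriminant.
\<close>

hide_const (open) up_ring.coeff up_ring.monom

section \<open>Subrings and congruences\<close>

locale comm_subring =
  fixes R :: "'a::comm_ring_1 set"
  assumes one_mem: "1 \<in> R"
    and diff_mem: "x \<in> R \<Longrightarrow> y \<in> R \<Longrightarrow> x - y \<in> R"
    and mult_mem: "x \<in> R \<Longrightarrow> y \<in> R \<Longrightarrow> x * y \<in> R"
begin

lemma zero_mem: "0 \<in> R"
  using diff_mem[OF one_mem one_mem] by simp

lemma uminus_mem: "x \<in> R \<Longrightarrow> - x \<in> R"
  using diff_mem[OF zero_mem] by fastforce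

lemma add_mem: "x \<in> R \<Longrightarrow> y \<in> R \<Longrightarrow> x + y \<in> R"
  using diff_mem[of x "- y"] uminus_mem[of y] by simp

lemma power_mem: "x \<in> R \<Longrightarrow> x ^ n \<in> R"
  by (induction n) (auto intro: one_mem mult_mem)

lemma sum_mem: "(\<And>i. i \<in> I \<Longrightarrow> f i \<in> R) \<Longrightarrow> sum f I \<in> R"
  by (induction I rule: infinite_finite_induct) (auto intro: zero_mem add_mem)

lemma prod_mem: "(\<And>i. i \<in> I \<Longrightarrow> f i \<in> R) \<Longrightarrow> prod f I \<in> R"
  by (induction I rule: infinite_finite_induct) (auto intro: one_mem mult_mem)

lemma of_nat_mem: "of_nat n \<in> R"
  by (induction n) (auto intro: zero_mem one_mem add_mem)

lemma of_int_mem: "of_int n \<in> R"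
  by (cases n rule: int_cases2) (auto intro: of_nat_mem uminus_mem)

lemma Ints_subset: "\<int> \<subseteq> R"
  by (auto elim!: Ints_cases intro: of_int_mem)

definition cong_mod :: "'a \<Rightarrow> 'a \<Rightarrow> 'a \<Rightarrow> bool" where
  "cong_mod q x y \<longleftrightarrow> (\<exists>c\<in>R. x - y = q * c)"

lemma cong_modI: "c \<in> R \<Longrightarrow> x - y = q * c \<Longrightarrow> cong_mod q x y"
  unfolding cong_mod_def by blast

lemma cong_modE:
  assumes "cong_mod q x y"
  obtains c where "c \<in> R" "x = y + q * c"
  using assms unfolding cong_mod_def by (metis add.commute diff_add_cancel)

lemma cong_mod_refl: "cong_mod q x x"
  by (rule cong_modI[OF zero_mem]) simp

lemma cong_mod_sym: "cong_mod q x y \<Longrightarrow> cong_mod q y x"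
  by (elim cong_modE, rule cong_modI[OF uminus_mem]) auto

lemma cong_mod_diff_eq_0_iff: "cong_mod q (x - y) 0 \<longleftrightarrow> cong_mod q x y"
  by (simp add: cong_mod_def)

lemma cong_mod_add:
  assumes "cong_mod q x y" "cong_mod q x' y'"
  shows "cong_mod q (x + x') (y + y')"
proof -
  obtain c c' where "c \<in> R" "c' \<in> R" "x = y + q * c" "x' = y' + q * c'"
    using assms by (elim cong_modE)
  then show ?thesis
    by (intro cong_modI[OF add_mem[of c c']]) (auto simp: algebra_simps)
qed

lemma cong_mod_trans [trans]: "cong_mod q x y \<Longrightarrow> cong_mod q y z \<Longrightarrow> cong_mod q x z"
  using cong_mod_add[of q x y y z] unfolding cong_mod_def by (simp add: algebra_simps)

lemma cong_mod_mult:
  assumes "cong_mod q x y" "cong_mod q x' y'" "y \<in> R" "x' \<in> R"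
  shows "cong_mod q (x * x') (y * y')"
proof -
  obtain c c' where "c \<in> R" "c' \<in> R" "x = y + q * c" "x' = y' + q * c'"
    using assms by (elim cong_modE)
  then show ?thesis
    using assms by (intro cong_modI[of "c * x' + y * c'"] add_mem mult_mem)
      (auto simp: algebra_simps)
qed

lemma cong_mod_mult_left: "cong_mod q x y \<Longrightarrow> c \<in> R \<Longrightarrow> cong_mod q (c * x) (c * y)"
  unfolding cong_mod_def by (metis mult.left_commute mult_mem right_diff_distrib)

lemma cong_mod_sum:
  "(\<And>i. i \<in> I \<Longrightarrow> cong_mod q (f i) (g i)) \<Longrightarrow> cong_mod q (sum f I) (sum g I)"
  by (induction I rule: infinite_finite_induct) (auto intro: cong_mod_refl cong_mod_add)

lemma cong_mod_power:
  assumes "cong_mod q x y" "x \<in> R" "y \<in> R"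
  shows "cong_mod q (x ^ n) (y ^ n)"
  using assms by (induction n) (auto intro: cong_mod_refl cong_mod_mult power_mem)

lemma cong_mod_cancel_modulus:
  "cong_mod (q * s) x y \<Longrightarrow> s \<in> R \<Longrightarrow> cong_mod q x y"
  unfolding cong_mod_def by (metis mult.assoc mult_mem)

lemma cong_mod_power_le:
  assumes "cong_mod (q ^ b) x y" "a \<le> b" "q \<in> R"
  shows "cong_mod (q ^ a) x y"
  using assms
  by (intro cong_mod_cancel_modulus[of "q ^ a" "q ^ (b - a)"])
    (auto simp: power_mem simp flip: power_add)

lemma cong_mod_freshman:
  assumes p: "prime p" and xy: "x \<in> R" "y \<in> R"
  shows "cong_mod (of_nat p) ((x + y) ^ p) (x ^ p + y ^ p)"
proof -
  let ?t = "\<lambda>k. of_nat (p choose k) * x ^ k * y ^ (p - k)"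
  have p0: "p > 0"
    using p prime_gt_0_nat by blast
  have middle: "cong_mod (of_nat p) (?t k) 0" if "k \<in> {1..<p}" for k
  proof -
    have "p dvd (p choose k)"
      using that p by (intro dvd_choose_prime) auto
    then obtain c where "p choose k = p * c"
      by (elim dvdE)
    then show ?thesis
      using xy by (intro cong_modI[of "of_nat c * x ^ k * y ^ (p - k)"])
        (auto intro!: mult_mem of_nat_mem power_mem)
  qed
  have "(x + y) ^ p = (\<Sum>k\<le>p. ?t k)"
    by (rule binomial_ring)
  also have "{..p} = {0, p} \<union> {1..<p}"
    using p0 by auto
  also have "(\<Sum>k\<in>\<dots>. ?t k) = x ^ p + y ^ p + (\<Sum>k=1..<p. ?t k)"
    using p0 by (subst sum.union_disjoint) (auto simp: add_ac)
  also have "cong_mod (of_nat p) \<dots> (x ^ p + y ^ p + (\<Sum>k=1..<p. 0))"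
    by (intro cong_mod_add cong_mod_refl cong_mod_sum middle)
  finally show ?thesis
    by simp
qed

lemma cong_mod_freshman_sum:
  assumes p: "prime p" and "\<And>i. i \<in> I \<Longrightarrow> f i \<in> R"
  shows "cong_mod (of_nat p) (sum f I ^ p) (\<Sum>i\<in>I. f i ^ p)"
  using assms(2)
proof (induction I rule: infinite_finite_induct)
  case (insert i I)
  have "cong_mod (of_nat p) ((f i + sum f I) ^ p) (f i ^ p + sum f I ^ p)"
    using insert by (intro cong_mod_freshman p sum_mem) auto
  also have "cong_mod (of_nat p) (f i ^ p + sum f I ^ p) (f i ^ p + (\<Sum>i\<in>I. f i ^ p))"
    using insert by (intro cong_mod_add cong_mod_refl) auto
  finally show ?case
    using insert.hyps by simp
qed (use p in \<open>auto simp: power_0_left intro: cong_mod_refl\<close>)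

lemma cong_mod_freshman_power:
  assumes p: "prime p" and "x \<in> R" "y \<in> R"
  shows "cong_mod (of_nat p) ((x + y) ^ (p ^ n)) (x ^ (p ^ n) + y ^ (p ^ n))"
proof (induction n)
  case (Suc n)
  have "cong_mod (of_nat p) (((x + y) ^ (p ^ n)) ^ p) ((x ^ (p ^ n) + y ^ (p ^ n)) ^ p)"
    using assms by (intro cong_mod_power Suc.IH power_mem add_mem)
  also have "cong_mod (of_nat p) \<dots> ((x ^ (p ^ n)) ^ p + (y ^ (p ^ n)) ^ p)"
    using assms by (intro cong_mod_freshman power_mem)
  finally show ?case
    unfolding power_Suc2 power_mult .
qed (auto intro: cong_mod_refl)

lemma cong_mod_fermat:
  assumes p: "prime p"
  shows "cong_mod (of_nat p) (of_int a ^ p) (of_int a)"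
proof -
  define n where "n = nat (a mod int p)"
  have "a - int n = int p * (a div int p)"
    using prime_gt_0_nat[OF p] by (simp add: n_def minus_mod_eq_mult_div)
  then have "of_int (a - int n) = (of_int (int p * (a div int p)) :: 'a)"
    by simp
  then have a: "cong_mod (of_nat p) (of_int a) (of_nat n)"
    by (intro cong_modI[OF of_int_mem[of "a div int p"]]) simp
  then have "cong_mod (of_nat p) (of_int a ^ p) (of_nat n ^ p)"
    by (intro cong_mod_power of_int_mem of_nat_mem)
  also have "cong_mod (of_nat p) (of_nat n ^ p) (of_nat n)"
    using cong_mod_freshman_sum[OF p, of "{..<n}" "\<lambda>_. 1"] one_mem by simp
  also note cong_mod_sym[OF a]
  finally show ?thesis .
qed

lemma cong_mod_power_lift:
  assumes "cong_mod (of_nat p ^ Suc a) x y" "x \<in> R" "y \<in> R"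
  shows "cong_mod (of_nat p ^ Suc (Suc a)) (x ^ p) (y ^ p)"
proof -
  obtain c where c: "c \<in> R" "x = y + of_nat p ^ Suc a * c"
    using assms by (elim cong_modE)
  have "cong_mod (of_nat p ^ Suc 0) x y"
    using assms(1) by (rule cong_mod_power_le) (auto intro: of_nat_mem)
  then have "cong_mod (of_nat p) (\<Sum>i<p. y ^ (p - Suc i) * x ^ i) (\<Sum>i<p. y ^ (p - Suc i) * y ^ i)"
    using assms by (intro cong_mod_sum cong_mod_mult_left cong_mod_power power_mem) auto
  also have "(\<Sum>i<p. y ^ (p - Suc i) * y ^ i) = of_nat p * y ^ (p - 1)"
    by (simp flip: power_add)
  finally obtain e where e: "e \<in> R"
      "(\<Sum>i<p. y ^ (p - Suc i) * x ^ i) = of_nat p * y ^ (p - 1) + of_nat p * e"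
    by (elim cong_modE)
  have "x ^ p - y ^ p = (x - y) * (\<Sum>i<p. y ^ (p - Suc i) * x ^ i)"
    by (rule power_diff_sumr2)
  also have "\<dots> = of_nat p ^ Suc (Suc a) * (c * (y ^ (p - 1) + e))"
    unfolding e(2) by (simp add: c(2) algebra_simps)
  finally show ?thesis
    using c e assms by (intro cong_modI[of "c * (y ^ (p - 1) + e)"] mult_mem add_mem power_mem)
qed

lemma cong_mod_power_lift_iterate:
  assumes "cong_mod (of_nat p) x y" "x \<in> R" "y \<in> R"
  shows "cong_mod (of_nat p ^ Suc n) (x ^ (p ^ n)) (y ^ (p ^ n))"
proof (induction n)
  case (Suc n)
  show ?case
    using cong_mod_power_lift[OF Suc] assms by (simp add: power_mem mult.commute flip: power_mult)
qed (use assms in simp)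

end

section \<open>Radical ideals\<close>

context comm_subring
begin

definition ideal_in :: "'a set \<Rightarrow> bool" where
  "ideal_in I \<longleftrightarrow> I \<subseteq> R \<and> 0 \<in> I \<and> (\<forall>x\<in>I. \<forall>y\<in>I. x + y \<in> I) \<and> (\<forall>x\<in>I. \<forall>c\<in>R. c * x \<in> I)"

definition radical_ideal_in :: "'a set \<Rightarrow> bool" where
  "radical_ideal_in N \<longleftrightarrow> ideal_in N \<and> (\<forall>x\<in>R. \<forall>n. x ^ n \<in> N \<longrightarrow> x \<in> N)"

lemma ideal_in_subset: "ideal_in I \<Longrightarrow> I \<subseteq> R"
  and ideal_in_zero: "ideal_in I \<Longrightarrow> 0 \<in> I"
  and ideal_in_add: "ideal_in I \<Longrightarrow> x \<in> I \<Longrightarrow> y \<in> I \<Longrightarrow> x + y \<in> I"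
  and ideal_in_mult: "ideal_in I \<Longrightarrow> x \<in> I \<Longrightarrow> c \<in> R \<Longrightarrow> c * x \<in> I"
  by (auto simp: ideal_in_def)

lemma ideal_in_uminus: "ideal_in I \<Longrightarrow> x \<in> I \<Longrightarrow> - x \<in> I"
  using ideal_in_mult[of I x "- 1"] uminus_mem[OF one_mem] by simp

lemma ideal_in_diff: "ideal_in I \<Longrightarrow> x \<in> I \<Longrightarrow> y \<in> I \<Longrightarrow> x - y \<in> I"
  using ideal_in_add[of I x "- y"] ideal_in_uminus by simp

lemma ideal_in_sum: "ideal_in I \<Longrightarrow> (\<And>i. i \<in> A \<Longrightarrow> f i \<in> I) \<Longrightarrow> sum f A \<in> I"
  by (induction A rule: infinite_finite_induct) (auto intro: ideal_in_zero ideal_in_add)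

lemma radical_ideal_inD:
  assumes "radical_ideal_in N"
  shows "ideal_in N" "x \<in> R \<Longrightarrow> x ^ n \<in> N \<Longrightarrow> x \<in> N"
  using assms by (auto simp: radical_ideal_in_def)

definition radical :: "'a \<Rightarrow> 'a set" where
  "radical q = {x \<in> R. \<exists>n. cong_mod q (x ^ n) 0}"

lemma radicalI: "x \<in> R \<Longrightarrow> cong_mod q (x ^ n) 0 \<Longrightarrow> x \<in> radical q"
  by (auto simp: radical_def)

lemma radicalE:
  assumes "x \<in> radical q"
  obtains n where "x \<in> R" "cong_mod q (x ^ n) 0"
  using assms by (auto simp: radical_def)

lemma cong_mod_0_power_le:
  assumes "cong_mod q (x ^ n) 0" "x \<in> R" "n \<le> k"
  shows "cong_mod q (x ^ k) 0"
proof -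
  have "x ^ k = x ^ (k - n) * x ^ n"
    using assms(3) by (simp flip: power_add)
  then show ?thesis
    using cong_mod_mult_left[OF assms(1) power_mem[OF assms(2)]] by simp
qed

lemma radical_add:
  assumes "x \<in> radical q" "y \<in> radical q"
  shows "x + y \<in> radical q"
proof -
  obtain n k where nk: "x \<in> R" "y \<in> R" "cong_mod q (x ^ n) 0" "cong_mod q (y ^ k) 0"
    using assms by (elim radicalE)
  have term0: "cong_mod q (of_nat (n + k choose i) * x ^ i * y ^ (n + k - i)) 0" for i
  proof (cases "i \<ge> n")
    case True
    then have "cong_mod q (x ^ i) 0"
      using nk cong_mod_0_power_le by blast
    then have "cong_mod q ((of_nat (n + k choose i) * y ^ (n + k - i)) * x ^ i)
        ((of_nat (n + k choose i) * y ^ (n + k - i)) * 0)"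
      using nk by (intro cong_mod_mult_left mult_mem of_nat_mem power_mem)
    then show ?thesis
      by (simp add: mult_ac)
  next
    case False
    then have "cong_mod q (y ^ (n + k - i)) 0"
      using nk cong_mod_0_power_le[of q y k "n + k - i"] by simp
    then have "cong_mod q ((of_nat (n + k choose i) * x ^ i) * y ^ (n + k - i))
        ((of_nat (n + k choose i) * x ^ i) * 0)"
      using nk by (intro cong_mod_mult_left mult_mem of_nat_mem power_mem)
    then show ?thesis
      by simp
  qed
  have "cong_mod q ((x + y) ^ (n + k)) (\<Sum>i\<le>n + k. 0)"
    unfolding binomial_ring by (intro cong_mod_sum term0)
  then show ?thesis
    using nk by (intro radicalI add_mem) simp_all
qed

lemma radical_ideal_in_radical:
  assumes "q \<in> R"
  shows "radical_ideal_in (radical q)"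
  unfolding radical_ideal_in_def ideal_in_def
proof (intro conjI ballI allI impI)
  show "radical q \<subseteq> R"
    by (auto simp: radical_def)
  show "0 \<in> radical q"
    using zero_mem cong_mod_refl by (intro radicalI[of _ _ 1]) simp_all
  show "x + y \<in> radical q" if "x \<in> radical q" "y \<in> radical q" for x y
    using that by (rule radical_add)
  show "c * x \<in> radical q" if x: "x \<in> radical q" and c: "c \<in> R" for x c
  proof -
    obtain n where "x \<in> R" "cong_mod q (x ^ n) 0"
      using x by (elim radicalE)
    then show ?thesis
      using c cong_mod_mult_left[of q "x ^ n" 0 "c ^ n"]
      by (intro radicalI[of _ _ n] mult_mem) (simp_all add: power_mult_distrib power_mem)
  qed
  show "x \<in> radical q" if "x \<in> R" "x ^ n \<in> radical q" for x n
    using that by (elim radicalE, intro radicalI) (simp_all flip: power_mult)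
qed

lemma det_mem:
  assumes A: "A \<in> carrier_mat n n" and AR: "\<And>i j. i < n \<Longrightarrow> j < n \<Longrightarrow> A $$ (i, j) \<in> R"
  shows "det A \<in> R"
proof -
  have "signof \<pi> \<in> R" for \<pi> :: "nat \<Rightarrow> nat"
    by (auto simp: sign_def intro: one_mem uminus_mem)
  then show ?thesis
    unfolding det_def'[OF A] by (intro sum_mem mult_mem prod_mem AR) (auto simp: permutes_in_image)
qed

lemma det_mem_ideal:
  assumes I: "ideal_in I" and A: "A \<in> carrier_mat n n"
    and AR: "\<And>i j. i < n \<Longrightarrow> j < n \<Longrightarrow> A $$ (i, j) \<in> R"
    and l: "l < n" and col: "\<And>i. i < n \<Longrightarrow> A $$ (i, l) \<in> I"
  shows "det A \<in> I"
proof -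
  have "cofactor A i l \<in> R" if "i < n" for i
    unfolding cofactor_def
    by (intro mult_mem power_mem uminus_mem one_mem det_mem[OF mat_delete_carrier[OF A]])
      (use A AR in \<open>auto simp: mat_delete_def\<close>)
  then have "(\<Sum>i<n. cofactor A i l * A $$ (i, l)) \<in> I"
    using col by (intro ideal_in_sum ideal_in_mult I) auto
  then show ?thesis
    unfolding laplace_expansion_column[OF A l] by (simp add: mult.commute)
qed

end

section \<open>Polynomials over subrings\<close>

definition polys_over :: "'a::comm_ring_1 set \<Rightarrow> 'a poly set" where
  "polys_over R = {f. \<forall>n. coeff f n \<in> R}"

lemma polys_overI: "(\<And>n. coeff f n \<in> R) \<Longrightarrow> f \<in> polys_over R"
  by (simp add: polys_over_def)

lemma coeff_polys_over: "f \<in> polys_over R \<Longrightarrow> coeff f n \<in> R"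
  by (simp add: polys_over_def)

lemma polys_over_mono: "R \<subseteq> S \<Longrightarrow> polys_over R \<subseteq> polys_over S"
  by (auto simp: polys_over_def)

lemma pCons_polys_over_iff: "pCons a f \<in> polys_over R \<longleftrightarrow> a \<in> R \<and> f \<in> polys_over R"
  unfolding polys_over_def by (auto simp: coeff_pCons split: nat.splits)

lemma poly_map_poly_sum:
  fixes \<psi> :: "'a::zero \<Rightarrow> 'b::comm_semiring_1"
  assumes "\<psi> 0 = 0"
  shows "poly (map_poly \<psi> f) x = (\<Sum>i\<le>degree f. \<psi> (coeff f i) * x ^ i)"
proof -
  have "(\<Sum>i\<le>degree (map_poly \<psi> f). coeff (map_poly \<psi> f) i * x ^ i) =
      (\<Sum>i\<le>degree f. coeff (map_poly \<psi> f) i * x ^ i)"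
    using degree_map_poly_le[of \<psi> f] by (intro sum.mono_neutral_left) (auto simp: coeff_eq_0)
  then show ?thesis
    unfolding poly_altdef by (simp add: coeff_map_poly assms)
qed

lemma coeff_pcompose_monom:
  fixes g :: "'a::comm_ring_1 poly"
  assumes "p > 0"
  shows "coeff (pcompose g (monom 1 p)) (p * i) = coeff g i"
proof (induction g arbitrary: i)
  case (pCons a g)
  have "coeff (pcompose (pCons a g) (monom 1 p)) (p * i) =
      coeff [:a:] (p * i) + (if p * i < p then 0 else coeff (pcompose g (monom 1 p)) (p * i - p))"
    by (simp add: pcompose_pCons coeff_monom_mult)
  also have "\<dots> = coeff (pCons a g) i"
  proof (cases i)
    case 0
    then show ?thesis
      using assms by simp
  next
    case (Suc j)
    have "coeff [:a:] (p * i) = 0"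
      using assms Suc by (intro coeff_eq_0) simp
    then show ?thesis
      using Suc pCons.IH[of j] by simp
  qed
  finally show ?case .
qed simp

context comm_subring
begin

lemma comm_subring_polys_over: "comm_subring (polys_over R)"
proof
  show "f * g \<in> polys_over R" if "f \<in> polys_over R" "g \<in> polys_over R" for f g
    using that by (auto simp: polys_over_def coeff_mult intro!: sum_mem mult_mem)
qed (auto simp: polys_over_def intro: one_mem zero_mem diff_mem)

interpretation polys: comm_subring "polys_over R"
  by (rule comm_subring_polys_over)

lemma linear_polys_over: "a \<in> R \<Longrightarrow> b \<in> R \<Longrightarrow> [:a, b:] \<in> polys_over R"
  by (simp add: pCons_polys_over_iff polys.zero_mem)

lemma monom_polys_over: "a \<in> R \<Longrightarrow> monom a n \<in> polys_over R"
  by (auto simp: polys_over_def intro: zero_mem)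

lemma smult_polys_over: "a \<in> R \<Longrightarrow> f \<in> polys_over R \<Longrightarrow> smult a f \<in> polys_over R"
  by (auto simp: polys_over_def intro: mult_mem)

lemma poly_mem: "f \<in> polys_over R \<Longrightarrow> x \<in> R \<Longrightarrow> poly f x \<in> R"
  by (auto simp: poly_altdef polys_over_def intro!: sum_mem mult_mem power_mem)

lemma pcompose_polys_over:
  assumes "f \<in> polys_over R" "g \<in> polys_over R"
  shows "pcompose f g \<in> polys_over R"
  using assms(1)
proof (induction f)
  case (pCons a f)
  then show ?case
    using assms(2) polys.zero_mem
    by (auto simp: pcompose_pCons pCons_polys_over_iff intro!: polys.add_mem polys.mult_mem)
qed simp

lemma monic_division:
  assumes g: "g \<in> polys_over R" "lead_coeff g = 1" "degree g > 0" and f: "f \<in> polys_over R"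
  shows "\<exists>s\<in>polys_over R. \<exists>r\<in>polys_over R. f = g * s + r \<and> degree r < degree g"
  using f
proof (induction f)
  case 0
  show ?case
    using g(3) polys.zero_mem by (intro bexI[of _ 0]) auto
next
  case (pCons a f)
  then obtain s r where sr: "s \<in> polys_over R" "r \<in> polys_over R" "f = g * s + r"
    "degree r < degree g"
    by (auto simp: pCons_polys_over_iff)
  define c where "c = coeff r (degree g - 1)"
  have c: "c \<in> R"
    unfolding c_def using sr(2) by (rule coeff_polys_over)
  let ?s = "pCons c s" and ?r = "pCons a r - smult c g"
  have "pCons a f = g * ?s + ?r"
    by (simp add: sr(3) algebra_simps)
  moreover have "degree ?r < degree g"
  proof (rule degree_lessI)
    have "coeff ?r k = 0" if "k \<ge> degree g" for k
    proof (cases "k = degree g")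
      case True
      then show ?thesis
        using g by (cases "degree g") (simp_all add: c_def)
    next
      case False
      then show ?thesis
        using that sr(4) by (cases k) (auto simp: coeff_eq_0)
    qed
    then show "\<forall>k\<ge>degree g. coeff ?r k = 0"
      by blast
  qed (use g(3) in simp)
  moreover have "?s \<in> polys_over R" "?r \<in> polys_over R"
    using sr c g pCons.prems
    by (auto simp: pCons_polys_over_iff intro!: polys.diff_mem smult_polys_over)
  ultimately show ?case
    by blast
qed

lemma cong_mod_poly_0:
  assumes "\<And>i. cong_mod q (coeff g i) 0" "x \<in> R"
  shows "cong_mod q (poly g x) 0"
proof -
  have "cong_mod q (\<Sum>i\<le>degree g. x ^ i * coeff g i) (\<Sum>i\<le>degree g. x ^ i * 0)"
    using assms by (intro cong_mod_sum cong_mod_mult_left power_mem)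
  then show ?thesis
    by (simp add: poly_altdef mult.commute)
qed

lemma cong_mod_poly:
  assumes "g \<in> polys_over R" "cong_mod q x y" "x \<in> R" "y \<in> R"
  shows "cong_mod q (poly g x) (poly g y)"
  unfolding poly_altdef using assms
  by (intro cong_mod_sum cong_mod_mult_left cong_mod_power coeff_polys_over)

lemma cong_mod_poly_power_prime:
  assumes p: "prime p" and g: "g \<in> polys_over S" "S \<subseteq> R" and x: "x \<in> R" and \<psi>0: "\<psi> 0 = 0"
    and \<psi>: "\<And>a. a \<in> S \<Longrightarrow> cong_mod (of_nat p) (a ^ p) (\<psi> a)"
  shows "cong_mod (of_nat p) (poly g x ^ p) (poly (map_poly \<psi> g) (x ^ p))"
proof -
  have coeff: "coeff g i \<in> S" "coeff g i \<in> R" for i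
    using g coeff_polys_over by blast+
  have "cong_mod (of_nat p) (poly g x ^ p) (\<Sum>i\<le>degree g. (coeff g i * x ^ i) ^ p)"
    unfolding poly_altdef using coeff x by (intro cong_mod_freshman_sum p mult_mem power_mem)
  also have "(\<Sum>i\<le>degree g. (coeff g i * x ^ i) ^ p) = (\<Sum>i\<le>degree g. (x ^ p) ^ i * coeff g i ^ p)"
    by (simp add: power_mult_distrib mult.commute flip: power_mult)
  also have "cong_mod (of_nat p) \<dots> (\<Sum>i\<le>degree g. (x ^ p) ^ i * \<psi> (coeff g i))"
    using coeff x by (intro cong_mod_sum cong_mod_mult_left \<psi> power_mem)
  also have "\<dots> = poly (map_poly \<psi> g) (x ^ p)"
    by (simp add: poly_map_poly_sum[of \<psi>, OF \<psi>0] mult.commute)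
  finally show ?thesis .
qed

lemma polys_cong_mod_iff:
  "polys.cong_mod (of_nat q) f g \<longleftrightarrow> (\<forall>i. cong_mod (of_nat q) (coeff f i) (coeff g i))"
proof
  assume "polys.cong_mod (of_nat q) f g"
  then obtain h where "h \<in> polys_over R" "f - g = of_nat q * h"
    by (auto simp: polys.cong_mod_def)
  then have "coeff f i - coeff g i = of_nat q * coeff h i" "coeff h i \<in> R" for i
    by (auto simp: of_nat_poly coeff_polys_over simp flip: coeff_diff)
  then show "\<forall>i. cong_mod (of_nat q) (coeff f i) (coeff g i)"
    using cong_modI by blast
next
  assume "\<forall>i. cong_mod (of_nat q) (coeff f i) (coeff g i)"
  then obtain c where c: "\<And>i. c i \<in> R" "\<And>i. coeff f i - coeff g i = of_nat q * c i"
    unfolding cong_mod_def by metis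
  define h where "h = (\<Sum>i\<le>max (degree f) (degree g). monom (c i) i)"
  have "f - g = of_nat q * h"
  proof (rule poly_eqI)
    show "coeff (f - g) i = coeff (of_nat q * h) i" for i
      using c(2)[of i] by (auto simp: h_def of_nat_poly coeff_sum coeff_eq_0)
  qed
  moreover have "h \<in> polys_over R"
    unfolding h_def using c(1) by (intro polys.sum_mem monom_polys_over)
  ultimately show "polys.cong_mod (of_nat q) f g"
    by (intro polys.cong_modI)
qed

lemma polys_cong_mod_power_prime:
  assumes p: "prime p" and f: "f \<in> polys_over R" and \<psi>0: "\<psi> 0 = 0"
    and \<psi>: "\<And>i. cong_mod (of_nat p) (coeff f i ^ p) (\<psi> (coeff f i))"
  shows "polys.cong_mod (of_nat p) (f ^ p) (pcompose (map_poly \<psi> f) (monom 1 p))"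
proof -
  let ?X = "monom 1 p"
  have coeff: "coeff f i \<in> R" for i
    using f by (rule coeff_polys_over)
  have "polys.cong_mod (of_nat p) ((\<Sum>i\<le>degree f. monom (coeff f i) i) ^ p)
      (\<Sum>i\<le>degree f. monom (coeff f i) i ^ p)"
    using coeff by (intro polys.cong_mod_freshman_sum p monom_polys_over)
  also have "(\<Sum>i\<le>degree f. monom (coeff f i) i ^ p) = (\<Sum>i\<le>degree f. monom (coeff f i ^ p) (i * p))"
    by (simp add: monom_power)
  also have "polys.cong_mod (of_nat p) \<dots> (\<Sum>i\<le>degree f. monom (\<psi> (coeff f i)) (i * p))"
  proof (rule polys.cong_mod_sum)
    show "polys.cong_mod (of_nat p) (monom (coeff f i ^ p) (i * p)) (monom (\<psi> (coeff f i)) (i * p))" for i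
      unfolding polys_cong_mod_iff using \<psi> by (simp add: cong_mod_refl)
  qed
  also have "(\<Sum>i\<le>degree f. monom (\<psi> (coeff f i)) (i * p)) = pcompose (map_poly \<psi> f) ?X"
  proof -
    have "pcompose (map_poly \<psi> f) ?X = poly (map_poly (\<lambda>c. [:\<psi> c:]) f) ?X"
      by (simp add: pcompose_altdef map_poly_map_poly \<psi>0 o_def)
    also have "\<dots> = (\<Sum>i\<le>degree f. [:\<psi> (coeff f i):] * ?X ^ i)"
      by (rule poly_map_poly_sum) (simp add: \<psi>0)
    finally show ?thesis
      by (simp add: monom_power smult_monom mult.commute)
  qed
  finally show ?thesis
    by (simp add: poly_as_sum_of_monoms)
qed

lemma prod_linear_minus_monom_polys_over:
  assumes I: "ideal_in I" and y: "\<And>k. k \<in> A \<Longrightarrow> y k \<in> I"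
  shows "(\<Prod>k\<in>A. [:- y k, 1:]) - monom 1 (card A) \<in> polys_over I"
  using y
proof (induction A rule: infinite_finite_induct)
  case (insert k A)
  let ?q = "\<Prod>k\<in>A. [:- y k, 1:]" and ?X = "monom 1 (card A)"
  have y: "y k \<in> I" "\<And>j. j \<in> A \<Longrightarrow> y j \<in> R"
    using insert.prems ideal_in_subset[OF I] by auto
  have "?q \<in> polys_over R"
    using y by (intro polys.prod_mem linear_polys_over uminus_mem one_mem)
  then have "coeff ?q n * y k \<in> I" for n
    using y(1) by (intro ideal_in_mult[OF I] coeff_polys_over)
  moreover have "coeff (?q - ?X) n \<in> I" for n
    using insert by (intro coeff_polys_over) auto
  ultimately have "coeff (pCons 0 (?q - ?X) - smult (y k) ?q) n \<in> I" for n
    using ideal_in_diff[OF I] ideal_in_zero[OF I] ideal_in_uminus[OF I]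
    by (cases n) (auto simp: mult.commute)
  moreover have "(\<Prod>k\<in>insert k A. [:- y k, 1:]) - monom 1 (card (insert k A)) =
      pCons 0 (?q - ?X) - smult (y k) ?q"
    using insert.hyps by (simp add: monom_Suc algebra_simps)
  ultimately show ?case
    by (intro polys_overI) simp
qed (auto simp: polys_over_def ideal_in_zero[OF I])

text \<open>The counterpart of Gauss's lemma that makes prime ideals dispensable.\<close>

lemma coeff_mult_coeff_mem_radical_ideal:
  assumes N: "radical_ideal_in N"
    and f: "f \<in> polys_over R" and g: "g \<in> polys_over R" and fg: "f * g \<in> polys_over N"
  shows "coeff f i * coeff g j \<in> N"
proof (induction "i + j" arbitrary: i j rule: less_induct)
  case less
  note idN = radical_ideal_inD(1)[OF N]
  have fR: "coeff f k \<in> R" and gR: "coeff g k \<in> R" for k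
    using f g by (auto intro: coeff_polys_over)
  let ?y = "coeff f i * coeff g j"
  let ?S = "\<Sum>k\<in>{..i + j} - {i}. ?y * (coeff f k * coeff g (i + j - k))"
  have "?y * (coeff f k * coeff g (i + j - k)) \<in> N" if k: "k \<in> {..i + j} - {i}" for k
  proof (cases "k < i")
    case True
    then have "(coeff f i * coeff g (i + j - k)) * (coeff f k * coeff g j) \<in> N"
      by (intro ideal_in_mult[OF idN less.hyps] mult_mem fR gR) simp
    then show ?thesis
      by (simp add: mult_ac)
  next
    case False
    then have "(coeff f k * coeff g j) * (coeff f i * coeff g (i + j - k)) \<in> N"
      using k by (intro ideal_in_mult[OF idN less.hyps] mult_mem fR gR) auto
    then show ?thesis
      by (simp add: mult_ac)
  qed
  then have S: "?S \<in> N"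
    by (rule ideal_in_sum[OF idN])
  have "?y * coeff (f * g) (i + j) = (\<Sum>k\<le>i + j. ?y * (coeff f k * coeff g (i + j - k)))"
    by (simp add: coeff_mult sum_distrib_left)
  also have "\<dots> = ?y ^ 2 + ?S"
    by (subst sum.remove[of _ i]) (auto simp: power2_eq_square)
  finally have "?y ^ 2 = ?y * coeff (f * g) (i + j) - ?S"
    by simp
  also have "\<dots> \<in> N"
    by (intro ideal_in_diff[OF idN] ideal_in_mult[OF idN] coeff_polys_over[OF fg] S mult_mem fR gR)
  finally show ?case
    by (rule radical_ideal_inD(2)[OF N mult_mem[OF fR gR]])
qed

lemma prod_coeff_mem_radical_ideal:
  assumes N: "radical_ideal_in N" and "finite A" "\<And>s. s \<in> A \<Longrightarrow> F s \<in> polys_over R"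
    and "c \<in> R" "smult c (prod F A) \<in> polys_over N"
  shows "c * (\<Prod>s\<in>A. coeff (F s) (i s)) \<in> N"
  using assms(2-)
proof (induction A arbitrary: c rule: finite_induct)
  case empty
  then show ?case
    using coeff_polys_over[of "[:c:]" N 0] by simp
next
  case (insert s A)
  let ?G = "smult c (prod F A)"
  have F: "F s \<in> polys_over R" and "?G \<in> polys_over R"
    using insert.prems by (auto intro: smult_polys_over polys.prod_mem)
  moreover have "F s * ?G \<in> polys_over N"
    using insert by simp
  ultimately have "coeff (F s) (i s) * coeff ?G j \<in> N" for j
    by (rule coeff_mult_coeff_mem_radical_ideal[OF N])
  then have "smult (c * coeff (F s) (i s)) (prod F A) \<in> polys_over N"
    by (intro polys_overI) (simp add: mult_ac)
  then have "(c * coeff (F s) (i s)) * (\<Prod>s\<in>A. coeff (F s) (i s)) \<in> N"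
    using insert.prems F by (intro insert.IH mult_mem) (auto intro: coeff_polys_over)
  then show ?case
    using insert.hyps by (simp add: mult.assoc)
qed

end

lemma pderiv_polys_over:
  fixes f :: "'a::idom poly"
  assumes "comm_subring R" "f \<in> polys_over R"
  shows "pderiv f \<in> polys_over R"
proof (rule polys_overI)
  show "coeff (pderiv f) n \<in> R" for n
    unfolding coeff_pderiv using assms
    by (intro comm_subring.mult_mem[of R] comm_subring.of_nat_mem[of R] coeff_polys_over)
qed

section \<open>Homomorphisms of subrings\<close>

locale subring_hom = comm_subring R for R :: "'a::comm_ring_1 set" +
  fixes \<sigma> :: "'a \<Rightarrow> 'b::comm_ring_1"
  assumes hom_one: "\<sigma> 1 = 1"
    and hom_add: "x \<in> R \<Longrightarrow> y \<in> R \<Longrightarrow> \<sigma> (x + y) = \<sigma> x + \<sigma> y"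
    and hom_mult: "x \<in> R \<Longrightarrow> y \<in> R \<Longrightarrow> \<sigma> (x * y) = \<sigma> x * \<sigma> y"
begin

lemma hom_zero: "\<sigma> 0 = 0"
  using hom_add[OF zero_mem zero_mem] by simp

lemma hom_uminus: "x \<in> R \<Longrightarrow> \<sigma> (- x) = - \<sigma> x"
  using hom_add[of x "- x"] uminus_mem[of x] hom_zero by (simp add: add_eq_0_iff2)

lemma hom_diff: "x \<in> R \<Longrightarrow> y \<in> R \<Longrightarrow> \<sigma> (x - y) = \<sigma> x - \<sigma> y"
  using hom_add[of x "- y"] uminus_mem[of y] hom_uminus[of y] by simp

lemma hom_sum: "(\<And>i. i \<in> I \<Longrightarrow> f i \<in> R) \<Longrightarrow> \<sigma> (sum f I) = (\<Sum>i\<in>I. \<sigma> (f i))"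
  by (induction I rule: infinite_finite_induct) (auto simp: hom_zero hom_add sum_mem)

lemma hom_prod: "(\<And>i. i \<in> I \<Longrightarrow> f i \<in> R) \<Longrightarrow> \<sigma> (prod f I) = (\<Prod>i\<in>I. \<sigma> (f i))"
  by (induction I rule: infinite_finite_induct) (auto simp: hom_one hom_mult prod_mem)

lemma hom_power: "x \<in> R \<Longrightarrow> \<sigma> (x ^ n) = \<sigma> x ^ n"
  by (induction n) (auto simp: hom_one hom_mult power_mem)

lemma hom_of_nat: "\<sigma> (of_nat n) = of_nat n"
  by (induction n) (auto simp: hom_zero hom_one hom_add of_nat_mem one_mem)

lemma hom_of_int: "\<sigma> (of_int n) = of_int n"
  by (cases n rule: int_cases2) (auto simp: hom_of_nat hom_uminus of_nat_mem)

lemma hom_poly: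
  assumes "f \<in> polys_over R" "x \<in> R"
  shows "\<sigma> (poly f x) = poly (map_poly \<sigma> f) (\<sigma> x)"
proof -
  have "\<sigma> (\<Sum>i\<le>degree f. coeff f i * x ^ i) = (\<Sum>i\<le>degree f. \<sigma> (coeff f i) * \<sigma> x ^ i)"
    using assms by (simp add: hom_sum hom_mult hom_power mult_mem power_mem coeff_polys_over)
  then show ?thesis
    by (simp add: poly_map_poly_sum[of \<sigma>, OF hom_zero]) (simp add: poly_altdef)
qed

lemma subring_hom_map_poly: "subring_hom (polys_over R) (map_poly \<sigma>)"
proof (intro subring_hom.intro comm_subring_polys_over subring_hom_axioms.intro)
  fix f g assume fg: "f \<in> polys_over R" "g \<in> polys_over R"
  then have coeff: "coeff f i \<in> R" "coeff g i \<in> R" for i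
    by (auto intro: coeff_polys_over)
  show "map_poly \<sigma> (f + g) = map_poly \<sigma> f + map_poly \<sigma> g"
    by (intro poly_eqI) (simp add: coeff_map_poly hom_zero hom_add coeff)
  show "map_poly \<sigma> (f * g) = map_poly \<sigma> f * map_poly \<sigma> g"
    by (intro poly_eqI) (simp add: coeff_map_poly coeff_mult hom_zero hom_sum hom_mult mult_mem
      coeff)
qed (simp add: hom_one)

lemma map_poly_linear: "x \<in> R \<Longrightarrow> map_poly \<sigma> [:- x, 1:] = [:- \<sigma> x, 1:]"
  by (intro poly_eqI) (auto simp: coeff_map_poly coeff_pCons hom_zero hom_one hom_uminus
    split: nat.splits)

lemma map_poly_prod_linear:
  assumes "\<And>k. k \<in> A \<Longrightarrow> y k \<in> R"
  shows "map_poly \<sigma> (\<Prod>k\<in>A. [:- y k, 1:]) = (\<Prod>k\<in>A. [:- \<sigma> (y k), 1:])"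
proof -
  have "map_poly \<sigma> (\<Prod>k\<in>A. [:- y k, 1:]) = (\<Prod>k\<in>A. map_poly \<sigma> [:- y k, 1:])"
    using assms by (intro subring_hom.hom_prod[OF subring_hom_map_poly] linear_polys_over
      uminus_mem one_mem)
  also have "\<dots> = (\<Prod>k\<in>A. [:- \<sigma> (y k), 1:])"
    using assms by (intro prod.cong refl map_poly_linear)
  finally show ?thesis .
qed

end

section \<open>Indexed bases\<close>

locale indexed_module = Modules.module scale
  for scale :: "'a::comm_ring_1 \<Rightarrow> 'b::ab_group_add \<Rightarrow> 'b" (infixr "*s" 75)
begin

definition basis_family :: "'b set \<Rightarrow> nat \<Rightarrow> (nat \<Rightarrow> 'b) \<Rightarrow> bool" where
  "basis_family V n w \<longleftrightarrow> (\<forall>i<n. w i \<in> V) \<and> (\<forall>x\<in>V. \<exists>c. x = (\<Sum>i<n. c i *s w i)) \<and>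
     (\<forall>c. (\<Sum>i<n. c i *s w i) = 0 \<longrightarrow> (\<forall>i<n. c i = 0))"

lemma basis_familyI:
  assumes "\<And>i. i < n \<Longrightarrow> w i \<in> V" "\<And>x. x \<in> V \<Longrightarrow> \<exists>c. x = (\<Sum>i<n. c i *s w i)"
    "\<And>c i. (\<Sum>i<n. c i *s w i) = 0 \<Longrightarrow> i < n \<Longrightarrow> c i = 0"
  shows "basis_family V n w"
  using assms by (auto simp: basis_family_def)

lemma basis_familyD:
  assumes "basis_family V n w"
  shows "i < n \<Longrightarrow> w i \<in> V" "x \<in> V \<Longrightarrow> \<exists>c. x = (\<Sum>i<n. c i *s w i)"
    "(\<Sum>i<n. c i *s w i) = 0 \<Longrightarrow> i < n \<Longrightarrow> c i = 0"
  using assms by (auto simp: basis_family_def)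

lemma inj_on_if_independent_family:
  fixes n :: nat
  assumes "\<And>c i. (\<Sum>i<n. c i *s w i) = 0 \<Longrightarrow> i < n \<Longrightarrow> c i = 0"
  shows "inj_on w {..<n}"
proof (rule inj_onI, rule ccontr)
  fix i j assume ij: "i \<in> {..<n}" "j \<in> {..<n}" "w i = w j" "i \<noteq> j"
  let ?c = "\<lambda>k. (if k = i then 1 else 0) - (if k = j then 1 else 0) :: 'a"
  have "(\<Sum>k<n. ?c k *s w k) = (\<Sum>k<n. if k = i then w k else 0) - (\<Sum>k<n. if k = j then w k else 0)"
    unfolding sum_subtractf[symmetric] by (rule sum.cong) (auto simp: scale_left_diff_distrib)
  also have "\<dots> = 0"
    using ij by simp
  finally have "(\<Sum>k<n. ?c k *s w k) = 0" .
  from assms[OF this, of i] show False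
    using ij by simp
qed

lemma independent_image_iff:
  fixes n :: nat
  assumes "inj_on w {..<n}"
  shows "independent (w ` {..<n}) \<longleftrightarrow> (\<forall>c. (\<Sum>i<n. c i *s w i) = 0 \<longrightarrow> (\<forall>i<n. c i = 0))"
proof
  assume ind: "independent (w ` {..<n})"
  show "\<forall>c. (\<Sum>i<n. c i *s w i) = 0 \<longrightarrow> (\<forall>i<n. c i = 0)"
  proof (intro allI impI)
    fix c i assume c: "(\<Sum>i<n. c i *s w i) = 0" and i: "i < n"
    let ?u = "\<lambda>v. c (the_inv_into {..<n} w v)"
    have "(\<Sum>v\<in>w ` {..<n}. ?u v *s v) = 0"
      unfolding sum.reindex[OF assms] o_def c[symmetric] using assms
      by (intro sum.cong) (simp_all add: the_inv_into_f_f)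
    then have "?u (w i) = 0"
      using i by (intro independentD[OF ind]) auto
    then show "c i = 0"
      using i assms by (simp add: the_inv_into_f_f)
  qed
next
  assume zero: "\<forall>c. (\<Sum>i<n. c i *s w i) = 0 \<longrightarrow> (\<forall>i<n. c i = 0)"
  show "independent (w ` {..<n})"
  proof
    assume "dependent (w ` {..<n})"
    then obtain u i where u: "i < n" "u (w i) \<noteq> 0" "(\<Sum>v\<in>w ` {..<n}. u v *s v) = 0"
      by (subst (asm) dependent_finite) auto
    then have "(\<Sum>i<n. u (w i) *s w i) = 0"
      by (simp add: sum.reindex[OF assms])
    then have "\<forall>i<n. u (w i) = 0"
      by (rule zero[THEN spec, THEN mp])
    then show False
      using u by simp
  qed
qed

lemma basis_family_iff:
  assumes V: "subspace V"
  shows "basis_family V n w \<longleftrightarrow>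
    inj_on w {..<n} \<and> independent (w ` {..<n}) \<and> span (w ` {..<n}) = V"
proof (cases "inj_on w {..<n}")
  case False
  then show ?thesis
    using inj_on_if_independent_family[of w n] unfolding basis_family_def by blast
next
  case True
  have "span (w ` {..<n}) = range (\<lambda>u. \<Sum>i<n. u (w i) *s w i)"
    by (simp add: span_finite sum.reindex[OF True])
  also have "\<dots> = range (\<lambda>c. \<Sum>i<n. c i *s w i)"
  proof (intro subset_antisym image_subsetI)
    show "(\<Sum>i<n. c i *s w i) \<in> range (\<lambda>u. \<Sum>i<n. u (w i) *s w i)" for c
      using True by (intro range_eqI[of _ _ "\<lambda>v. c (the_inv_into {..<n} w v)"] sum.cong)
        (simp_all add: the_inv_into_f_f)
  qed (rule rangeI)
  finally have span: "span (w ` {..<n}) = range (\<lambda>c. \<Sum>i<n. c i *s w i)" .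
  have "span (w ` {..<n}) = V \<longleftrightarrow> (\<forall>i<n. w i \<in> V) \<and> (\<forall>x\<in>V. \<exists>c. x = (\<Sum>i<n. c i *s w i))"
  proof
    assume "span (w ` {..<n}) = V"
    then show "(\<forall>i<n. w i \<in> V) \<and> (\<forall>x\<in>V. \<exists>c. x = (\<Sum>i<n. c i *s w i))"
      using span span_superset[of "w ` {..<n}"] by auto
  next
    assume "(\<forall>i<n. w i \<in> V) \<and> (\<forall>x\<in>V. \<exists>c. x = (\<Sum>i<n. c i *s w i))"
    then show "span (w ` {..<n}) = V"
      using span span_minimal[OF _ V, of "w ` {..<n}"] by auto
  qed
  then show ?thesis
    unfolding basis_family_def using True independent_image_iff by auto
qed

end

locale indexed_vector_space = vector_space scale
  for scale :: "'a::field \<Rightarrow> 'b::ab_group_add \<Rightarrow> 'b" (infixr "*s" 75)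
begin

sublocale indexed_module
  by unfold_locales

lemma basis_family_dim:
  assumes "subspace V" "basis_family V n w"
  shows "dim V = n"
proof -
  have w: "inj_on w {..<n}" "independent (w ` {..<n})" "span (w ` {..<n}) = V"
    using assms basis_family_iff by blast+
  then have "span (w ` {..<n}) = span V"
    by (metis span_span)
  then have "dim V = card (w ` {..<n})"
    using w(2) by (rule dim_eq_card)
  then show ?thesis
    using w(1) by (simp add: card_image)
qed

lemma basis_family_if_independent:
  assumes V: "subspace V" and v: "basis_family V n v" and w: "\<And>i. i < n \<Longrightarrow> w i \<in> V"
    and ind: "\<And>c i. (\<Sum>i<n. c i *s w i) = 0 \<Longrightarrow> i < n \<Longrightarrow> c i = 0"
  shows "basis_family V n w"
proof -
  let ?B = "v ` {..<n}" and ?W = "w ` {..<n}"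
  have B: "inj_on v {..<n}" "span ?B = V"
    using v V basis_family_iff by blast+
  have inj: "inj_on w {..<n}"
    using ind by (rule inj_on_if_independent_family)
  then have W: "independent ?W"
    using ind independent_image_iff by blast
  have "V \<subseteq> span ?W"
  proof (rule ccontr)
    assume "\<not> V \<subseteq> span ?W"
    then obtain x where x: "x \<in> V" "x \<notin> span ?W"
      by blast
    have "independent (insert x ?W)"
      using x(2) W by (rule independent_insertI)
    moreover have "insert x ?W \<subseteq> span ?B"
      unfolding B(2) using x(1) w by blast
    ultimately have "card (insert x ?W) \<le> card ?B"
      using independent_span_bound[OF finite_imageI[OF finite_lessThan]] by blast
    moreover have "x \<notin> ?W"
      using x(2) span_base[of x ?W] by auto
    ultimately show False
      using inj B(1) by (simp add: card_image)
  qed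
  moreover have "span ?W \<subseteq> V"
    using w by (intro span_minimal V) auto
  ultimately show ?thesis
    using basis_family_iff[OF V] inj W by blast
qed

end

global_interpretation rat_vs: indexed_vector_space "\<lambda>(q::rat) (x::complex). of_rat q * x"
  by unfold_locales

global_interpretation int_mod: indexed_module "\<lambda>(k::int) (x::complex). of_int k * x"
  by unfold_locales

section \<open>Algebraic integers form a ring\<close>

lemma comm_subring_Ints: "comm_subring (\<int> :: 'a::comm_ring_1 set)"
  by unfold_locales auto

lemma comm_subring_Rats: "comm_subring (\<rat> :: complex set)"
  by unfold_locales auto

lemma polys_over_Ints_subset_Rats: "polys_over \<int> \<subseteq> (polys_over \<rat> :: complex poly set)"
  by (intro polys_over_mono) (auto elim!: Ints_cases)

lemma algebraic_int_iff_monic_root: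
  "algebraic_int x \<longleftrightarrow> (\<exists>f\<in>polys_over \<int>. lead_coeff f = 1 \<and> poly f x = 0)"
  by (auto simp: polys_over_def intro: algebraic_int.intros elim!: algebraic_int.cases)

lemma algebraic_int_integer_eigenvalue:
  fixes x :: complex and v :: "nat \<Rightarrow> complex" and A :: "nat \<Rightarrow> nat \<Rightarrow> int"
  assumes "\<And>i. i < n \<Longrightarrow> x * v i = (\<Sum>j<n. of_int (A i j) * v j)"
    and "k < n" "v k \<noteq> 0"
  shows "algebraic_int x"
proof -
  define B where "B = mat n n (\<lambda>(i, j). A i j)"
  define C where "C = (map_mat of_int B :: complex mat)"
  have B: "B \<in> carrier_mat n n" and C: "C \<in> carrier_mat n n"
    by (auto simp: B_def C_def)
  have "eigenvector C (vec n v) x"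
    unfolding eigenvector_def
  proof (intro conjI)
    show "vec n v \<in> carrier_vec (dim_row C)"
      using C by auto
    show "vec n v \<noteq> 0\<^sub>v (dim_row C)"
      using assms(2,3) C by (metis carrier_matD(1) index_vec index_zero_vec(1))
    show "C *\<^sub>v vec n v = x \<cdot>\<^sub>v vec n v"
      using assms(1) by (auto simp: C_def B_def scalar_prod_def atLeast0LessThan)
  qed
  then have "poly (char_poly C) x = 0"
    using eigenvalue_root_char_poly[OF C] by (auto simp: eigenvalue_def)
  moreover have "char_poly C = map_poly of_int (char_poly B)"
    unfolding C_def by (rule of_int_hom.char_poly_hom[OF B])
  moreover have "lead_coeff (char_poly B) = 1"
    using degree_monic_char_poly[OF B] by simp
  ultimately show ?thesis
    unfolding algebraic_int_altdef_ipoly by metis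
qed

definition stabilizes_int_span :: "complex \<Rightarrow> complex set \<Rightarrow> bool" where
  "stabilizes_int_span x V \<longleftrightarrow> (\<forall>v\<in>int_mod.span V. x * v \<in> int_mod.span V)"

lemma stabilizes_int_spanI:
  assumes "\<And>v. v \<in> V \<Longrightarrow> x * v \<in> int_mod.span V"
  shows "stabilizes_int_span x V"
  unfolding stabilizes_int_span_def
proof
  fix z assume "z \<in> int_mod.span V"
  then show "x * z \<in> int_mod.span V"
  proof (induction rule: int_mod.span_induct_alt)
    case base
    then show ?case
      by (simp add: int_mod.span_zero)
  next
    case (step c v y)
    then have "of_int c * (x * v) + x * y \<in> int_mod.span V"
      using assms by (intro int_mod.span_add int_mod.span_scale)
    then show ?case
      by (simp add: algebra_simps)
  qed
qed

lemma algebraic_int_if_stabilizes_int_span: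
  assumes V: "finite V" "1 \<in> V" and x: "stabilizes_int_span x V"
  shows "algebraic_int x"
proof -
  obtain v where v: "bij_betw v {..<card V} V"
    using V(1) ex_bij_betw_nat_finite atLeast0LessThan by metis
  have "\<exists>c. x * u = (\<Sum>w\<in>V. of_int (c w) * w)" if "u \<in> V" for u
    using x int_mod.span_base[OF that]
    unfolding stabilizes_int_span_def int_mod.span_finite[OF V(1)] by blast
  then obtain c where c: "\<And>u. u \<in> V \<Longrightarrow> x * u = (\<Sum>w\<in>V. of_int (c u w) * w)"
    by metis
  obtain k where k: "k < card V" "v k = 1"
    using v V(2) unfolding bij_betw_def by (metis imageE lessThan_iff)
  show ?thesis
  proof (rule algebraic_int_integer_eigenvalue[of "card V" x v "\<lambda>i j. c (v i) (v j)" k])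
    fix i assume "i < card V"
    then have "x * v i = (\<Sum>w\<in>V. of_int (c (v i) w) * w)"
      using v by (intro c) (auto simp: bij_betw_def)
    also have "\<dots> = (\<Sum>j<card V. of_int (c (v i) (v j)) * v j)"
      by (rule sum.reindex_bij_betw[OF v, symmetric])
    finally show "x * v i = (\<Sum>j<card V. of_int (c (v i) (v j)) * v j)" .
  qed (use k in auto)
qed

lemma algebraic_int_stabilizes_powers:
  assumes "algebraic_int (x :: complex)"
  obtains n where "stabilizes_int_span x ((\<lambda>i. x ^ i) ` {..<n})" "n > 0"
proof -
  obtain p where p: "poly (map_poly of_int p) x = 0" "lead_coeff p = 1"
    using assms unfolding algebraic_int_altdef_ipoly by blast
  let ?V = "(\<lambda>i. x ^ i) ` {..<degree p}"
  have "0 = (\<Sum>i\<le>degree p. of_int (coeff p i) * x ^ i)"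
    using p(1) by (simp add: poly_altdef degree_map_poly coeff_map_poly)
  also have "{..degree p} = insert (degree p) {..<degree p}"
    by auto
  finally have top: "x ^ degree p = (\<Sum>i<degree p. of_int (- coeff p i) * x ^ i)"
    using p(2) by (simp add: sum_negf eq_neg_iff_add_eq_0)
  have "x ^ i \<in> int_mod.span ?V" if "i \<le> degree p" for i
  proof (cases "i = degree p")
    case True
    show ?thesis
      unfolding True top by (intro int_mod.span_sum int_mod.span_scale int_mod.span_base) auto
  qed (use that in \<open>auto intro: int_mod.span_base\<close>)
  then have "stabilizes_int_span x ?V"
    by (intro stabilizes_int_spanI) (auto simp: Suc_leI simp flip: power_Suc)
  moreover have "degree p > 0"
    using p by (auto intro!: Nat.gr0I elim!: degree_eq_zeroE)
  ultimately show ?thesis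
    by (rule that)
qed

lemma stabilizes_int_span_products:
  assumes x: "stabilizes_int_span x V"
  shows "stabilizes_int_span x {v * w | v w. v \<in> V \<and> w \<in> W}" (is "stabilizes_int_span x ?VW")
proof (rule stabilizes_int_spanI)
  fix u assume "u \<in> ?VW"
  then obtain v w where vw: "v \<in> V" "w \<in> W" "u = v * w"
    by auto
  have "z * w \<in> int_mod.span ?VW" if "z \<in> int_mod.span V" for z
    using that
  proof (induction rule: int_mod.span_induct_alt)
    case base
    then show ?case
      by (simp add: int_mod.span_zero)
  next
    case (step c v y)
    then have "v * w \<in> ?VW"
      using vw(2) by blast
    then have "of_int c * (v * w) + y * w \<in> int_mod.span ?VW"
      using step(2) by (intro int_mod.span_add[OF int_mod.span_scale[OF int_mod.span_base]])
    then show ?case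
      by (simp add: algebra_simps)
  qed
  moreover have "x * v \<in> int_mod.span V"
    using x int_mod.span_base[OF vw(1)] by (auto simp: stabilizes_int_span_def)
  ultimately have "(x * v) * w \<in> int_mod.span ?VW"
    by blast
  then show "x * u \<in> int_mod.span ?VW"
    unfolding vw(3) mult.assoc .
qed

lemma algebraic_int_common_span:
  assumes "algebraic_int (x :: complex)" "algebraic_int y"
  obtains V where "finite V" "1 \<in> V" "stabilizes_int_span x V" "stabilizes_int_span y V"
proof -
  obtain n where n: "stabilizes_int_span x ((\<lambda>i. x ^ i) ` {..<n})" "n > 0"
    using algebraic_int_stabilizes_powers[OF assms(1)] .
  obtain m where m: "stabilizes_int_span y ((\<lambda>i. y ^ i) ` {..<m})" "m > 0"
    using algebraic_int_stabilizes_powers[OF assms(2)] .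
  let ?X = "(\<lambda>i. x ^ i) ` {..<n}" and ?Y = "(\<lambda>i. y ^ i) ` {..<m}"
  let ?V = "{v * w | v w. v \<in> ?X \<and> w \<in> ?Y}"
  have "?V = {w * v | w v. w \<in> ?Y \<and> v \<in> ?X}"
    using mult.commute by blast
  then have "stabilizes_int_span y ?V"
    using stabilizes_int_span_products[OF m(1), of ?X] by simp
  moreover have "1 \<in> ?V"
  proof (intro CollectI exI conjI)
    show "x ^ 0 \<in> ?X" "y ^ 0 \<in> ?Y"
      using n(2) m(2) by blast+
  qed simp
  moreover have "finite ?V"
    by (intro finite_image_set2) auto
  ultimately show ?thesis
    using stabilizes_int_span_products[OF n(1), of ?Y] that by blast
qed

lemma comm_subring_algebraic_ints: "comm_subring {x :: complex. algebraic_int x}"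
proof
  fix x y :: complex assume "x \<in> {x. algebraic_int x}" "y \<in> {x. algebraic_int x}"
  then obtain V where V: "finite V" "1 \<in> V" "stabilizes_int_span x V" "stabilizes_int_span y V"
    using algebraic_int_common_span by blast
  then have "stabilizes_int_span (x - y) V" "stabilizes_int_span (x * y) V"
    unfolding stabilizes_int_span_def
    by (auto simp: left_diff_distrib mult.assoc intro: int_mod.span_diff)
  then show "x - y \<in> {x. algebraic_int x}" "x * y \<in> {x. algebraic_int x}"
    using V(1,2) algebraic_int_if_stabilizes_int_span by auto
qed simp

section \<open>Minimal polynomials and primitive elements\<close>

lemma complex_subfield_hull: "complex_subfield (complex_subfield hull S)"
  by (rule hull_in) (auto simp: complex_subfield_def)

lemma complex_subfield_comm_subring: "complex_subfield F \<Longrightarrow> comm_subring F"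
proof (unfold_locales, goal_cases)
  case (2 x y)
  then have "x + - y \<in> F"
    unfolding complex_subfield_def by blast
  then show ?case
    by simp
qed (auto simp: complex_subfield_def)

lemma complex_subfield_inverse: "complex_subfield F \<Longrightarrow> x \<in> F \<Longrightarrow> inverse x \<in> F"
  by (simp add: complex_subfield_def)

lemma Rats_subset_complex_subfield:
  assumes F: "complex_subfield F"
  shows "\<rat> \<subseteq> F"
proof
  interpret comm_subring F
    using F by (rule complex_subfield_comm_subring)
  fix x :: complex assume "x \<in> \<rat>"
  then obtain a b where "x = of_int a * inverse (of_int b)"
    by (auto elim!: Rats_cases' simp: divide_inverse)
  then show "x \<in> F"
    using complex_subfield_inverse[OF F] by (auto intro: mult_mem of_int_mem)
qed

lemma complex_subfield_Rats: "complex_subfield \<rat>"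
  by (auto simp: complex_subfield_def)

definition minimal_poly :: "complex set \<Rightarrow> complex \<Rightarrow> complex poly \<Rightarrow> bool" where
  "minimal_poly F x g \<longleftrightarrow> g \<in> polys_over F \<and> lead_coeff g = 1 \<and> poly g x = 0 \<and>
     (\<forall>h\<in>polys_over F. h \<noteq> 0 \<longrightarrow> poly h x = 0 \<longrightarrow> degree g \<le> degree h)"

lemma minimal_polyD:
  assumes "minimal_poly F x g"
  shows "g \<in> polys_over F" "lead_coeff g = 1" "poly g x = 0" "degree g > 0"
    and "h \<in> polys_over F \<Longrightarrow> poly h x = 0 \<Longrightarrow> degree h < degree g \<Longrightarrow> h = 0"
  using assms unfolding minimal_poly_def by (auto intro!: Nat.gr0I elim!: degree_eq_zeroE)

lemma ex_minimal_poly: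
  assumes F: "complex_subfield F" and f: "f \<in> polys_over F" "f \<noteq> 0" "poly f x = 0"
  shows "\<exists>g. minimal_poly F x g"
proof -
  interpret comm_subring F
    using F by (rule complex_subfield_comm_subring)
  let ?P = "\<lambda>h. h \<in> polys_over F \<and> h \<noteq> 0 \<and> poly h x = 0"
  define h where "h = arg_min degree ?P"
  have h: "?P h"
    using arg_min_natI[of ?P f degree] f unfolding h_def by blast
  have "degree h \<le> degree k" if "?P k" for k
    unfolding h_def by (rule arg_min_nat_le) (rule that)
  then show ?thesis
    using h F unfolding minimal_poly_def
    by (intro exI[of _ "smult (inverse (lead_coeff h)) h"])
      (auto intro!: smult_polys_over complex_subfield_inverse coeff_polys_over)
qed

lemma minimal_poly_dvd:
  assumes F: "complex_subfield F" and g: "minimal_poly F x g"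
    and h: "h \<in> polys_over F" "poly h x = 0"
  shows "\<exists>s\<in>polys_over F. h = g * s"
proof -
  interpret comm_subring F
    using F by (rule complex_subfield_comm_subring)
  obtain s r where sr: "s \<in> polys_over F" "r \<in> polys_over F" "h = g * s + r" "degree r < degree g"
    using monic_division[OF minimal_polyD(1,2,4)[OF g] h(1)] by blast
  have "poly r x = 0"
    using sr(3) h(2) minimal_polyD(3)[OF g] by simp
  then have "r = 0"
    using sr minimal_polyD(5)[OF g] by blast
  then show ?thesis
    using sr by auto
qed

lemma minimal_poly_other_root:
  assumes F: "complex_subfield F" and g: "minimal_poly F x g" and z: "poly g z = 0"
  shows "minimal_poly F z g"
proof -
  note gD = minimal_polyD[OF g]
  have "g \<noteq> 0"
    using gD(2) by auto
  then obtain k where k: "minimal_poly F z k"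
    using ex_minimal_poly[OF F gD(1) _ z] by blast
  obtain s where s: "s \<in> polys_over F" "g = k * s"
    using minimal_poly_dvd[OF F k gD(1) z] by blast
  have nz: "k \<noteq> 0" "s \<noteq> 0"
    using s(2) \<open>g \<noteq> 0\<close> by auto
  then have "degree s < degree g"
    unfolding s(2) using minimal_polyD(4)[OF k] by (simp add: degree_mult_eq)
  then have "poly s x \<noteq> 0"
    using gD(5)[OF s(1)] nz by blast
  then have "poly k x = 0"
    using gD(3) s(2) by simp
  then have "degree g \<le> degree k"
    using gD(5)[OF minimal_polyD(1)[OF k]] nz by force
  then show ?thesis
    using g k z unfolding minimal_poly_def by (meson order_trans)
qed

lemma card_roots_minimal_poly:
  assumes F: "complex_subfield F" and g: "minimal_poly F x g"
  shows "card {z. poly g z = 0} = degree g"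
proof -
  have "poly (pderiv g) z \<noteq> 0" if "poly g z = 0" for z
  proof
    assume "poly (pderiv g) z = 0"
    moreover have "pderiv g \<noteq> 0" and "degree (pderiv g) < degree g"
      using minimal_polyD(4)[OF g] by (auto simp: pderiv_eq_0_iff degree_pderiv)
    moreover have "pderiv g \<in> polys_over F"
      using complex_subfield_comm_subring[OF F] minimal_polyD(1)[OF g] by (rule pderiv_polys_over)
    ultimately show False
      using minimal_polyD(5)[OF minimal_poly_other_root[OF F g that]] by blast
  qed
  then have "rsquarefree g"
    unfolding rsquarefree_roots by blast
  then have "g = (\<Prod>z|poly g z = 0. [:- z, 1:])"
    using complex_poly_decompose_rsquarefree[of g] minimal_polyD(2)[OF g] by simp
  then have "degree g = degree (\<Prod>z|poly g z = 0. [:- z, 1:])"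
    by simp
  also have "\<dots> = card {z. poly g z = 0}"
    by (subst degree_prod_eq_sum_degree) auto
  finally show ?thesis ..
qed

lemma minimal_poly_unique_root:
  assumes F: "complex_subfield F" and g: "minimal_poly F x g" and unique: "\<And>z. poly g z = 0 \<Longrightarrow> z = x"
  shows "x \<in> F"
proof -
  interpret comm_subring F
    using F by (rule complex_subfield_comm_subring)
  have "{z. poly g z = 0} = {x}"
    using unique minimal_polyD(3)[OF g] by blast
  then have "degree g = 1"
    using card_roots_minimal_poly[OF F g] by simp
  then obtain a b where "g = [:a, b:]"
    by (elim degree1_coeffs)
  then have "b = 1" "a = - x" "a \<in> F"
    using minimal_polyD(1-3)[OF g]
    by (auto simp: pCons_polys_over_iff eq_neg_iff_add_eq_0 split: if_splits)
  then show ?thesis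
    using uminus_mem[of a] by simp
qed

lemma mem_if_unique_common_root:
  assumes F: "complex_subfield F" and g: "g \<in> polys_over F" "g \<noteq> 0" "poly g x = 0"
    and h: "h \<in> polys_over F" "poly h x = 0"
    and unique: "\<And>z. poly g z = 0 \<Longrightarrow> poly h z = 0 \<Longrightarrow> z = x"
  shows "x \<in> F"
proof -
  obtain q where q: "minimal_poly F x q"
    using ex_minimal_poly[OF F g] by blast
  obtain s s' where "g = q * s" "h = q * s'"
    using minimal_poly_dvd[OF F q g(1,3)] minimal_poly_dvd[OF F q h] by blast
  then have "z = x" if "poly q z = 0" for z
    using that by (intro unique) simp_all
  then show ?thesis
    by (rule minimal_poly_unique_root[OF F q])
qed

text \<open>The choice of \<open>c\<close> excludes common roots of \<open>g\<close> and \<open>f (a + c b - c X)\<close> other than \<open>b\<close>.\<close>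

lemma primitive_element_two:
  assumes "algebraic a" "algebraic b"
  obtains c :: int where "{a, b} \<subseteq> complex_subfield hull {a + of_int c * b}"
proof -
  obtain f g where f: "f \<in> polys_over \<int>" "f \<noteq> 0" "poly f a = 0"
    and g: "g \<in> polys_over \<int>" "g \<noteq> 0" "poly g b = 0"
    using assms by (auto simp: algebraic_def polys_over_def)
  define bad where "bad = (\<lambda>(u, v). (u - a) / (b - v)) ` ({u. poly f u = 0} \<times> {v. poly g v = 0})"
  have "finite ((of_int :: int \<Rightarrow> complex) -` bad)"
    unfolding bad_def using f g
    by (intro finite_vimageI finite_imageI finite_cartesian_product poly_roots_finite)
      (auto intro: injI)
  then obtain c :: int where c: "of_int c \<notin> bad"
    using infinite_UNIV_int by (metis ex_new_if_finite vimage_eq)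
  define \<gamma> where "\<gamma> = a + of_int c * b"
  define F where "F = complex_subfield hull {\<gamma>}"
  have F: "complex_subfield F"
    unfolding F_def by (rule complex_subfield_hull)
  interpret comm_subring F
    using F by (rule complex_subfield_comm_subring)
  have \<gamma>: "\<gamma> \<in> F"
    unfolding F_def by (simp add: hull_inc)
  have fg: "f \<in> polys_over F" "g \<in> polys_over F"
    using f g polys_over_mono[OF Ints_subset] by blast+
  define h where "h = pcompose f [:\<gamma>, - of_int c:]"
  have h: "poly h z = poly f (\<gamma> - of_int c * z)" for z
    by (simp add: h_def poly_pcompose mult.commute)
  have "b \<in> F"
  proof (rule mem_if_unique_common_root[OF F fg(2) g(2,3)])
    show "h \<in> polys_over F"
      unfolding h_def using fg \<gamma>
      by (intro pcompose_polys_over linear_polys_over uminus_mem of_int_mem)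
    show "poly h b = 0"
      using f(3) by (simp add: h \<gamma>_def)
    show "z = b" if z: "poly g z = 0" "poly h z = 0" for z
    proof (rule ccontr)
      assume "z \<noteq> b"
      then have "of_int c = ((\<gamma> - of_int c * z) - a) / (b - z)"
        by (simp add: \<gamma>_def field_simps)
      then have "of_int c \<in> bad"
        unfolding bad_def using z by (intro image_eqI[of _ _ "(\<gamma> - of_int c * z, z)"])
          (auto simp: h)
      then show False
        using c by simp
    qed
  qed
  moreover from this have "\<gamma> - of_int c * b \<in> F"
    using \<gamma> by (intro diff_mem mult_mem of_int_mem)
  ultimately show ?thesis
    by (intro that[of c]) (simp add: F_def \<gamma>_def)
qed

lemma primitive_element:
  assumes "finite S" "\<And>x. x \<in> S \<Longrightarrow> algebraic_int x"
  shows "\<exists>\<theta>. algebraic_int \<theta> \<and> complex_subfield hull {\<theta>} = complex_subfield hull S"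
  using assms
proof (induction S rule: finite_induct)
  case empty
  have "0 \<in> complex_subfield hull {}"
    using complex_subfield_hull[of "{}"] by (simp add: complex_subfield_def)
  then have "complex_subfield hull {0} = complex_subfield hull {}"
    by (rule hull_redundant)
  then show ?case
    by (intro exI[of _ 0]) auto
next
  case (insert x S)
  then obtain \<theta> where \<theta>: "algebraic_int \<theta>" "complex_subfield hull {\<theta>} = complex_subfield hull S"
    by auto
  obtain c :: int where c: "{\<theta>, x} \<subseteq> complex_subfield hull {\<theta> + of_int c * x}"
    using primitive_element_two[of \<theta> x] \<theta>(1) insert.prems by auto
  interpret A: comm_subring "{x :: complex. algebraic_int x}"
    by (rule comm_subring_algebraic_ints)
  interpret L: comm_subring "complex_subfield hull {\<theta>, x}"
    by (intro complex_subfield_comm_subring complex_subfield_hull)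
  have "\<theta> + of_int c * x \<in> complex_subfield hull {\<theta>, x}"
    by (intro L.add_mem L.mult_mem L.of_int_mem hull_inc) auto
  then have "complex_subfield hull {\<theta> + of_int c * x} = complex_subfield hull {\<theta>, x}"
    using c by (intro subset_antisym hull_minimal complex_subfield_hull) auto
  also have "\<dots> = complex_subfield hull (insert x S)"
    using \<theta>(2) hull_insert[of complex_subfield x "{\<theta>}"] hull_insert[of complex_subfield x S]
    by (simp add: insert_commute)
  finally have "complex_subfield hull {\<theta> + of_int c * x} = complex_subfield hull (insert x S)" .
  moreover have "\<theta> + of_int c * x \<in> {x. algebraic_int x}"
    using \<theta>(1) insert.prems by (intro A.add_mem A.mult_mem A.of_int_mem) auto
  ultimately show ?case
    by blast
qed

lemma ex_multiple_of_smaller_degree: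
  assumes F: "complex_subfield F" and g: "minimal_poly F x g"
    and h: "h \<in> polys_over F" "poly h x \<noteq> 0" "degree h > 0"
  shows "\<exists>k\<in>polys_over F. \<exists>r\<in>polys_over F.
    degree r < degree h \<and> poly r x \<noteq> 0 \<and> poly r x = poly h x * poly k x"
proof (cases "degree h \<ge> degree g")
  case True
  interpret comm_subring F
    using F by (rule complex_subfield_comm_subring)
  obtain s r where sr: "r \<in> polys_over F" "h = g * s + r" "degree r < degree g"
    using monic_division[OF minimal_polyD(1,2,4)[OF g] h(1)] by blast
  then have "poly r x = poly h x"
    using minimal_polyD(3)[OF g] by simp
  then have "degree r < degree h \<and> poly r x \<noteq> 0 \<and> poly r x = poly h x * poly 1 x"
    using sr True h(2) by auto
  then show ?thesis
    using sr(1) comm_subring.one_mem[OF comm_subring_polys_over] by blast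
next
  case False
  interpret comm_subring F
    using F by (rule complex_subfield_comm_subring)
  note gD = minimal_polyD[OF g]
  define a where "a = inverse (lead_coeff h)"
  have a: "a \<in> F" "a \<noteq> 0"
    using h complex_subfield_inverse[OF F] coeff_polys_over by (auto simp: a_def)
  have ah: "smult a h \<in> polys_over F" "lead_coeff (smult a h) = 1" "degree (smult a h) = degree h"
    using a h by (auto simp: a_def intro: smult_polys_over)
  obtain s r where sr: "s \<in> polys_over F" "r \<in> polys_over F" "g = smult a h * s + r"
    "degree r < degree h"
    using monic_division[OF ah(1,2) _ gD(1)] ah(3) h(3) by auto
  have "s \<noteq> 0"
    using sr(3,4) False by auto
  then have "degree (smult a h * s) = degree h + degree s"
    using h a by (subst degree_mult_eq) auto
  then have "degree g = degree h + degree s"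
    unfolding sr(3) using sr(4) by (subst degree_add_eq_left) auto
  then have "poly s x \<noteq> 0"
    using gD(5)[OF sr(1)] \<open>s \<noteq> 0\<close> h(3) by linarith
  moreover have "poly r x = poly h x * poly (smult (- a) s) x"
    using gD(3) unfolding sr(3) by (simp add: eq_neg_iff_add_eq_0 add.commute mult.left_commute)
  moreover from calculation have "poly r x \<noteq> 0"
    using a(2) h(2) by simp
  moreover have "smult (- a) s \<in> polys_over F"
    using a(1) sr(1) by (intro smult_polys_over uminus_mem)
  ultimately show ?thesis
    using sr(2,4) by blast
qed

lemma ex_inverse_poly:
  assumes F: "complex_subfield F" and g: "minimal_poly F x g"
    and h: "h \<in> polys_over F" "poly h x \<noteq> 0"
  shows "\<exists>k\<in>polys_over F. poly h x * poly k x = 1"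
  using h
proof (induction "degree h" arbitrary: h rule: less_induct)
  case less
  interpret comm_subring F
    using F by (rule complex_subfield_comm_subring)
  interpret polys: comm_subring "polys_over F"
    by (rule comm_subring_polys_over)
  show ?case
  proof (cases "degree h = 0")
    case True
    then obtain c where c: "h = [:c:]"
      by (elim degree_eq_zeroE)
    then have "inverse c \<in> F" "c \<noteq> 0"
      using less.prems complex_subfield_inverse[OF F] by (auto simp: pCons_polys_over_iff)
    then show ?thesis
      by (intro bexI[of _ "[:inverse c:]"]) (auto simp: c pCons_polys_over_iff polys.zero_mem)
  next
    case False
    then obtain k r where k: "k \<in> polys_over F" and r: "r \<in> polys_over F" "degree r < degree h"
        "poly r x \<noteq> 0" "poly r x = poly h x * poly k x"
      using ex_multiple_of_smaller_degree[OF F g less.prems] by blast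
    then obtain l where l: "l \<in> polys_over F" "poly r x * poly l x = 1"
      using less.hyps by blast
    then have "poly h x * poly (k * l) x = 1"
      by (simp add: r(4) mult.assoc)
    then show ?thesis
      using k l(1) by (intro bexI[of _ "k * l"] polys.mult_mem)
  qed
qed

lemma algebraic_ex_minimal_poly:
  assumes "algebraic x"
  shows "\<exists>g. minimal_poly \<rat> x g"
proof -
  obtain f where "f \<in> polys_over \<int>" "f \<noteq> 0" "poly f x = 0"
    using assms by (auto simp: algebraic_def polys_over_def)
  then show ?thesis
    using polys_over_Ints_subset_Rats
    by (intro ex_minimal_poly[OF complex_subfield_Rats, of f]) auto
qed

lemma complex_subfield_polys_over_Rats_image:
  assumes x: "algebraic x"
  shows "complex_subfield ((\<lambda>h. poly h x) ` polys_over \<rat>)" (is "complex_subfield ?L")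
proof -
  interpret Q: comm_subring "\<rat> :: complex set"
    by (rule comm_subring_Rats)
  interpret QX: comm_subring "polys_over (\<rat> :: complex set)"
    by (rule Q.comm_subring_polys_over)
  have inverse: "inverse (poly h x) \<in> ?L" if h: "h \<in> polys_over \<rat>" for h
  proof (cases "poly h x = 0")
    case True
    then show ?thesis
      using h by (intro image_eqI[of _ _ h]) auto
  next
    case False
    obtain g where "minimal_poly \<rat> x g"
      using algebraic_ex_minimal_poly[OF x] by blast
    then obtain k where "k \<in> polys_over \<rat>" "poly h x * poly k x = 1"
      using ex_inverse_poly[OF complex_subfield_Rats _ h False] by blast
    then show ?thesis
      using inverse_unique by blast
  qed
  show ?thesis
    unfolding complex_subfield_def ball_simps
  proof (intro conjI ballI inverse)
    show "0 \<in> ?L" "1 \<in> ?L"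
      using image_eqI[OF _ QX.zero_mem, of 0 "\<lambda>h. poly h x"]
        image_eqI[OF _ QX.one_mem, of 1 "\<lambda>h. poly h x"]
      by simp_all
    fix f g :: "complex poly" assume fg: "f \<in> polys_over \<rat>" "g \<in> polys_over \<rat>"
    show "poly f x + poly g x \<in> ?L" "poly f x * poly g x \<in> ?L" "- poly f x \<in> ?L"
      using fg QX.add_mem QX.mult_mem QX.uminus_mem
      by (auto simp flip: poly_add poly_mult poly_minus)
  qed
qed

lemma complex_subfield_hull_singleton:
  assumes x: "algebraic x"
  shows "complex_subfield hull {x} = (\<lambda>h. poly h x) ` polys_over \<rat>" (is "?K = ?L")
proof (rule subset_antisym)
  interpret Q: comm_subring "\<rat> :: complex set"
    by (rule comm_subring_Rats)
  interpret K: comm_subring ?K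
    by (intro complex_subfield_comm_subring complex_subfield_hull)
  have "polys_over \<rat> \<subseteq> polys_over ?K"
    by (intro polys_over_mono Rats_subset_complex_subfield complex_subfield_hull)
  then show "?L \<subseteq> ?K"
    using hull_inc[of x "{x}" complex_subfield] by (auto intro: K.poly_mem)
  have "x \<in> ?L"
    using Q.linear_polys_over[of 0 1] by (intro image_eqI[of _ _ "[:0, 1:]"]) auto
  then show "?K \<subseteq> ?L"
    using complex_subfield_polys_over_Rats_image[OF x] by (intro hull_minimal) auto
qed

section \<open>The Galois group of a splitting field\<close>

locale subfield_hom = subring_hom K \<sigma> for K :: "complex set" and \<sigma> :: "complex \<Rightarrow> complex" +
  assumes subfield: "complex_subfield K"
begin

lemma hom_inverse: "x \<in> K \<Longrightarrow> \<sigma> (inverse x) = inverse (\<sigma> x)"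
proof (cases "x = 0")
  case False
  assume "x \<in> K"
  moreover from this have "inverse x \<in> K"
    using subfield by (intro complex_subfield_inverse)
  ultimately have "\<sigma> x * \<sigma> (inverse x) = 1"
    using False by (simp add: hom_one flip: hom_mult)
  then show ?thesis
    by (metis inverse_unique)
qed (simp add: hom_zero)

lemma hom_Rats: "x \<in> \<rat> \<Longrightarrow> \<sigma> x = x"
  using of_int_mem complex_subfield_inverse[OF subfield of_int_mem]
  by (auto elim!: Rats_cases' simp: divide_inverse hom_mult hom_of_int hom_inverse)

lemma hom_poly_Rats:
  assumes "h \<in> polys_over \<rat>" "x \<in> K"
  shows "\<sigma> (poly h x) = poly h (\<sigma> x)"
proof -
  have "map_poly \<sigma> h = h"
    using assms(1) by (intro poly_eqI) (simp add: coeff_map_poly hom_zero hom_Rats coeff_polys_over)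
  then show ?thesis
    using assms polys_over_mono[OF Rats_subset_complex_subfield[OF subfield]] hom_poly[of h x]
    by auto
qed

lemma inj_on_hom: "inj_on \<sigma> K"
proof (rule inj_onI, rule ccontr)
  fix x y assume xy: "x \<in> K" "y \<in> K" "\<sigma> x = \<sigma> y" "x \<noteq> y"
  then have "x - y \<in> K" "\<sigma> (x - y) = 0"
    by (simp_all add: hom_diff diff_mem)
  then have "\<sigma> ((x - y) * inverse (x - y)) = 0"
    using complex_subfield_inverse[OF subfield] by (simp only: hom_mult mult_zero_left)
  then show False
    using xy(4) hom_one by simp
qed

lemma hom_algebraic_int:
  assumes "x \<in> K" "algebraic_int x"
  shows "algebraic_int (\<sigma> x)"
proof -
  obtain f where f: "f \<in> polys_over \<int>" "lead_coeff f = 1" "poly f x = 0"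
    using assms(2) algebraic_int_iff_monic_root by blast
  then have "poly f (\<sigma> x) = 0"
    using assms polys_over_Ints_subset_Rats hom_poly_Rats[of f x] hom_zero by auto
  then show ?thesis
    using f algebraic_int_iff_monic_root by blast
qed

end

locale splitting_field =
  fixes C :: "complex poly" and K :: "complex set"
  assumes C_Ints: "C \<in> polys_over \<int>" and monic_C: "lead_coeff C = 1"
    and K_hull: "K = complex_subfield hull {z. poly C z = 0}"
begin

lemma K_subfield: "complex_subfield K"
  unfolding K_hull by (rule complex_subfield_hull)

sublocale K: comm_subring K
  using K_subfield by (rule complex_subfield_comm_subring)

lemma Rats_subset_K: "\<rat> \<subseteq> K"
  using K_subfield by (rule Rats_subset_complex_subfield)

lemma of_rat_mem_K: "of_rat q \<in> K"
  using Rats_subset_K by auto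

lemma root_mem_K: "poly C z = 0 \<Longrightarrow> z \<in> K"
  unfolding K_hull by (intro hull_inc) simp

lemma C_Rats: "C \<in> polys_over \<rat>"
  using C_Ints polys_over_Ints_subset_Rats by blast

lemma algebraic_int_root: "poly C z = 0 \<Longrightarrow> algebraic_int z"
  using C_Ints monic_C algebraic_int_iff_monic_root by blast

lemma ex_primitive: "\<exists>\<theta>. algebraic_int \<theta> \<and> complex_subfield hull {\<theta>} = K"
  unfolding K_hull using monic_C
  by (intro primitive_element poly_roots_finite) (auto simp: algebraic_int_root)

definition \<theta> :: complex where
  "\<theta> = (SOME \<theta>. algebraic_int \<theta> \<and> complex_subfield hull {\<theta>} = K)"

lemma algebraic_int_\<theta>: "algebraic_int \<theta>" and hull_\<theta>: "complex_subfield hull {\<theta>} = K"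
  using someI_ex[OF ex_primitive] unfolding \<theta>_def by blast+

lemma \<theta>_mem_K: "\<theta> \<in> K"
  using hull_inc[of \<theta> "{\<theta>}" complex_subfield] hull_\<theta> by simp

lemma K_eq: "K = (\<lambda>h. poly h \<theta>) ` polys_over \<rat>"
  using complex_subfield_hull_singleton[of \<theta>] algebraic_int_\<theta> hull_\<theta> by auto

definition minpoly :: "complex poly" where
  "minpoly = (SOME g. minimal_poly \<rat> \<theta> g)"

definition m :: nat where
  "m = degree minpoly"

lemma minimal_poly_minpoly: "minimal_poly \<rat> \<theta> minpoly"
  unfolding minpoly_def by (rule someI_ex) (use algebraic_ex_minimal_poly algebraic_int_\<theta> in blast)

lemma m_pos: "m > 0"
  unfolding m_def using minimal_poly_minpoly by (rule minimal_polyD(4))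

interpretation Q: comm_subring "\<rat> :: complex set"
  by (rule comm_subring_Rats)

interpretation QX: comm_subring "polys_over (\<rat> :: complex set)"
  by (rule Q.comm_subring_polys_over)

lemma K_reduced_poly:
  assumes "x \<in> K"
  obtains h where "h \<in> polys_over \<rat>" "degree h < m" "x = poly h \<theta>"
proof -
  obtain h where h: "h \<in> polys_over \<rat>" "x = poly h \<theta>"
    using equalityD1[OF K_eq] assms by auto
  obtain s r where "r \<in> polys_over \<rat>" "h = minpoly * s + r" "degree r < m"
    using Q.monic_division[OF minimal_polyD(1,2,4)[OF minimal_poly_minpoly] h(1)] unfolding m_def
    by blast
  then show ?thesis
    using h that[of r] minimal_polyD(3)[OF minimal_poly_minpoly] by simp
qed

lemma poly_\<theta>_mem_K: "h \<in> polys_over \<rat> \<Longrightarrow> poly h \<theta> \<in> K"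
  using equalityD2[OF K_eq] by auto

lemma rat_subspace_K: "rat_vs.subspace K"
  unfolding rat_vs.subspace_def by (simp add: K.zero_mem K.add_mem K.mult_mem of_rat_mem_K)

lemma basis_family_powers: "rat_vs.basis_family K m (\<lambda>i. \<theta> ^ i)"
proof (rule rat_vs.basis_familyI)
  show "\<theta> ^ i \<in> K" for i
    by (intro K.power_mem \<theta>_mem_K)
  show "\<exists>q. x = (\<Sum>i<m. of_rat (q i) * \<theta> ^ i)" if "x \<in> K" for x
  proof -
    obtain h where h: "h \<in> polys_over \<rat>" "degree h < m" "x = poly h \<theta>"
      using \<open>x \<in> K\<close> by (rule K_reduced_poly)
    then have "\<exists>q. coeff h i = of_rat q" for i
      by (auto simp: polys_over_def elim: Rats_cases)
    then obtain q where q: "\<And>i. coeff h i = of_rat (q i)"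
      by metis
    have "x = (\<Sum>i<m. coeff h i * \<theta> ^ i)"
      unfolding h(3) poly_altdef using h(2) by (intro sum.mono_neutral_left) (auto simp: coeff_eq_0)
    then show ?thesis
      unfolding q by blast
  qed
  show "q i = 0" if q: "(\<Sum>i<m. of_rat (q i) * \<theta> ^ i) = 0" and i: "i < m" for q i
  proof -
    define h where "h = (\<Sum>i<m. monom (of_rat (q i) :: complex) i)"
    have coeff_h: "coeff h i = (if i < m then of_rat (q i) else 0)" for i
      by (simp add: h_def coeff_sum)
    have "poly h \<theta> = 0"
      using q by (simp add: h_def poly_sum poly_monom)
    moreover have "h \<in> polys_over \<rat>"
      by (auto simp: polys_over_def coeff_h)
    moreover have "degree h < m"
      using m_pos by (intro degree_lessI) (auto simp: coeff_h)
    ultimately have "h = 0"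
      using minimal_polyD(5)[OF minimal_poly_minpoly] by (simp add: m_def)
    then show ?thesis
      using coeff_h[of i] i by simp
  qed
qed

lemma dim_K: "rat_vs.dim K = m"
  using rat_subspace_K basis_family_powers by (rule rat_vs.basis_family_dim)

text \<open>Automorphisms are extended by the identity outside \<open>K\<close>, so that they compose as
  plain functions.\<close>

definition Gal :: "(complex \<Rightarrow> complex) set" where
  "Gal = {\<sigma>. subfield_hom K \<sigma> \<and> (\<forall>x. x \<notin> K \<longrightarrow> \<sigma> x = x)}"

lemma Gal_hom: "\<sigma> \<in> Gal \<Longrightarrow> subfield_hom K \<sigma>"
  and Gal_outside: "\<sigma> \<in> Gal \<Longrightarrow> x \<notin> K \<Longrightarrow> \<sigma> x = x"
  by (simp_all add: Gal_def)

lemma Gal_poly: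
  assumes "\<sigma> \<in> Gal" "h \<in> polys_over \<rat>" "x \<in> K"
  shows "\<sigma> (poly h x) = poly h (\<sigma> x)"
  using subfield_hom.hom_poly_Rats[OF Gal_hom] assms by blast

lemma Gal_root:
  assumes "\<sigma> \<in> Gal" "h \<in> polys_over \<rat>" "x \<in> K" "poly h x = 0"
  shows "poly h (\<sigma> x) = 0"
proof -
  interpret subfield_hom K \<sigma>
    using assms(1) by (rule Gal_hom)
  show ?thesis
    using hom_poly_Rats[OF assms(2,3)] assms(4) hom_zero by simp
qed

lemma Gal_mem_K:
  assumes \<sigma>: "\<sigma> \<in> Gal" and "x \<in> K"
  shows "\<sigma> x \<in> K"
proof -
  interpret subfield_hom K \<sigma>
    using \<sigma> by (rule Gal_hom)
  have "complex_subfield {x \<in> K. \<sigma> x \<in> K}"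
    using K_subfield unfolding complex_subfield_def
    by (auto simp: hom_zero hom_one hom_add hom_mult hom_uminus hom_inverse)
  then have "complex_subfield hull {z. poly C z = 0} \<subseteq> {x \<in> K. \<sigma> x \<in> K}"
    using root_mem_K Gal_root[OF \<sigma> C_Rats] by (intro hull_minimal) auto
  then show ?thesis
    using assms(2) K_hull by auto
qed

lemma Gal_eqI:
  assumes "\<sigma> \<in> Gal" "\<tau> \<in> Gal" "\<sigma> \<theta> = \<tau> \<theta>"
  shows "\<sigma> = \<tau>"
proof
  fix x
  show "\<sigma> x = \<tau> x"
  proof (cases "x \<in> K")
    case True
    then obtain h where "h \<in> polys_over \<rat>" "x = poly h \<theta>"
      by (rule K_reduced_poly)
    then show ?thesis
      using assms Gal_poly[OF _ _ \<theta>_mem_K] by metis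
  qed (use assms in \<open>simp add: Gal_outside\<close>)
qed

lemma poly_eq_at_conjugate:
  assumes z: "poly minpoly z = 0"
    and fg: "f \<in> polys_over \<rat>" "g \<in> polys_over \<rat>" "poly f \<theta> = poly g \<theta>"
  shows "poly f z = poly g z"
proof -
  obtain s where "f - g = minpoly * s"
    using minimal_poly_dvd[OF complex_subfield_Rats minimal_poly_minpoly, of "f - g"] fg
      QX.diff_mem by auto
  then have "poly (f - g) z = 0"
    using z by simp
  then show ?thesis
    by simp
qed

lemma ex_Gal:
  assumes z: "poly minpoly z = 0"
  shows "\<exists>\<sigma>\<in>Gal. \<sigma> \<theta> = z"
proof -
  define \<sigma> where "\<sigma> x = (if x \<in> K then poly (SOME h. h \<in> polys_over \<rat> \<and> poly h \<theta> = x) z else x)"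
    for x
  have \<sigma>: "\<sigma> (poly h \<theta>) = poly h z" if h: "h \<in> polys_over \<rat>" for h
  proof -
    let ?P = "\<lambda>k. k \<in> polys_over \<rat> \<and> poly k \<theta> = poly h \<theta>"
    have "?P (SOME k. ?P k)"
      using h by (intro someI[of ?P h]) simp
    then have "poly (SOME k. ?P k) z = poly h z"
      using h by (intro poly_eq_at_conjugate[OF z]) auto
    then show ?thesis
      by (simp add: \<sigma>_def poly_\<theta>_mem_K[OF h])
  qed
  have "subfield_hom K \<sigma>"
  proof
    show "complex_subfield K"
      by (rule K_subfield)
    show "\<sigma> 1 = 1"
      using \<sigma>[of 1] QX.one_mem by simp
    fix x y assume "x \<in> K" "y \<in> K"
    then obtain f g where "f \<in> polys_over \<rat>" "g \<in> polys_over \<rat>" "x = poly f \<theta>" "y = poly g \<theta>"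
      by (metis K_reduced_poly)
    then show "\<sigma> (x + y) = \<sigma> x + \<sigma> y" "\<sigma> (x * y) = \<sigma> x * \<sigma> y"
      using \<sigma>[of f] \<sigma>[of g] \<sigma>[of "f + g"] \<sigma>[of "f * g"] QX.add_mem QX.mult_mem by auto
  qed
  then have "\<sigma> \<in> Gal"
    by (simp add: Gal_def \<sigma>_def)
  moreover have "\<sigma> \<theta> = z"
    using \<sigma>[of "[:0, 1:]"] Q.linear_polys_over[of 0 1] by simp
  ultimately show ?thesis
    by blast
qed

lemma Gal_bij: "bij_betw (\<lambda>\<sigma>. \<sigma> \<theta>) Gal {z. poly minpoly z = 0}"
proof (rule bij_betwI')
  fix \<sigma> assume \<sigma>: "\<sigma> \<in> Gal"
  then show "\<sigma> \<theta> \<in> {z. poly minpoly z = 0}"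
    using Gal_root[OF _ minimal_polyD(1)[OF minimal_poly_minpoly] \<theta>_mem_K
      minimal_polyD(3)[OF minimal_poly_minpoly]] by simp
  show "\<sigma> \<theta> = \<tau> \<theta> \<longleftrightarrow> \<sigma> = \<tau>" if "\<tau> \<in> Gal" for \<tau>
    using Gal_eqI[OF \<sigma> that] by blast
next
  show "\<exists>\<sigma>\<in>Gal. z = \<sigma> \<theta>" if "z \<in> {z. poly minpoly z = 0}" for z
    using ex_Gal[of z] that by auto
qed

lemma card_Gal: "card Gal = m"
  using bij_betw_same_card[OF Gal_bij]
    card_roots_minimal_poly[OF complex_subfield_Rats minimal_poly_minpoly]
  by (simp add: m_def)

lemma finite_Gal: "finite Gal"
  using card_Gal m_pos card_ge_0_finite by force

lemma eq_0_if_conjugate_roots: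
  assumes "degree h < m" and roots: "\<And>\<sigma>. \<sigma> \<in> Gal \<Longrightarrow> poly h (\<sigma> \<theta>) = 0"
  shows "h = 0"
proof (rule ccontr)
  assume "h \<noteq> 0"
  have "{z. poly minpoly z = 0} \<subseteq> {z. poly h z = 0}"
    using ex_Gal roots by auto
  then have "m \<le> card {z. poly h z = 0}"
    using card_roots_minimal_poly[OF complex_subfield_Rats minimal_poly_minpoly]
      poly_roots_finite[OF \<open>h \<noteq> 0\<close>]
    unfolding m_def by (metis card_mono)
  then show False
    using card_poly_roots_bound[OF \<open>h \<noteq> 0\<close>] assms(1) by simp
qed

lemma Gal_fixed_Rats:
  assumes "x \<in> K" and fixed: "\<And>\<sigma>. \<sigma> \<in> Gal \<Longrightarrow> \<sigma> x = x"
  shows "x \<in> \<rat>"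
proof -
  obtain h where h: "h \<in> polys_over \<rat>" "degree h < m" "x = poly h \<theta>"
    using \<open>x \<in> K\<close> by (rule K_reduced_poly)
  have "h - [:x:] = 0"
  proof (rule eq_0_if_conjugate_roots)
    show "degree (h - [:x:]) < m"
      using h(2) by (intro degree_diff_less) auto
    show "poly (h - [:x:]) (\<sigma> \<theta>) = 0" if \<sigma>: "\<sigma> \<in> Gal" for \<sigma>
      using Gal_poly[OF \<sigma> h(1) \<theta>_mem_K] fixed[OF \<sigma>] unfolding h(3) by simp
  qed
  then have "coeff h 0 = x"
    by simp
  then show ?thesis
    using coeff_polys_over[OF h(1), of 0] by simp
qed

lemma id_Gal: "id \<in> Gal"
  by (auto simp: Gal_def subfield_hom_def subfield_hom_axioms_def subring_hom_def
    subring_hom_axioms_def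
      K_subfield K.comm_subring_axioms)

lemma comp_Gal:
  assumes "\<sigma> \<in> Gal" "\<tau> \<in> Gal"
  shows "\<sigma> \<circ> \<tau> \<in> Gal"
proof -
  interpret s: subfield_hom K \<sigma>
    using assms by (intro Gal_hom)
  interpret t: subfield_hom K \<tau>
    using assms by (intro Gal_hom)
  have "subfield_hom K (\<sigma> \<circ> \<tau>)"
    by unfold_locales
      (auto simp: K_subfield s.hom_one t.hom_one s.hom_add t.hom_add s.hom_mult t.hom_mult
        Gal_mem_K[OF assms(2)])
  then show ?thesis
    using assms by (simp add: Gal_def)
qed

lemma inj_Gal:
  assumes "\<sigma> \<in> Gal"
  shows "inj \<sigma>"
proof (rule injI)
  fix x y assume "\<sigma> x = \<sigma> y"
  then show "x = y"
    using inj_onD[OF subfield_hom.inj_on_hom[OF Gal_hom[OF assms]]] Gal_mem_K[OF assms]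
      Gal_outside[OF assms]
    by metis
qed

lemma bij_betw_comp_Gal:
  assumes "\<sigma> \<in> Gal"
  shows "bij_betw (\<lambda>\<tau>. \<sigma> \<circ> \<tau>) Gal Gal"
proof -
  have "inj_on (\<lambda>\<tau>. \<sigma> \<circ> \<tau>) Gal"
    using inj_Gal[OF assms] by (auto simp: inj_on_def fun_eq_iff)
  moreover from this have "(\<lambda>\<tau>. \<sigma> \<circ> \<tau>) ` Gal = Gal"
    using comp_Gal[OF assms] finite_Gal by (intro endo_inj_surj) auto
  ultimately show ?thesis
    by (simp add: bij_betw_def)
qed

lemma Gal_funpow_eq_id:
  assumes "\<sigma> \<in> Gal" "m dvd t"
  shows "\<sigma> ^^ t = id"
proof -
  \<comment> \<open>The multiplication is reversed composition: finiteness yields right inverses, and the group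
    axioms ask for left inverses.\<close>
  define G where "G = \<lparr>carrier = Gal, mult = (\<lambda>\<sigma> \<tau>. \<tau> \<circ> \<sigma>), one = (id :: complex \<Rightarrow> complex)\<rparr>"
  interpret G: group G
  proof (rule groupI)
    fix \<sigma> assume "\<sigma> \<in> carrier G"
    then have "(\<lambda>\<tau>. \<sigma> \<circ> \<tau>) ` Gal = Gal"
      using bij_betw_imp_surj_on[OF bij_betw_comp_Gal] by (simp add: G_def)
    then obtain \<tau> where "\<tau> \<in> Gal" "\<sigma> \<circ> \<tau> = id"
      using id_Gal by (metis imageE)
    then show "\<exists>\<tau>\<in>carrier G. \<tau> \<otimes>\<^bsub>G\<^esub> \<sigma> = \<one>\<^bsub>G\<^esub>"
      by (auto simp: G_def)
  qed (auto simp: G_def comp_Gal id_Gal o_assoc)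
  have pow: "\<sigma> [^]\<^bsub>G\<^esub> n = \<sigma> ^^ n" for n :: nat
    by (induction n) (auto simp: G_def nat_pow_def)
  have "\<sigma> ^^ m = id"
    using G.pow_order_eq_1[of \<sigma>] assms(1) card_Gal unfolding pow
    by (simp add: G_def Coset.order_def)
  moreover obtain s where "t = m * s"
    using assms(2) by (elim dvdE)
  then have "\<sigma> ^^ t = (\<sigma> ^^ m) ^^ s"
    by (simp add: funpow_mult)
  ultimately show ?thesis
    by simp
qed

end

section \<open>Traces, discriminants and integral bases\<close>

definition mat_trace :: "'a::comm_monoid_add mat \<Rightarrow> 'a" where
  "mat_trace A = (\<Sum>i<dim_row A. A $$ (i, i))"

lemma mat_trace_mult_comm:
  fixes A B :: "'a::comm_ring_1 mat"
  assumes "A \<in> carrier_mat n n" "B \<in> carrier_mat n n"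
  shows "mat_trace (A * B) = mat_trace (B * A)"
proof -
  have trace: "mat_trace (X * Y) = (\<Sum>i<n. \<Sum>k<n. X $$ (i, k) * Y $$ (k, i))"
    if "X \<in> carrier_mat n n" "Y \<in> carrier_mat n n" for X Y :: "'a mat"
    using that by (auto simp: mat_trace_def scalar_prod_def atLeast0LessThan)
  show ?thesis
    unfolding trace[OF assms] trace[OF assms(2,1)] by (subst sum.swap) (simp add: mult.commute)
qed

lemma mat_trace_similar:
  fixes S M D :: "'a::field mat"
  assumes S: "S \<in> carrier_mat n n" "det S \<noteq> 0" and M: "M \<in> carrier_mat n n"
    and D: "D \<in> carrier_mat n n"
    and eq: "S * M = D * S"
  shows "mat_trace M = mat_trace D"
proof -
  obtain T where T: "T \<in> carrier_mat n n" "T * S = 1\<^sub>m n" "S * T = 1\<^sub>m n"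
    using det_non_zero_imp_unit[OF S, of "()"] by (auto simp: Units_def ring_mat_def)
  have "M = T * S * M"
    using T(2) M by simp
  also have "\<dots> = T * (D * S)"
    using T(1) S(1) M eq by (simp add: assoc_mult_mat[of T n n S n M n])
  finally have "mat_trace M = mat_trace (D * S * T)"
    using mat_trace_mult_comm[OF T(1), of "D * S"] S(1) D by simp
  also have "D * S * T = D"
    using T S(1) D by (simp add: assoc_mult_mat[of D n n S n T n])
  finally show ?thesis .
qed

lemma common_denominator:
  fixes q :: "'a \<Rightarrow> rat"
  assumes "finite I"
  obtains N :: int and c :: "'a \<Rightarrow> int" where "N > 0" "\<And>i. i \<in> I \<Longrightarrow> of_int N * q i = of_int (c i)"
proof -
  let ?b = "\<lambda>i. snd (quotient_of (q i))"
  define N where "N = (\<Prod>i\<in>I. ?b i)"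
  have "\<exists>c. of_int N * q i = of_int c" if i: "i \<in> I" for i
  proof -
    obtain a where a: "q i = of_int a / of_int (?b i)" "?b i \<noteq> 0"
      by (metis less_irrefl prod.collapse quotient_of_denom_pos quotient_of_div)
    have "N = ?b i * (\<Prod>j\<in>I - {i}. ?b j)"
      unfolding N_def using assms i by (rule prod.remove)
    then have "of_int N * q i = of_int (\<Prod>j\<in>I - {i}. ?b j) * (of_int (?b i) * (of_int a / of_int (?b i)))"
      using a(1) by (simp only: of_int_mult mult_ac)
    also have "\<dots> = of_int ((\<Prod>j\<in>I - {i}. ?b j) * a)"
      using a(2) by simp
    finally show ?thesis ..
  qed
  then obtain c where "\<And>i. i \<in> I \<Longrightarrow> of_int N * q i = of_int (c i)"
    by metis
  moreover have "N > 0"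
    unfolding N_def by (intro prod_pos) (metis prod.collapse quotient_of_denom_pos)
  ultimately show ?thesis
    using that by blast
qed

lemma norm_of_rat: "norm (of_rat q :: complex) = of_rat \<bar>q\<bar>"
proof -
  obtain a b where ab: "q = of_int a / of_int b"
    by (metis quotient_of_div surj_pair)
  then have "\<bar>q\<bar> = of_int \<bar>a\<bar> / of_int \<bar>b\<bar>"
    by simp
  then show ?thesis
    by (simp add: ab of_rat_divide norm_divide del: of_int_abs)
qed

context splitting_field
begin

abbreviation O_K :: "complex set" where
  "O_K \<equiv> ring_of_integers K"

lemma O_K_iff: "x \<in> O_K \<longleftrightarrow> x \<in> K \<and> algebraic_int x"
  by (simp add: ring_of_integers_def)

sublocale O_K: comm_subring O_K
proof -
  interpret A: comm_subring "{x :: complex. algebraic_int x}"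
    by (rule comm_subring_algebraic_ints)
  show "comm_subring O_K"
    using K.one_mem K.diff_mem K.mult_mem A.one_mem A.diff_mem A.mult_mem
    by unfold_locales (auto simp: O_K_iff)
qed

lemma O_K_subset_K: "O_K \<subseteq> K"
  by (auto simp: O_K_iff)

lemma O_K_Rats_Ints: "x \<in> O_K \<Longrightarrow> x \<in> \<rat> \<Longrightarrow> x \<in> \<int>"
  by (auto simp: O_K_iff rational_algebraic_int_is_int)

lemma of_int_dvd_O_K:
  assumes "of_int a = of_int n * c" "c \<in> O_K"
  shows "n dvd a"
proof (cases "n = 0")
  case False
  then have "c = of_int a / of_int n"
    using assms(1) by simp
  then have "c \<in> \<int>"
    using assms(2) O_K_Rats_Ints by (metis Rats_divide Rats_of_int)
  then obtain b where "c = of_int b"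
    by (elim Ints_cases)
  then have "(of_int a :: complex) = of_int (n * b)"
    using assms(1) by simp
  then show ?thesis
    unfolding of_int_eq_iff by simp
qed (use assms in simp)

lemma Gal_zero: "\<sigma> \<in> Gal \<Longrightarrow> \<sigma> 0 = 0"
  and Gal_mult: "\<sigma> \<in> Gal \<Longrightarrow> x \<in> K \<Longrightarrow> y \<in> K \<Longrightarrow> \<sigma> (x * y) = \<sigma> x * \<sigma> y"
  using subring_hom.hom_zero subring_hom.hom_mult subfield_hom.axioms(1)[OF Gal_hom] by blast+

lemma Gal_mem_O_K: "\<sigma> \<in> Gal \<Longrightarrow> x \<in> O_K \<Longrightarrow> \<sigma> x \<in> O_K"
  using Gal_mem_K subfield_hom.hom_algebraic_int[OF Gal_hom] by (auto simp: O_K_iff)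

lemma O_K_Gal_fixed_Ints: "x \<in> O_K \<Longrightarrow> (\<And>\<sigma>. \<sigma> \<in> Gal \<Longrightarrow> \<sigma> x = x) \<Longrightarrow> x \<in> \<int>"
  using Gal_fixed_Rats O_K_Rats_Ints by (auto simp: O_K_iff)

lemma Gal_rat_combination:
  assumes "\<sigma> \<in> Gal" "\<And>i. i \<in> I \<Longrightarrow> w i \<in> K"
  shows "\<sigma> (\<Sum>i\<in>I. of_rat (q i) * w i) = (\<Sum>i\<in>I. of_rat (q i) * \<sigma> (w i))"
proof -
  interpret subfield_hom K \<sigma>
    using assms(1) by (rule Gal_hom)
  show ?thesis
    using assms(2) by (simp add: hom_sum hom_mult of_rat_mem_K hom_Rats K.mult_mem)
qed

definition gal :: "nat \<Rightarrow> complex \<Rightarrow> complex" where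
  "gal = (SOME f. bij_betw f {..<m} Gal)"

lemma bij_gal: "bij_betw gal {..<m} Gal"
proof -
  have "\<exists>h. bij_betw h {..<m} Gal"
    using ex_bij_betw_nat_finite[OF finite_Gal] by (simp add: card_Gal atLeast0LessThan)
  then show ?thesis
    unfolding gal_def by (rule someI_ex)
qed

lemma gal_Gal: "k < m \<Longrightarrow> gal k \<in> Gal"
  using bij_gal by (auto simp: bij_betw_def)

definition conj_mat :: "(nat \<Rightarrow> complex) \<Rightarrow> complex mat" where
  "conj_mat w = mat m m (\<lambda>(k, i). gal k (w i))"

lemma conj_mat_carrier: "conj_mat w \<in> carrier_mat m m"
  by (simp add: conj_mat_def)

lemma conj_mat_index: "k < m \<Longrightarrow> i < m \<Longrightarrow> conj_mat w $$ (k, i) = gal k (w i)"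
  by (simp add: conj_mat_def)

lemma conj_mat_mult_vec:
  assumes "\<And>i. i < m \<Longrightarrow> w i \<in> K"
  shows "conj_mat w *\<^sub>v vec m (\<lambda>i. of_rat (q i)) = vec m (\<lambda>k. gal k (\<Sum>i<m. of_rat (q i) * w i))"
proof (rule eq_vecI)
  fix k assume "k < dim_vec (vec m (\<lambda>k. gal k (\<Sum>i<m. of_rat (q i) * w i)))"
  then have k: "k < m"
    by simp
  then have "(conj_mat w *\<^sub>v vec m (\<lambda>i. of_rat (q i))) $ k = (\<Sum>i<m. of_rat (q i) * gal k (w i))"
    by (simp add: conj_mat_def scalar_prod_def atLeast0LessThan mult.commute)
  also have "\<dots> = gal k (\<Sum>i<m. of_rat (q i) * w i)"
    using assms gal_Gal[OF k] by (intro Gal_rat_combination[symmetric]) auto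
  finally show "(conj_mat w *\<^sub>v vec m (\<lambda>i. of_rat (q i))) $ k =
      vec m (\<lambda>k. gal k (\<Sum>i<m. of_rat (q i) * w i)) $ k"
    using k by simp
qed (simp add: conj_mat_def)

lemma det_conj_mat_update:
  assumes w: "\<And>i. i < m \<Longrightarrow> w i \<in> K" and l: "l < m"
  shows "det (conj_mat (w(l := \<Sum>i<m. of_rat (q i) * w i))) = of_rat (q l) * det (conj_mat w)"
proof -
  let ?q = "vec m (\<lambda>i. of_rat (q i)) :: complex vec"
  have conj: "conj_mat w *\<^sub>v ?q = vec m (\<lambda>k. gal k (\<Sum>i<m. of_rat (q i) * w i))"
    using w by (rule conj_mat_mult_vec)
  have "conj_mat (w(l := \<Sum>i<m. of_rat (q i) * w i)) = replace_col (conj_mat w) (conj_mat w *\<^sub>v ?q) l"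
    unfolding conj
    by (rule eq_matI) (auto simp: replace_col_def conj_mat_def)
  then show ?thesis
    using cramer_lemma_mat[OF conj_mat_carrier[of w], of ?q l] l by simp
qed

lemma det_conj_mat_powers_nonzero: "det (conj_mat (\<lambda>i. \<theta> ^ i)) \<noteq> 0"
proof
  assume "det (conj_mat (\<lambda>i. \<theta> ^ i)) = 0"
  then obtain v where v: "v \<in> carrier_vec m" "v \<noteq> 0\<^sub>v m" "conj_mat (\<lambda>i. \<theta> ^ i) *\<^sub>v v = 0\<^sub>v m"
    using det_0_iff_vec_prod_zero_field[OF conj_mat_carrier] by blast
  define h where "h = (\<Sum>i<m. monom (v $ i) i)"
  have coeff_h: "coeff h i = (if i < m then v $ i else 0)" for i
    by (simp add: h_def coeff_sum)
  have "poly h (gal k \<theta>) = 0" if k: "k < m" for k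
  proof -
    interpret subfield_hom K "gal k"
      using k by (intro Gal_hom gal_Gal)
    have "poly h (gal k \<theta>) = (\<Sum>i<m. gal k (\<theta> ^ i) * v $ i)"
      by (simp add: h_def poly_sum poly_monom hom_power \<theta>_mem_K mult.commute)
    also have "\<dots> = (conj_mat (\<lambda>i. \<theta> ^ i) *\<^sub>v v) $ k"
      using k v(1) by (simp add: conj_mat_def scalar_prod_def atLeast0LessThan)
    finally show ?thesis
      using v(3) k by simp
  qed
  then have "poly h (\<sigma> \<theta>) = 0" if "\<sigma> \<in> Gal" for \<sigma>
    using bij_betw_imp_surj_on[OF bij_gal] that by (metis imageE lessThan_iff)
  moreover have "degree h < m"
    using m_pos by (intro degree_lessI) (auto simp: coeff_h)
  ultimately have "h = 0"
    by (intro eq_0_if_conjugate_roots)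
  then have "v $ i = 0" if "i < m" for i
    using coeff_h[of i] that by simp
  then have "v = 0\<^sub>v m"
    using v(1) by (intro eq_vecI) auto
  then show False
    using v(2) by blast
qed

lemma det_conj_mat_nonzero:
  assumes w: "rat_vs.basis_family K m w"
  shows "det (conj_mat w) \<noteq> 0"
proof -
  have "\<exists>q. \<theta> ^ j = (\<Sum>i<m. of_rat (q i) * w i)" for j
    by (intro rat_vs.basis_familyD(2)[OF w] K.power_mem \<theta>_mem_K)
  then obtain q where q: "\<And>j. \<theta> ^ j = (\<Sum>i<m. of_rat (q j i) * w i)"
    by metis
  define Q where "Q = mat m m (\<lambda>(i, j). of_rat (q j i) :: complex)"
  have Q: "Q \<in> carrier_mat m m"
    by (simp add: Q_def)
  have "conj_mat (\<lambda>i. \<theta> ^ i) = conj_mat w * Q"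
  proof (rule eq_matI)
    fix k j assume "k < dim_row (conj_mat w * Q)" "j < dim_col (conj_mat w * Q)"
    then have kj: "k < m" "j < m"
      using Q by (auto simp: conj_mat_def)
    then have "(conj_mat w * Q) $$ (k, j) = (\<Sum>i<m. of_rat (q j i) * gal k (w i))"
      by (simp add: conj_mat_def Q_def scalar_prod_def atLeast0LessThan mult.commute)
    also have "\<dots> = gal k (\<theta> ^ j)"
      unfolding q using rat_vs.basis_familyD(1)[OF w] gal_Gal[OF kj(1)]
      by (intro Gal_rat_combination[symmetric]) auto
    finally show "conj_mat (\<lambda>i. \<theta> ^ i) $$ (k, j) = (conj_mat w * Q) $$ (k, j)"
      using kj by (simp add: conj_mat_index)
  qed (use Q in \<open>auto simp: conj_mat_def\<close>)
  then show ?thesis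
    using det_conj_mat_powers_nonzero det_mult[OF conj_mat_carrier Q, of w] by auto
qed

lemma basis_family_if_det_conj_mat_nonzero:
  assumes w: "\<And>i. i < m \<Longrightarrow> w i \<in> K" and det: "det (conj_mat w) \<noteq> 0"
  shows "rat_vs.basis_family K m w"
proof (rule rat_vs.basis_family_if_independent[OF rat_subspace_K basis_family_powers w])
  fix q :: "nat \<Rightarrow> rat" and i assume q: "(\<Sum>i<m. of_rat (q i) * w i) = 0" and i: "i < m"
  let ?q = "vec m (\<lambda>i. of_rat (q i)) :: complex vec"
  have "conj_mat w *\<^sub>v ?q = vec m (\<lambda>k. gal k (\<Sum>i<m. of_rat (q i) * w i))"
    using w by (rule conj_mat_mult_vec)
  also have "\<dots> = 0\<^sub>v m"
    unfolding q by (intro eq_vecI) (simp_all add: Gal_zero gal_Gal)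
  finally have "?q = 0\<^sub>v m"
    using det det_0_iff_vec_prod_zero_field[OF conj_mat_carrier] by (metis vec_carrier)
  then have "?q $ i = 0\<^sub>v m $ i"
    by simp
  then show "q i = 0"
    using i by simp
qed

lemma mat_trace_coordinates:
  assumes w: "rat_vs.basis_family K m w" and x: "x \<in> K"
    and M: "\<And>j. j < m \<Longrightarrow> x * w j = (\<Sum>i<m. of_rat (M i j) * w i)"
  shows "of_rat (\<Sum>i<m. M i i) = (\<Sum>\<sigma>\<in>Gal. \<sigma> x)"
proof -
  define N where "N = mat m m (\<lambda>(i, j). of_rat (M i j) :: complex)"
  define D where "D = mat m m (\<lambda>(k, l). if k = l then gal k x else 0)"
  have ND: "N \<in> carrier_mat m m" "D \<in> carrier_mat m m"
    by (simp_all add: N_def D_def)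
  have "conj_mat w * N = D * conj_mat w"
  proof (rule eq_matI)
    fix k j assume "k < dim_row (D * conj_mat w)" "j < dim_col (D * conj_mat w)"
    then have kj: "k < m" "j < m"
      using ND by (auto simp: conj_mat_def)
    have "(conj_mat w * N) $$ (k, j) = (\<Sum>i<m. of_rat (M i j) * gal k (w i))"
      using kj by (simp add: conj_mat_def N_def scalar_prod_def atLeast0LessThan mult.commute)
    also have "\<dots> = gal k (x * w j)"
      unfolding M[OF kj(2)] using rat_vs.basis_familyD(1)[OF w] gal_Gal[OF kj(1)]
      by (intro Gal_rat_combination[symmetric]) auto
    also have "\<dots> = (\<Sum>l<m. if k = l then gal k x * gal l (w j) else 0)"
      using kj x rat_vs.basis_familyD(1)[OF w] by (simp add: Gal_mult gal_Gal)
    also have "\<dots> = (\<Sum>l<m. (if k = l then gal k x else 0) * gal l (w j))"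
      by (intro sum.cong) auto
    also have "\<dots> = (D * conj_mat w) $$ (k, j)"
      using kj by (simp add: conj_mat_def D_def scalar_prod_def atLeast0LessThan)
    finally show "(conj_mat w * N) $$ (k, j) = (D * conj_mat w) $$ (k, j)" .
  qed (use ND in \<open>auto simp: conj_mat_def\<close>)
  then have "mat_trace N = mat_trace D"
    by (rule mat_trace_similar[OF conj_mat_carrier det_conj_mat_nonzero[OF w] ND])
  then have "of_rat (\<Sum>i<m. M i i) = (\<Sum>k<m. gal k x)"
    by (simp add: mat_trace_def N_def D_def of_rat_sum)
  also have "\<dots> = (\<Sum>\<sigma>\<in>Gal. \<sigma> x)"
    by (rule sum.reindex_bij_betw[OF bij_gal])
  finally show ?thesis .
qed

lemma ex_basis_family_enumeration:
  assumes B: "rat_vs.independent B" "rat_vs.span B = K"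
  obtains w where "bij_betw w {..<m} B" "rat_vs.basis_family K m w"
proof -
  have "rat_vs.span B = rat_vs.span K"
    using rat_vs.span_span[of B] unfolding B(2) ..
  then have card: "card B = m"
    using rat_vs.dim_eq_card[OF _ B(1)] dim_K by simp
  then have "finite B"
    using m_pos card_ge_0_finite by force
  then obtain w where w: "bij_betw w {..<m} B"
    using ex_bij_betw_nat_finite card by (metis atLeast0LessThan)
  then have "rat_vs.basis_family K m w"
    using B rat_vs.basis_family_iff[OF rat_subspace_K] by (simp add: bij_betw_def)
  with w show ?thesis
    by (rule that)
qed

lemma field_trace_eq_sum_conjugates:
  assumes x: "x \<in> K"
  shows "of_rat (field_trace K x) = (\<Sum>\<sigma>\<in>Gal. \<sigma> x)"
proof -
  let ?P = "\<lambda>B. rat_vs.independent B \<and> rat_vs.span B = K"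
  define B where "B = (SOME B. ?P B)"
  have "?P ((\<lambda>i. \<theta> ^ i) ` {..<m})"
    using basis_family_powers rat_vs.basis_family_iff[OF rat_subspace_K] by blast
  then have "?P B"
    unfolding B_def by (rule someI)
  then have B: "rat_vs.independent B" "rat_vs.span B = K"
    by simp_all
  obtain w where w: "bij_betw w {..<m} B" and basis: "rat_vs.basis_family K m w"
    using B by (rule ex_basis_family_enumeration)
  then have fin: "finite B"
    using bij_betw_finite by blast
  let ?M = "\<lambda>i j. rat_vs.representation B (x * w j) (w i)"
  have "x * w j = (\<Sum>i<m. of_rat (?M i j) * w i)" if "j < m" for j
  proof -
    have "x * w j \<in> rat_vs.span B"
      unfolding B(2) using x rat_vs.basis_familyD(1)[OF basis that] by (rule K.mult_mem)
    then have "x * w j = (\<Sum>b\<in>B. of_rat (rat_vs.representation B (x * w j) b) * b)"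
      using rat_vs.sum_representation_eq[OF B(1) _ fin order_refl] by simp
    also have "\<dots> = (\<Sum>i<m. of_rat (?M i j) * w i)"
      by (rule sum.reindex_bij_betw[OF w, symmetric])
    finally show ?thesis .
  qed
  then have "(\<Sum>\<sigma>\<in>Gal. \<sigma> x) = of_rat (\<Sum>i<m. ?M i i)"
    using mat_trace_coordinates[OF basis x, of ?M] by simp
  also have "(\<Sum>i<m. ?M i i) = (\<Sum>b\<in>B. rat_vs.representation B (x * b) b)"
    by (rule sum.reindex_bij_betw[OF w])
  also have "\<dots> = field_trace K x"
    by (simp add: field_trace_def B_def Let_def)
  finally show ?thesis ..
qed

definition disc :: "(nat \<Rightarrow> complex) \<Rightarrow> complex" where
  "disc w = (det (conj_mat w))\<^sup>2"

lemma disc_eq_det_field_trace: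
  assumes w: "\<And>i. i < m \<Longrightarrow> w i \<in> K"
  shows "disc w = of_rat (det (mat m m (\<lambda>(i, j). field_trace K (w i * w j))))"
proof -
  let ?S = "conj_mat w" and ?T = "mat m m (\<lambda>(i, j). field_trace K (w i * w j))"
  have "map_mat of_rat ?T = transpose_mat ?S * ?S"
  proof (rule eq_matI)
    fix i j assume "i < dim_row (transpose_mat ?S * ?S)" "j < dim_col (transpose_mat ?S * ?S)"
    then have ij: "i < m" "j < m"
      by (auto simp: conj_mat_def)
    have "(transpose_mat ?S * ?S) $$ (i, j) = (\<Sum>k<m. gal k (w i) * gal k (w j))"
      using ij by (simp add: conj_mat_def scalar_prod_def atLeast0LessThan)
    also have "\<dots> = (\<Sum>k<m. gal k (w i * w j))"
      using ij w
      by (intro sum.cong) (simp_all add: Gal_mult gal_Gal)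
    also have "\<dots> = of_rat (field_trace K (w i * w j))"
      using ij w sum.reindex_bij_betw[OF bij_gal]
      by (simp add: field_trace_eq_sum_conjugates K.mult_mem)
    finally show "map_mat of_rat ?T $$ (i, j) = (transpose_mat ?S * ?S) $$ (i, j)"
      using ij by simp
  qed (auto simp: conj_mat_def)
  then have "of_rat (det ?T) = det (transpose_mat ?S) * det ?S"
    using det_mult[of "transpose_mat ?S" m ?S] conj_mat_carrier[of w]
    by (simp flip: of_rat_hom.hom_det)
  then show ?thesis
    using det_transpose[OF conj_mat_carrier] by (simp add: disc_def power2_eq_square)
qed

lemma det_conj_mat_O_K:
  assumes "\<And>i. i < m \<Longrightarrow> w i \<in> O_K"
  shows "det (conj_mat w) \<in> O_K"
  using assms by (intro O_K.det_mem[OF conj_mat_carrier])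
    (simp add: conj_mat_index Gal_mem_O_K gal_Gal)

lemma disc_Ints:
  assumes w: "\<And>i. i < m \<Longrightarrow> w i \<in> O_K"
  shows "disc w \<in> \<int>"
proof (rule O_K_Rats_Ints)
  show "disc w \<in> O_K"
    unfolding disc_def using w by (intro O_K.power_mem det_conj_mat_O_K)
  show "disc w \<in> \<rat>"
    using w O_K_subset_K by (subst disc_eq_det_field_trace) auto
qed

lemma disc_update:
  assumes "\<And>i. i < m \<Longrightarrow> w i \<in> K" "l < m"
  shows "disc (w(l := \<Sum>i<m. of_rat (q i) * w i)) = of_rat ((q l)\<^sup>2) * disc w"
  using det_conj_mat_update[of w l q, OF assms]
  by (simp add: disc_def power_mult_distrib of_rat_power)

lemma ex_minimal_disc:
  obtains w where "\<And>i. i < m \<Longrightarrow> w i \<in> O_K" "disc w \<noteq> 0"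
    "\<And>v. (\<And>i. i < m \<Longrightarrow> v i \<in> O_K) \<Longrightarrow> disc v \<noteq> 0 \<Longrightarrow> cmod (disc w) \<le> cmod (disc v)"
proof -
  let ?P = "\<lambda>w. (\<forall>i<m. w i \<in> O_K) \<and> disc w \<noteq> 0" and ?f = "\<lambda>w. nat \<lfloor>cmod (disc w)\<rfloor>"
  have "\<theta> \<in> O_K"
    by (simp add: O_K_iff \<theta>_mem_K algebraic_int_\<theta>)
  then have "?P (\<lambda>i. \<theta> ^ i)"
    using det_conj_mat_powers_nonzero by (simp add: disc_def O_K.power_mem)
  then obtain w where w: "?P w" "\<forall>v. ?P v \<longrightarrow> ?f w \<le> ?f v"
    using ex_has_least_nat[of ?P _ ?f] by blast
  have f: "cmod (disc v) = real (?f v)" if "?P v" for v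
  proof -
    obtain D where "disc v = of_int D"
      using disc_Ints[of v] \<open>?P v\<close> by (auto elim: Ints_cases)
    then show ?thesis
      by simp
  qed
  show ?thesis
  proof (rule that[of w])
    show "cmod (disc w) \<le> cmod (disc v)" if "\<And>i. i < m \<Longrightarrow> v i \<in> O_K" "disc v \<noteq> 0" for v
    proof -
      have "?P v"
        using that by simp
      then have "real (?f w) \<le> real (?f v)"
        using w(2) by (intro of_nat_mono) blast
      then show ?thesis
        unfolding f[OF w(1), symmetric] f[OF \<open>?P v\<close>, symmetric] .
    qed
  qed (use w in auto)
qed

text \<open>Replacing \<open>w l\<close> by an integer of \<open>K\<close> whose \<open>l\<close>-th coordinate is the fractional part of \<open>q l\<close>
  would lower the discriminant.\<close>

lemma minimal_disc_coordinate_Ints: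
  assumes w: "\<And>i. i < m \<Longrightarrow> w i \<in> O_K" and nz: "disc w \<noteq> 0"
    and min: "\<And>v. (\<And>i. i < m \<Longrightarrow> v i \<in> O_K) \<Longrightarrow> disc v \<noteq> 0 \<Longrightarrow> cmod (disc w) \<le> cmod (disc v)"
    and x: "(\<Sum>i<m. of_rat (q i) * w i) \<in> O_K" and l: "l < m"
  shows "q l \<in> \<int>"
proof (rule ccontr)
  assume "q l \<notin> \<int>"
  then have frac: "0 < frac (q l)" "frac (q l) < 1"
    by (simp_all add: frac_gt_0_iff frac_lt_1)
  let ?q = "q(l := frac (q l))"
  let ?v = "w(l := \<Sum>i<m. of_rat (?q i) * w i)"
  have "(\<Sum>i<m. of_rat (?q i) * w i) = (\<Sum>i<m. of_rat (q i) * w i) - of_int \<lfloor>q l\<rfloor> * w l"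
    using l by (simp add: sum.remove[of _ l] frac_def of_rat_diff left_diff_distrib)
  then have "?v i \<in> O_K" if "i < m" for i
    using that w x l by (auto intro!: O_K.diff_mem O_K.mult_mem O_K.of_int_mem)
  moreover have disc: "disc ?v = of_rat ((frac (q l))\<^sup>2) * disc w"
    using disc_update[of w l ?q] w O_K_subset_K l by auto
  ultimately have "cmod (disc w) \<le> cmod (disc ?v)"
    using frac nz by (intro min) auto
  also have "\<dots> = (cmod (of_rat (frac (q l))))\<^sup>2 * cmod (disc w)"
    unfolding disc by (simp add: norm_mult of_rat_power norm_power)
  also have "cmod (of_rat (frac (q l))) = of_rat (frac (q l))"
    using frac by (simp add: norm_of_rat)
  also have "(of_rat (frac (q l)))\<^sup>2 * cmod (disc w) < 1 * cmod (disc w)"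
    using frac nz by (intro mult_strict_right_mono)
      (auto simp: power_less_one_iff abs_square_less_1)
  finally show False
    by simp
qed

lemma ex_int_basis_family: "\<exists>w. int_mod.basis_family O_K m w"
proof -
  obtain w where w: "\<And>i. i < m \<Longrightarrow> w i \<in> O_K" and nz: "disc w \<noteq> 0"
    and min: "\<And>v. (\<And>i. i < m \<Longrightarrow> v i \<in> O_K) \<Longrightarrow> disc v \<noteq> 0 \<Longrightarrow> cmod (disc w) \<le> cmod (disc v)"
    using ex_minimal_disc by blast
  have basis: "rat_vs.basis_family K m w"
    using w O_K_subset_K nz by (intro basis_family_if_det_conj_mat_nonzero) (auto simp: disc_def)
  have "int_mod.basis_family O_K m w"
  proof (rule int_mod.basis_familyI[OF w])
    fix x assume x: "x \<in> O_K"
    then obtain q where q: "x = (\<Sum>i<m. of_rat (q i) * w i)"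
      using rat_vs.basis_familyD(2)[OF basis] O_K_subset_K by blast
    have "q i \<in> \<int>" if "i < m" for i
      using w nz min x[unfolded q] that by (rule minimal_disc_coordinate_Ints)
    then have "\<exists>c. q i = of_int c" if "i < m" for i
      using that by (auto elim: Ints_cases)
    then obtain c where "\<And>i. i < m \<Longrightarrow> q i = of_int (c i)"
      by metis
    then show "\<exists>c. x = (\<Sum>i<m. of_int (c i) * w i)"
      unfolding q by (intro exI[of _ c] sum.cong) auto
  next
    fix c i assume "(\<Sum>i<m. of_int (c i) * w i) = 0" "i < m"
    then show "c i = 0"
      using rat_vs.basis_familyD(3)[OF basis, of "\<lambda>i. of_int (c i)"] by simp
  qed
  then show ?thesis
    by blast
qed

lemma ex_multiple_O_K:
  assumes "x \<in> K"
  obtains N :: int where "N > 0" "of_int N * x \<in> O_K"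
proof -
  obtain q where q: "x = (\<Sum>i<m. of_rat (q i) * \<theta> ^ i)"
    using rat_vs.basis_familyD(2)[OF basis_family_powers assms] by blast
  obtain N c where N: "N > 0" "\<And>i. i \<in> {..<m} \<Longrightarrow> of_int N * q i = of_int (c i)"
    using common_denominator[of "{..<m}" q] by auto
  have "of_int N * x = (\<Sum>i<m. of_rat (of_int N * q i) * \<theta> ^ i)"
    unfolding q by (simp add: sum_distrib_left of_rat_mult mult.assoc)
  also have "\<dots> = (\<Sum>i<m. of_int (c i) * \<theta> ^ i)"
    by (intro sum.cong) (simp_all add: N(2))
  also have "\<dots> \<in> O_K"
    using \<theta>_mem_K algebraic_int_\<theta>
    by (intro O_K.sum_mem O_K.mult_mem O_K.of_int_mem O_K.power_mem) (simp add: O_K_iff)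
  finally show ?thesis
    using N(1) that by blast
qed

lemma rat_basis_family_if_int:
  assumes w: "int_mod.basis_family O_K n w"
  shows "rat_vs.basis_family K n w"
proof (rule rat_vs.basis_familyI)
  show "w i \<in> K" if "i < n" for i
    using int_mod.basis_familyD(1)[OF w that] O_K_subset_K by blast
  show "\<exists>q. x = (\<Sum>i<n. of_rat (q i) * w i)" if x: "x \<in> K" for x
  proof -
    obtain N :: int where N: "N > 0" "of_int N * x \<in> O_K"
      using x by (rule ex_multiple_O_K)
    then obtain c where "of_int N * x = (\<Sum>i<n. of_int (c i) * w i)"
      using int_mod.basis_familyD(2)[OF w] by blast
    then have "x = (\<Sum>i<n. of_int (c i) * w i) / of_int N"
      using N(1) by (simp add: field_simps)
    then show ?thesis
      by (intro exI[of _ "\<lambda>i. of_int (c i) / of_int N"])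
        (simp add: sum_divide_distrib of_rat_divide)
  qed
  show "q i = 0" if q: "(\<Sum>i<n. of_rat (q i) * w i) = 0" and i: "i < n" for q i
  proof -
    obtain N c where N: "N > 0" "\<And>i. i \<in> {..<n} \<Longrightarrow> of_int N * q i = of_int (c i)"
      using common_denominator[of "{..<n}" q] by auto
    have "(\<Sum>i<n. of_int (c i) * w i) = (\<Sum>i<n. of_rat (of_int N * q i) * w i)"
      by (intro sum.cong) (simp_all add: N(2))
    also have "\<dots> = of_int N * (\<Sum>i<n. of_rat (q i) * w i)"
      by (simp add: sum_distrib_left of_rat_mult mult.assoc)
    finally have "c i = 0"
      using q i by (intro int_mod.basis_familyD(3)[OF w]) auto
    then show ?thesis
      using N(1) N(2)[of i] i by simp
  qed
qed

lemma int_basis_family_length: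
  assumes "int_mod.basis_family O_K n w"
  shows "n = m"
  using rat_vs.basis_family_dim[OF rat_subspace_K rat_basis_family_if_int[OF assms]] dim_K by simp

lemma int_subspace_O_K: "int_mod.subspace O_K"
  unfolding int_mod.subspace_def using O_K.zero_mem O_K.add_mem O_K.mult_mem O_K.of_int_mem by blast

lemma integral_basis_iff: "integral_basis K bs \<longleftrightarrow> int_mod.basis_family O_K (length bs) ((!) bs)"
proof -
  have "(!) bs ` {..<length bs} = set bs"
    by (auto simp: set_conv_nth)
  moreover have "inj_on ((!) bs) {..<length bs} \<longleftrightarrow> distinct bs"
    by (auto simp: inj_on_def distinct_conv_nth)
  ultimately show ?thesis
    unfolding integral_basis_def int_mod.basis_family_iff[OF int_subspace_O_K] by simp
qed

lemma field_discriminant_eq_disc: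
  obtains w where "int_mod.basis_family O_K m w" "of_int (field_discriminant K) = disc w"
proof -
  let ?T = "\<lambda>bs. mat (length bs) (length bs) (\<lambda>(i, j). field_trace K (bs ! i * bs ! j))"
  let ?P = "\<lambda>D. \<exists>bs. integral_basis K bs \<and> of_int D = det (?T bs)"
  have T: "of_rat (det (?T bs)) = disc ((!) bs)" if bs: "integral_basis K bs" for bs
  proof -
    have w: "int_mod.basis_family O_K (length bs) ((!) bs)"
      using bs by (simp add: integral_basis_iff)
    then have "length bs = m"
      by (rule int_basis_family_length)
    then show ?thesis
      using int_mod.basis_familyD(1)[OF w] O_K_subset_K by (subst disc_eq_det_field_trace) auto
  qed
  obtain v where v: "int_mod.basis_family O_K m v"
    using ex_int_basis_family by blast
  then have basis: "integral_basis K (map v [0..<m])"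
    unfolding integral_basis_iff by (simp add: int_mod.basis_family_def)
  moreover have "disc ((!) (map v [0..<m])) \<in> \<int>"
    using int_mod.basis_familyD(1)[OF v] by (intro disc_Ints) simp
  then obtain D where "disc ((!) (map v [0..<m])) = of_int D"
    by (elim Ints_cases)
  ultimately have "of_rat (det (?T (map v [0..<m]))) = (of_rat (of_int D) :: complex)"
    using T[OF basis] by simp
  then have "of_int D = det (?T (map v [0..<m]))"
    unfolding of_rat_eq_iff by simp
  then have "?P D"
    using basis by blast
  then have "?P (field_discriminant K)"
    unfolding field_discriminant_def by (rule someI[of ?P])
  then obtain bs where bs: "integral_basis K bs" "of_int (field_discriminant K) = det (?T bs)"
    by blast
  then have "of_rat (of_int (field_discriminant K)) = disc ((!) bs)"
    using T by simp
  moreover have "int_mod.basis_family O_K m ((!) bs)"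
    using bs(1) int_basis_family_length unfolding integral_basis_iff by metis
  ultimately show ?thesis
    using that by simp
qed

lemma field_discriminant_nonzero: "field_discriminant K \<noteq> 0"
proof -
  obtain w where "int_mod.basis_family O_K m w" "of_int (field_discriminant K) = disc w"
    by (rule field_discriminant_eq_disc)
  then show ?thesis
    using det_conj_mat_nonzero[OF rat_basis_family_if_int] by (auto simp: disc_def)
qed

end

section \<open>The radical of a rational prime\<close>

lemma (in subring_hom) map_poly_prod_linear_permuted:
  assumes "bij_betw \<pi> A A" and y: "\<And>k. k \<in> A \<Longrightarrow> y k \<in> R" "\<And>k. k \<in> A \<Longrightarrow> \<sigma> (y k) = z (\<pi> k)"
  shows "map_poly \<sigma> (\<Prod>k\<in>A. [:- y k, 1:]) = (\<Prod>k\<in>A. [:- z k, 1:])"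
proof -
  have "map_poly \<sigma> (\<Prod>k\<in>A. [:- y k, 1:]) = (\<Prod>k\<in>A. [:- z (\<pi> k), 1:])"
    using y by (simp add: map_poly_prod_linear)
  also have "\<dots> = (\<Prod>k\<in>A. [:- z k, 1:])"
    using assms(1) by (rule prod.reindex_bij_betw)
  finally show ?thesis .
qed

context splitting_field
begin

sublocale OX: comm_subring "polys_over O_K"
  by (rule O_K.comm_subring_polys_over)

abbreviation radical_O_K :: "nat \<Rightarrow> complex set" where
  "radical_O_K p \<equiv> O_K.radical (of_nat p)"

lemma radical_ideal_radical_O_K: "O_K.radical_ideal_in (radical_O_K p)"
  and ideal_radical_O_K: "O_K.ideal_in (radical_O_K p)"
  using O_K.radical_ideal_in_radical[OF O_K.of_nat_mem] O_K.radical_ideal_inD(1) by blast+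

lemma radical_O_K_Gal:
  assumes \<sigma>: "\<sigma> \<in> Gal" and x: "x \<in> radical_O_K p"
  shows "\<sigma> x \<in> radical_O_K p"
proof -
  interpret subfield_hom K \<sigma>
    using \<sigma> by (rule Gal_hom)
  obtain n c where n: "x \<in> O_K" "c \<in> O_K" "x ^ n = of_nat p * c"
    using x by (auto simp: O_K.cong_mod_def elim!: O_K.radicalE)
  then have K: "x \<in> K" "c \<in> K"
    using O_K_subset_K by blast+
  then have "\<sigma> x ^ n = \<sigma> (x ^ n)"
    by (simp add: hom_power)
  also have "\<dots> = of_nat p * \<sigma> c"
    unfolding n(3) using K by (simp add: hom_mult hom_of_nat K.of_nat_mem)
  finally show ?thesis
    using n \<sigma> by (intro O_K.radicalI[of _ _ n] O_K.cong_modI[of "\<sigma> c"]) (auto simp: Gal_mem_O_K)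
qed

lemma radical_O_K_of_int_dvd:
  assumes p: "prime p" and a: "of_int a \<in> radical_O_K p"
  shows "int p dvd a"
proof -
  obtain n c where "c \<in> O_K" "of_int (a ^ n) = of_int (int p) * c"
    using a by (auto simp: O_K.cong_mod_def elim!: O_K.radicalE)
  then have "int p dvd a ^ n"
    by (intro of_int_dvd_O_K)
  then show ?thesis
    using p by (simp add: prime_dvd_power)
qed

lemma of_int_cong_mod_0:
  assumes "int p dvd a"
  shows "O_K.cong_mod (of_nat p) (of_int a) 0"
proof -
  obtain b where "a = int p * b"
    using assms by (elim dvdE)
  then show ?thesis
    by (intro O_K.cong_modI[OF O_K.of_int_mem[of b]]) simp
qed

text \<open>By Cramer's rule, \<open>c\<^sub>l\<close> times the determinant of the conjugates of an integral basis \<open>w\<close> is a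
  determinant with a column of conjugates of \<open>x\<close>, so \<open>p\<close> divides \<open>c\<^sub>l\<^sup>2\<close> times the discriminant.\<close>

lemma radical_O_K_unramified:
  assumes p: "prime p" and D: "\<not> int p dvd field_discriminant K" and x: "x \<in> radical_O_K p"
  shows "O_K.cong_mod (of_nat p) x 0"
proof -
  obtain w where w: "int_mod.basis_family O_K m w" "of_int (field_discriminant K) = disc w"
    by (rule field_discriminant_eq_disc)
  note wO = int_mod.basis_familyD(1)[OF w(1)]
  have xO: "x \<in> O_K"
    using x O_K.ideal_in_subset[OF ideal_radical_O_K] by blast
  obtain c where c: "x = (\<Sum>i<m. of_int (c i) * w i)"
    using int_mod.basis_familyD(2)[OF w(1) xO] by blast
  have "int p dvd c l" if l: "l < m" for l
  proof -
    let ?v = "w(l := x)"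
    have "det (conj_mat ?v) \<in> radical_O_K p"
    proof (rule O_K.det_mem_ideal[OF ideal_radical_O_K conj_mat_carrier _ l])
      show "conj_mat ?v $$ (i, l) \<in> radical_O_K p" if "i < m" for i
        using that l x by (simp add: conj_mat_index radical_O_K_Gal gal_Gal)
      show "conj_mat ?v $$ (i, j) \<in> O_K" if "i < m" "j < m" for i j
        using that xO wO by (simp add: conj_mat_index Gal_mem_O_K gal_Gal)
    qed
    then have "disc ?v \<in> radical_O_K p"
      unfolding disc_def power2_eq_square using xO wO
      by (intro O_K.ideal_in_mult[OF ideal_radical_O_K] det_conj_mat_O_K) auto
    moreover have "disc ?v = of_int ((c l)\<^sup>2 * field_discriminant K)"
      using disc_update[of w l "\<lambda>i. of_int (c i)"] wO O_K_subset_K l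
      by (auto simp: c w(2) of_rat_power)
    ultimately have "int p dvd (c l)\<^sup>2 * field_discriminant K"
      using radical_O_K_of_int_dvd[OF p] by simp
    then show ?thesis
      using p D by (simp add: prime_dvd_mult_iff prime_dvd_power_iff)
  qed
  then have "O_K.cong_mod (of_nat p) (\<Sum>i<m. w i * of_int (c i)) (\<Sum>i<m. w i * 0)"
    using wO by (intro O_K.cong_mod_sum O_K.cong_mod_mult_left of_int_cong_mod_0) auto
  then show ?thesis
    by (simp add: c mult.commute)
qed

lemma prod_conjugates_linear_Ints:
  assumes x: "x \<in> O_K"
  shows "(\<Prod>\<sigma>\<in>Gal. [:- \<sigma> x, 1:]) \<in> polys_over \<int>" (is "?h \<in> _")
proof (rule polys_overI, rule O_K_Gal_fixed_Ints)
  have conj: "\<sigma> x \<in> O_K" if "\<sigma> \<in> Gal" for \<sigma>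
    using that x by (rule Gal_mem_O_K)
  then show "coeff ?h n \<in> O_K" for n
    by (intro coeff_polys_over OX.prod_mem O_K.linear_polys_over O_K.uminus_mem O_K.one_mem)
  fix n \<tau> assume \<tau>: "\<tau> \<in> Gal"
  interpret subfield_hom K \<tau>
    using \<tau> by (rule Gal_hom)
  have "map_poly \<tau> ?h = ?h"
    using conj O_K_subset_K by (intro map_poly_prod_linear_permuted[OF bij_betw_comp_Gal[OF \<tau>]])
      auto
  then show "\<tau> (coeff ?h n) = coeff ?h n"
    using coeff_map_poly[of \<tau> ?h n] hom_zero by simp
qed

lemma prod_conjugates_poly_linear_Ints:
  assumes f: "f \<in> polys_over O_K"
  shows "(\<Prod>\<sigma>\<in>Gal. [:- map_poly \<sigma> f, 1:]) \<in> polys_over (polys_over \<int>)" (is "?\<Phi> \<in> _")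
proof (rule polys_overI, rule polys_overI, rule O_K_Gal_fixed_Ints)
  have conj: "map_poly \<sigma> f \<in> polys_over O_K" if "\<sigma> \<in> Gal" for \<sigma>
    using that f by (auto simp: polys_over_def coeff_map_poly Gal_zero Gal_mem_O_K)
  show "coeff (coeff ?\<Phi> n) k \<in> O_K" for n k
    using conj
    by (intro coeff_polys_over comm_subring.prod_mem[OF OX.comm_subring_polys_over]
      OX.linear_polys_over
        OX.uminus_mem OX.one_mem)
  fix n k \<tau> assume \<tau>: "\<tau> \<in> Gal"
  interpret subfield_hom K \<tau>
    using \<tau> by (rule Gal_hom)
  interpret X: subring_hom "polys_over K" "map_poly \<tau>"
    by (rule subring_hom_map_poly)
  have "map_poly \<tau> (map_poly \<sigma> f) = map_poly (\<tau> \<circ> \<sigma>) f" if "\<sigma> \<in> Gal" for \<sigma>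
    by (rule map_poly_map_poly) (rule hom_zero)
  then have "map_poly (map_poly \<tau>) ?\<Phi> = ?\<Phi>"
    using conj polys_over_mono[OF O_K_subset_K]
    by (intro X.map_poly_prod_linear_permuted[OF bij_betw_comp_Gal[OF \<tau>]]) auto
  then have "coeff (coeff (map_poly (map_poly \<tau>) ?\<Phi>) n) k = coeff (coeff ?\<Phi> n) k"
    by simp
  then show "\<tau> (coeff (coeff ?\<Phi> n) k) = coeff (coeff ?\<Phi> n) k"
    by (simp add: coeff_map_poly hom_zero)
qed

lemma radical_O_K_power_m:
  assumes p: "prime p" and x: "x \<in> radical_O_K p"
  shows "O_K.cong_mod (of_nat p) (x ^ m) 0"
proof -
  define h where "h = (\<Prod>\<sigma>\<in>Gal. [:- \<sigma> x, 1:])"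
  have xO: "x \<in> O_K"
    using x O_K.ideal_in_subset[OF ideal_radical_O_K] by blast
  have "h - monom 1 m \<in> polys_over (radical_O_K p)"
    using O_K.prod_linear_minus_monom_polys_over[OF ideal_radical_O_K, of Gal "\<lambda>\<sigma>. \<sigma> x"]
      radical_O_K_Gal x
    by (simp add: h_def card_Gal)
  moreover have "h - monom 1 m \<in> polys_over \<int>"
    using prod_conjugates_linear_Ints[OF xO] by (auto simp: polys_over_def h_def)
  ultimately have "O_K.cong_mod (of_nat p) (coeff (h - monom 1 m) i) 0" for i
    using radical_O_K_of_int_dvd[OF p] of_int_cong_mod_0 by (metis Ints_cases coeff_polys_over)
  then have "O_K.cong_mod (of_nat p) (poly (h - monom 1 m) x) 0"
    using xO by (rule O_K.cong_mod_poly_0)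
  moreover have "poly h x = 0"
    unfolding h_def poly_prod using finite_Gal id_Gal by (intro prod_zero bexI[of _ id]) auto
  ultimately have "O_K.cong_mod (of_nat p) (0 - x ^ m) 0"
    by (simp add: poly_monom)
  then show ?thesis
    using O_K.cong_mod_sym by (simp only: O_K.cong_mod_diff_eq_0_iff)
qed

section \<open>Frobenius automorphisms\<close>

lemma poly_power_prime_cong_mod:
  assumes p: "prime p" and f: "f \<in> polys_over O_K" and \<Phi>: "\<Phi> \<in> polys_over (polys_over \<int>)"
  shows "OX.cong_mod (of_nat p) (poly \<Phi> f ^ p)
    (pcompose (poly \<Phi> (map_poly (\<lambda>a. a ^ p) f)) (monom 1 p))"
proof -
  have p0: "p > 0"
    using p prime_gt_0_nat by blast
  let ?f' = "map_poly (\<lambda>a. a ^ p) f" and ?\<psi> = "\<lambda>g. pcompose g (monom 1 p) :: complex poly"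
  interpret \<psi>: subring_hom UNIV ?\<psi>
    by unfold_locales (auto simp: pcompose_add pcompose_mult pcompose_1)
  have \<psi>: "?\<psi> g \<in> polys_over O_K" if "g \<in> polys_over O_K" for g
    using that by (intro O_K.pcompose_polys_over O_K.monom_polys_over O_K.one_mem)
  have f': "?f' \<in> polys_over O_K"
    using coeff_polys_over[OF f] p0 by (intro polys_overI)
      (simp add: coeff_map_poly power_0_left O_K.power_mem)
  have Ints: "polys_over \<int> \<subseteq> polys_over O_K"
    by (intro polys_over_mono O_K.Ints_subset)
  have "OX.cong_mod (of_nat p) (poly \<Phi> f ^ p) (poly (map_poly ?\<psi> \<Phi>) (f ^ p))"
  proof (rule OX.cong_mod_poly_power_prime[OF p \<Phi> Ints f])
    fix g :: "complex poly" assume g: "g \<in> polys_over \<int>"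
    have "O_K.cong_mod (of_nat p) (coeff g i ^ p) (coeff g i)" for i
      using coeff_polys_over[OF g, of i] O_K.cong_mod_fermat[OF p] by (auto elim!: Ints_cases)
    then show "OX.cong_mod (of_nat p) (g ^ p) (?\<psi> g)"
      using O_K.polys_cong_mod_power_prime[OF p, of g "\<lambda>x. x"] g Ints by auto
  qed simp
  also have "OX.cong_mod (of_nat p) \<dots> (poly (map_poly ?\<psi> \<Phi>) (?\<psi> ?f'))"
  proof (rule OX.cong_mod_poly)
    show "map_poly ?\<psi> \<Phi> \<in> polys_over (polys_over O_K)"
    proof (rule polys_overI)
      show "coeff (map_poly ?\<psi> \<Phi>) n \<in> polys_over O_K" for n
        using coeff_polys_over[OF \<Phi>] Ints \<psi> by (simp add: coeff_map_poly subset_iff)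
    qed
    show "OX.cong_mod (of_nat p) (f ^ p) (?\<psi> ?f')"
      using p0 by (intro O_K.polys_cong_mod_power_prime p f O_K.cong_mod_refl)
        (simp add: power_0_left)
  qed (use f f' \<psi> OX.power_mem in auto)
  also have "poly (map_poly ?\<psi> \<Phi>) (?\<psi> ?f') = ?\<psi> (poly \<Phi> ?f')"
    by (rule \<psi>.hom_poly[symmetric]) (auto simp: polys_over_def)
  finally show ?thesis .
qed

lemma prod_Frobenius_minus_conjugate_polys_over:
  assumes p: "prime p" and f: "f \<in> polys_over O_K"
  shows "(\<Prod>\<sigma>\<in>Gal. map_poly (\<lambda>a. a ^ p) f - map_poly \<sigma> f) \<in> polys_over (radical_O_K p)" (is "?F \<in> _")
proof (rule polys_overI)
  have p0: "p > 0"
    using p prime_gt_0_nat by blast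
  define \<Phi> where "\<Phi> = (\<Prod>\<sigma>\<in>Gal. [:- map_poly \<sigma> f, 1:])"
  have "poly \<Phi> f = 0"
    unfolding \<Phi>_def poly_prod using finite_Gal id_Gal by (intro prod_zero bexI[of _ id]) auto
  moreover have "poly \<Phi> (map_poly (\<lambda>a. a ^ p) f) = ?F"
    by (simp add: \<Phi>_def poly_prod)
  ultimately have "OX.cong_mod (of_nat p) 0 (pcompose ?F (monom 1 p))"
    using poly_power_prime_cong_mod[OF p f, of \<Phi>] prod_conjugates_poly_linear_Ints[OF f] p0
    by (simp add: \<Phi>_def power_0_left)
  fix i
  have "O_K.cong_mod (of_nat p) (coeff (pcompose ?F (monom 1 p)) (p * i)) 0"
    using \<open>OX.cong_mod _ _ _\<close> O_K.polys_cong_mod_iff O_K.cong_mod_sym by (metis coeff_0)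
  then have "O_K.cong_mod (of_nat p) (coeff ?F i ^ 1) 0"
    by (simp add: coeff_pcompose_monom[OF p0])
  moreover have "map_poly (\<lambda>a. a ^ p) f - map_poly \<sigma> f \<in> polys_over O_K" if "\<sigma> \<in> Gal" for \<sigma>
    using that p0 coeff_polys_over[OF f] by (intro polys_overI)
      (simp add: coeff_map_poly power_0_left Gal_zero O_K.diff_mem O_K.power_mem Gal_mem_O_K)
  ultimately show "coeff ?F i \<in> radical_O_K p"
    by (intro O_K.radicalI coeff_polys_over OX.prod_mem)
qed

text \<open>For every prime ideal \<open>P\<close> above \<open>p\<close> some \<open>\<sigma>\<close> satisfies \<open>x\<^sup>p \<equiv> \<sigma> x\<close> modulo \<open>P\<close> for all \<open>x\<close>: otherwise
  the product below, with a counterexample \<open>z \<sigma>\<close> for every \<open>\<sigma>\<close>, would avoid \<open>P\<close>. Taking the \<open>z \<sigma>\<close> as the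
  coefficients of one polynomial allows the factors to be chosen independently.\<close>

lemma prod_Frobenius_minus_conjugate_mem_radical_O_K:
  assumes p: "prime p" and z: "\<And>\<sigma>. \<sigma> \<in> Gal \<Longrightarrow> z \<sigma> \<in> O_K"
  shows "(\<Prod>\<sigma>\<in>Gal. z \<sigma> ^ p - \<sigma> (z \<sigma>)) \<in> radical_O_K p"
proof -
  have p0: "p > 0"
    using p prime_gt_0_nat by blast
  define f where "f = (\<Sum>k<m. monom (z (gal k)) k)"
  have coeff_f: "coeff f k = (if k < m then z (gal k) else 0)" for k
    by (simp add: f_def coeff_sum)
  have f: "f \<in> polys_over O_K"
    using z gal_Gal O_K.zero_mem by (simp add: polys_over_def coeff_f)
  define F where "F \<sigma> = map_poly (\<lambda>a. a ^ p) f - map_poly \<sigma> f" for \<sigma>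
  have coeff_F: "coeff (F \<sigma>) k = coeff f k ^ p - \<sigma> (coeff f k)" if "\<sigma> \<in> Gal" for \<sigma> k
    using that p0 by (simp add: F_def coeff_map_poly power_0_left Gal_zero)
  have F: "F \<sigma> \<in> polys_over O_K" if "\<sigma> \<in> Gal" for \<sigma>
    using that coeff_polys_over[OF f] by (intro polys_overI)
      (simp add: coeff_F O_K.diff_mem O_K.power_mem Gal_mem_O_K)
  have "smult 1 (prod F Gal) \<in> polys_over (radical_O_K p)"
    using prod_Frobenius_minus_conjugate_polys_over[OF p f] by (simp add: F_def)
  then have "1 * (\<Prod>\<sigma>\<in>Gal. coeff (F \<sigma>) (the_inv_into {..<m} gal \<sigma>)) \<in> radical_O_K p"
    using F finite_Gal O_K.one_mem
    by (intro O_K.prod_coeff_mem_radical_ideal radical_ideal_radical_O_K) auto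
  also have "(\<Prod>\<sigma>\<in>Gal. coeff (F \<sigma>) (the_inv_into {..<m} gal \<sigma>)) = (\<Prod>\<sigma>\<in>Gal. z \<sigma> ^ p - \<sigma> (z \<sigma>))"
  proof (rule prod.cong[OF refl])
    fix \<sigma> assume \<sigma>: "\<sigma> \<in> Gal"
    then obtain k where "k < m" "\<sigma> = gal k"
      using bij_betw_imp_surj_on[OF bij_gal] by auto
    then show "coeff (F \<sigma>) (the_inv_into {..<m} gal \<sigma>) = z \<sigma> ^ p - \<sigma> (z \<sigma>)"
      using \<sigma> bij_betw_imp_inj_on[OF bij_gal] by (simp add: coeff_F coeff_f the_inv_into_f_f)
  qed
  finally show ?thesis
    by simp
qed

lemma funpow_Gal_mem_O_K: "\<sigma> \<in> Gal \<Longrightarrow> x \<in> O_K \<Longrightarrow> (\<sigma> ^^ n) x \<in> O_K"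
  by (induction n) (simp_all add: Gal_mem_O_K)

lemma power_minus_self_telescope:
  assumes \<sigma>: "\<sigma> \<in> Gal" and t: "m dvd t" and x: "x \<in> O_K"
  shows "\<exists>b. (\<forall>n. b n \<in> O_K) \<and>
    x ^ (p ^ t) - x = (\<Sum>n<t. ((\<sigma> ^^ n) x ^ p - \<sigma> ((\<sigma> ^^ n) x)) * b n)"
proof -
  let ?u = "\<lambda>n. (\<sigma> ^^ n) x ^ (p ^ (t - n))"
  define b where "b n = (\<Sum>i<p ^ (t - Suc n). \<sigma> ((\<sigma> ^^ n) x) ^ (p ^ (t - Suc n) - Suc i) * ((\<sigma> ^^ n) x ^ p) ^ i)"
    for n
  have "x ^ (p ^ t) - x = ?u 0 - ?u t"
    by (simp add: Gal_funpow_eq_id[OF \<sigma> t])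
  also have "\<dots> = (\<Sum>n<t. ?u n - ?u (Suc n))"
    by (rule sum_lessThan_telescope'[symmetric])
  also have "\<dots> = (\<Sum>n<t. ((\<sigma> ^^ n) x ^ p - \<sigma> ((\<sigma> ^^ n) x)) * b n)"
  proof (rule sum.cong[OF refl])
    fix n assume "n \<in> {..<t}"
    then have "p ^ (t - n) = p * p ^ (t - Suc n)"
      by (simp add: Suc_diff_Suc flip: power_Suc)
    then have "?u n = ((\<sigma> ^^ n) x ^ p) ^ (p ^ (t - Suc n))"
      by (simp add: power_mult)
    then show "?u n - ?u (Suc n) = ((\<sigma> ^^ n) x ^ p - \<sigma> ((\<sigma> ^^ n) x)) * b n"
      by (simp only: b_def power_diff_sumr2 funpow.simps o_apply)
  qed
  finally have "x ^ (p ^ t) - x = (\<Sum>n<t. ((\<sigma> ^^ n) x ^ p - \<sigma> ((\<sigma> ^^ n) x)) * b n)" .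
  moreover have "b n \<in> O_K" for n
    unfolding b_def by (intro O_K.sum_mem O_K.mult_mem O_K.power_mem Gal_mem_O_K[OF \<sigma>]
      funpow_Gal_mem_O_K[OF \<sigma> x])
  ultimately show ?thesis
    by blast
qed

lemma power_minus_self_mem_radical_O_K:
  assumes p: "prime p" and t: "m dvd t" and x: "x \<in> O_K"
  shows "x ^ (p ^ t) - x \<in> radical_O_K p"
proof -
  define a where "a \<sigma> n = (\<sigma> ^^ n) x ^ p - \<sigma> ((\<sigma> ^^ n) x)" for \<sigma> :: "complex \<Rightarrow> complex" and n
  have "\<forall>\<sigma>\<in>Gal. \<exists>b. (\<forall>n. b n \<in> O_K) \<and> x ^ (p ^ t) - x = (\<Sum>n<t. a \<sigma> n * b n)"
    unfolding a_def using power_minus_self_telescope[OF _ t x] by blast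
  then obtain b where b: "\<And>\<sigma> n. \<sigma> \<in> Gal \<Longrightarrow> b \<sigma> n \<in> O_K"
      "\<And>\<sigma>. \<sigma> \<in> Gal \<Longrightarrow> x ^ (p ^ t) - x = (\<Sum>n<t. a \<sigma> n * b \<sigma> n)"
    by metis
  have "(x ^ (p ^ t) - x) ^ m = (\<Prod>\<sigma>\<in>Gal. x ^ (p ^ t) - x)"
    by (simp add: card_Gal)
  also have "\<dots> = (\<Prod>\<sigma>\<in>Gal. \<Sum>n<t. a \<sigma> n * b \<sigma> n)"
    by (intro prod.cong refl b(2))
  also have "\<dots> = (\<Sum>g\<in>Gal \<rightarrow>\<^sub>E {..<t}. \<Prod>\<sigma>\<in>Gal. a \<sigma> (g \<sigma>) * b \<sigma> (g \<sigma>))"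
    using finite_Gal by (rule prod_sum_PiE) simp
  also have "\<dots> \<in> radical_O_K p"
  proof (rule O_K.ideal_in_sum[OF ideal_radical_O_K])
    fix g
    have "(\<Prod>\<sigma>\<in>Gal. a \<sigma> (g \<sigma>)) \<in> radical_O_K p"
      unfolding a_def using p x
      by (intro prod_Frobenius_minus_conjugate_mem_radical_O_K funpow_Gal_mem_O_K)
    moreover have "(\<Prod>\<sigma>\<in>Gal. b \<sigma> (g \<sigma>)) \<in> O_K"
      using b(1) by (rule O_K.prod_mem)
    ultimately show "(\<Prod>\<sigma>\<in>Gal. a \<sigma> (g \<sigma>) * b \<sigma> (g \<sigma>)) \<in> radical_O_K p"
      using O_K.ideal_in_mult[OF ideal_radical_O_K] by (simp add: prod.distrib mult.commute)
  qed
  finally show ?thesis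
    by (rule O_K.radical_ideal_inD(2)[OF radical_ideal_radical_O_K
      O_K.diff_mem[OF O_K.power_mem[OF x] x]])
qed

lemma power_prime_power_cong_unramified:
  assumes p: "prime p" and D: "\<not> int p dvd field_discriminant K"
    and t: "m dvd t" "t \<ge> 1" and x: "x \<in> O_K"
  shows "O_K.cong_mod (of_nat p ^ Suc l) (x ^ (p ^ (Suc l * t))) (x ^ (p ^ (l * t)))"
proof -
  have "O_K.cong_mod (of_nat p) (x ^ (p ^ t) - x) 0"
    using p D power_minus_self_mem_radical_O_K[OF p t(1) x] by (rule radical_O_K_unramified)
  then have "O_K.cong_mod (of_nat p) (x ^ (p ^ t)) x"
    by (simp only: O_K.cong_mod_diff_eq_0_iff)
  then have "O_K.cong_mod (of_nat p ^ Suc (l * t)) ((x ^ (p ^ t)) ^ (p ^ (l * t))) (x ^ (p ^ (l * t)))"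
    using x by (intro O_K.cong_mod_power_lift_iterate O_K.power_mem)
  then have "O_K.cong_mod (of_nat p ^ Suc l) ((x ^ (p ^ t)) ^ (p ^ (l * t))) (x ^ (p ^ (l * t)))"
    by (rule O_K.cong_mod_power_le) (use t(2) in \<open>auto intro: O_K.of_nat_mem\<close>)
  then show ?thesis
    by (simp add: power_add flip: power_mult)
qed

lemma power_prime_power_cong:
  assumes p: "prime p" and t: "m dvd t" "t \<ge> 1" and x: "x \<in> O_K"
  shows "O_K.cong_mod (of_nat p ^ l) (x ^ (p ^ (Suc l * t))) (x ^ (p ^ (l * t)))"
proof (cases l)
  case 0
  then show ?thesis
    using x by (intro O_K.cong_modI[of "x ^ (p ^ (Suc l * t)) - x ^ (p ^ (l * t))"])
      (auto intro: O_K.diff_mem O_K.power_mem)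
next
  case (Suc j)
  define y where "y = x ^ (p ^ t) - x"
  have y: "y \<in> radical_O_K p" "y \<in> O_K"
    unfolding y_def using power_minus_self_mem_radical_O_K[OF p t(1) x] x
    by (auto intro: O_K.diff_mem O_K.power_mem)
  have "m \<le> p ^ t"
    using t dvd_imp_le[of m t] power_gt_expt[OF prime_gt_Suc_0_nat[OF p], of t] by linarith
  then have zero: "O_K.cong_mod (of_nat p) (y ^ (p ^ t)) 0"
    by (rule O_K.cong_mod_0_power_le[OF radical_O_K_power_m[OF p y(1)] y(2)])
  have "O_K.cong_mod (of_nat p) ((x + y) ^ (p ^ t)) (x ^ (p ^ t) + y ^ (p ^ t))"
    using p x y(2) by (rule O_K.cong_mod_freshman_power)
  also have "O_K.cong_mod (of_nat p) \<dots> (x ^ (p ^ t) + 0)"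
    by (intro O_K.cong_mod_add O_K.cong_mod_refl zero)
  finally have "O_K.cong_mod (of_nat p) (x ^ (p ^ (2 * t))) (x ^ (p ^ t))"
    by (simp add: y_def power_add mult_2 flip: power_mult)
  then have "O_K.cong_mod (of_nat p ^ Suc (j * t)) ((x ^ (p ^ (2 * t))) ^ (p ^ (j * t))) ((x ^ (p ^ t)) ^ (p ^ (j * t)))"
    using x by (intro O_K.cong_mod_power_lift_iterate O_K.power_mem)
  then have "O_K.cong_mod (of_nat p ^ l) ((x ^ (p ^ (2 * t))) ^ (p ^ (j * t))) ((x ^ (p ^ t)) ^ (p ^ (j * t)))"
    by (rule O_K.cong_mod_power_le) (use t(2) Suc in \<open>auto intro: O_K.of_nat_mem\<close>)
  then show ?thesis
    by (simp add: Suc power_add mult_2 mult.assoc flip: power_mult)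
qed

lemma int_prime_dvd_rad:
  assumes "prime p" "int p dvd D" "D \<noteq> 0"
  shows "int p dvd rad D"
proof -
  have "int p \<in> prime_factors D"
    using assms by (auto simp: in_prime_factors_iff)
  then show ?thesis
    unfolding rad_def by (metis dvd_prodI finite_set_mset)
qed

lemma rad_discriminant_power_cong:
  assumes p: "prime p" and t: "m dvd t" "t \<ge> 1" and x: "x \<in> O_K"
  shows "O_K.cong_mod (of_nat p ^ Suc l)
    (of_int (rad (field_discriminant K)) * x ^ (p ^ (Suc l * t)))
    (of_int (rad (field_discriminant K)) * x ^ (p ^ (l * t)))"
proof (cases "int p dvd field_discriminant K")
  case False
  then show ?thesis
    using p t x by (intro O_K.cong_mod_mult_left O_K.of_int_mem power_prime_power_cong_unramified)
next
  case True
  then obtain e where e: "rad (field_discriminant K) = int p * e"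
    using int_prime_dvd_rad[OF p True field_discriminant_nonzero] by (elim dvdE)
  obtain c where "c \<in> O_K" "x ^ (p ^ (Suc l * t)) - x ^ (p ^ (l * t)) = of_nat p ^ l * c"
    using power_prime_power_cong[OF p t x] unfolding O_K.cong_mod_def by blast
  then show ?thesis
    by (intro O_K.cong_modI[of "of_int e * c"] O_K.mult_mem O_K.of_int_mem)
      (simp_all add: e mult_ac flip: right_diff_distrib)
qed

lemma prod_roots_Ints:
  assumes g: "g \<in> polys_over \<int>"
  shows "(\<Prod>z | poly C z = 0. poly g z) \<in> \<int>"
proof (rule O_K_Gal_fixed_Ints)
  let ?Z = "{z. poly C z = 0}"
  have Z: "z \<in> K" "z \<in> O_K" if "z \<in> ?Z" for z
    using that root_mem_K algebraic_int_root by (auto simp: O_K_iff)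
  have gR: "g \<in> polys_over O_K" "g \<in> polys_over \<rat>"
    using g polys_over_mono[OF O_K.Ints_subset] polys_over_Ints_subset_Rats by blast+
  show "(\<Prod>z\<in>?Z. poly g z) \<in> O_K"
    using Z(2) by (intro O_K.prod_mem O_K.poly_mem gR)
  fix \<sigma> assume \<sigma>: "\<sigma> \<in> Gal"
  interpret subfield_hom K \<sigma>
    using \<sigma> by (rule Gal_hom)
  have "\<sigma> ` ?Z = ?Z"
    using monic_C Gal_root[OF \<sigma> C_Rats] Z(1) inj_on_subset[OF inj_Gal[OF \<sigma>]]
    by (intro endo_inj_surj poly_roots_finite) auto
  then have bij: "bij_betw \<sigma> ?Z ?Z"
    using inj_on_subset[OF inj_Gal[OF \<sigma>]] by (simp add: bij_betw_def)
  have "poly g z \<in> K" if "z \<in> ?Z" for z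
    using O_K.poly_mem[OF gR(1) Z(2)[OF that]] O_K_subset_K by blast
  then have "\<sigma> (\<Prod>z\<in>?Z. poly g z) = (\<Prod>z\<in>?Z. \<sigma> (poly g z))"
    by (rule hom_prod)
  also have "\<dots> = (\<Prod>z\<in>?Z. poly g (\<sigma> z))"
    using Z(1) by (intro prod.cong refl hom_poly_Rats gR)
  also have "\<dots> = (\<Prod>z\<in>?Z. poly g z)"
    by (rule prod.reindex_bij_betw[OF bij])
  finally show "\<sigma> (\<Prod>z\<in>?Z. poly g z) = (\<Prod>z\<in>?Z. poly g z)" .
qed

end

section \<open>Binet's formula\<close>

definition poly_apply_seq :: "'a::comm_ring_1 poly \<Rightarrow> (nat \<Rightarrow> 'a) \<Rightarrow> 'a" where
  "poly_apply_seq f u = (\<Sum>i\<le>degree f. coeff f i * u i)"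

lemma poly_apply_seq_eq_sum:
  assumes "degree f \<le> n"
  shows "poly_apply_seq f u = (\<Sum>i\<le>n. coeff f i * u i)"
  unfolding poly_apply_seq_def using assms by (intro sum.mono_neutral_left) (auto simp: coeff_eq_0)

lemma poly_apply_seq_add: "poly_apply_seq (f + g) u = poly_apply_seq f u + poly_apply_seq g u"
proof -
  let ?n = "max (degree f) (degree g)"
  have "poly_apply_seq (f + g) u = (\<Sum>i\<le>?n. coeff (f + g) i * u i)"
    by (intro poly_apply_seq_eq_sum degree_add_le) auto
  also have "\<dots> = (\<Sum>i\<le>?n. coeff f i * u i) + (\<Sum>i\<le>?n. coeff g i * u i)"
    by (simp add: algebra_simps sum.distrib)
  finally show ?thesis
    by (simp add: poly_apply_seq_eq_sum[of _ ?n])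
qed

lemma poly_apply_seq_smult: "poly_apply_seq (smult c f) u = c * poly_apply_seq f u"
  using poly_apply_seq_eq_sum[OF degree_smult_le, of c f u]
  by (simp add: poly_apply_seq_def sum_distrib_left mult.assoc)

lemma poly_apply_seq_0: "poly_apply_seq 0 u = 0"
  by (simp add: poly_apply_seq_def)

lemma poly_apply_seq_sum: "poly_apply_seq (sum f A) u = (\<Sum>i\<in>A. poly_apply_seq (f i) u)"
  by (induction A rule: infinite_finite_induct) (auto simp: poly_apply_seq_0 poly_apply_seq_add)

lemma poly_apply_seq_monom: "poly_apply_seq (monom c n) u = c * u n"
proof -
  have "poly_apply_seq (monom c n) u = (\<Sum>i\<le>n. if n = i then c * u n else 0)"
    by (subst poly_apply_seq_eq_sum[OF degree_monom_le]) (intro sum.cong, auto)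
  then show ?thesis
    by simp
qed

lemma poly_apply_seq_pCons_0: "poly_apply_seq (pCons 0 f) u = poly_apply_seq f (\<lambda>n. u (Suc n))"
proof -
  have "poly_apply_seq (pCons 0 f) u = (\<Sum>i\<le>Suc (degree f). coeff (pCons 0 f) i * u i)"
    by (intro poly_apply_seq_eq_sum degree_pCons_le)
  then show ?thesis
    by (simp only: sum.atMost_Suc_shift) (simp add: poly_apply_seq_def)
qed

lemma (in comm_subring) poly_apply_seq_mem:
  assumes "f \<in> polys_over R" "\<And>n. u n \<in> R"
  shows "poly_apply_seq f u \<in> R"
  unfolding poly_apply_seq_def using assms by (intro sum_mem mult_mem coeff_polys_over)

definition annihilates :: "'a::comm_ring_1 poly \<Rightarrow> (nat \<Rightarrow> 'a) \<Rightarrow> bool" where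
  "annihilates f u \<longleftrightarrow> (\<forall>k. poly_apply_seq f (\<lambda>n. u (n + k)) = 0)"

lemma poly_apply_seq_mult_annihilates:
  assumes "annihilates f u"
  shows "poly_apply_seq (q * f) u = 0"
  using assms
proof (induction q arbitrary: u)
  case (pCons a q)
  have f: "poly_apply_seq f (\<lambda>n. u (n + k)) = 0" for k
    using pCons.prems by (simp add: annihilates_def)
  then have "annihilates f (\<lambda>n. u (Suc n))"
    using f[of "Suc _"] by (simp add: annihilates_def)
  then show ?case
    using f[of 0] pCons.IH by (simp add: poly_apply_seq_add poly_apply_seq_smult
      poly_apply_seq_pCons_0)
qed (simp add: poly_apply_seq_0)

lemma poly_pderiv_prod_linear:
  fixes a :: "'a::idom"
  assumes "finite A" "a \<in> A"
  shows "poly (pderiv (\<Prod>b\<in>A. [:- b, 1:])) a = poly (\<Prod>b\<in>A - {a}. [:- b, 1:]) a"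
proof -
  define q where "q = (\<Prod>b\<in>A - {a}. [:- b, 1:])"
  have "(\<Prod>b\<in>A. [:- b, 1:]) = [:- a, 1:] * q"
    unfolding q_def using assms by (rule prod.remove)
  moreover have "poly (pderiv ([:- a, 1:] * q)) a = poly q a"
    unfolding pderiv_mult by (simp add: pderiv_pCons)
  ultimately show ?thesis
    by (simp only: q_def)
qed

lemma poly_pderiv_prod_linear_nonzero:
  fixes a :: "'a::idom"
  assumes "finite A" "a \<in> A"
  shows "poly (pderiv (\<Prod>b\<in>A. [:- b, 1:])) a \<noteq> 0"
  using assms by (simp add: poly_pderiv_prod_linear poly_prod)

lemma prod_linear_dvd:
  fixes f :: "'a::field poly"
  assumes "finite A" "\<And>a. a \<in> A \<Longrightarrow> poly f a = 0"
  shows "(\<Prod>a\<in>A. [:- a, 1:]) dvd f"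
  using assms
proof (induction A arbitrary: f rule: finite_induct)
  case (insert a A)
  then obtain g where g: "f = [:- a, 1:] * g"
    by (metis dvdE insertI1 poly_eq_0_iff_dvd)
  have "poly g b = 0" if "b \<in> A" for b
    using that insert by (auto simp: g)
  then have "(\<Prod>a\<in>A. [:- a, 1:]) dvd g"
    by (rule insert.IH)
  then show ?case
    unfolding g prod.insert[OF insert.hyps] by (rule mult_dvd_mono[OF dvd_refl])
qed simp

lemma binet_formula:
  fixes u :: "nat \<Rightarrow> 'a::field"
  assumes A: "finite A" and f: "f = (\<Prod>a\<in>A. [:- a, 1:])" and u: "annihilates f u"
  shows "u n = (\<Sum>a\<in>A. poly_apply_seq (\<Prod>b\<in>A - {a}. [:- b, 1:]) u / poly (pderiv f) a * a ^ n)"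
proof -
  define L where "L a = (\<Prod>b\<in>A - {a}. [:- b, 1:])" for a
  have L: "poly (L a) b = (if a = b then poly (pderiv f) a else 0)" if "a \<in> A" "b \<in> A" for a b
    using that A poly_pderiv_prod_linear[OF A \<open>a \<in> A\<close>] by (auto simp: L_def f poly_prod)
  have L_nonzero: "poly (pderiv f) a \<noteq> 0" if "a \<in> A" for a
    unfolding f using A that by (rule poly_pderiv_prod_linear_nonzero)
  define g where "g = (\<Sum>a\<in>A. smult (a ^ n / poly (pderiv f) a) (L a))"
  have "f dvd monom 1 n - g"
    unfolding f
  proof (rule prod_linear_dvd[OF A])
    fix b assume b: "b \<in> A"
    have "poly g b = (\<Sum>a\<in>A. if a = b then b ^ n else 0)"
      unfolding g_def poly_sum using b by (intro sum.cong) (simp_all add: L L_nonzero)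
    then show "poly (monom 1 n - g) b = 0"
      using b A by (simp add: poly_monom)
  qed
  then obtain q where "monom 1 n - g = f * q"
    by (elim dvdE)
  then have "monom 1 n = g + q * f"
    by (simp add: algebra_simps)
  then have "poly_apply_seq (monom 1 n) u = poly_apply_seq g u"
    using poly_apply_seq_mult_annihilates[OF u] by (simp add: poly_apply_seq_add)
  then show ?thesis
    by (simp add: poly_apply_seq_monom g_def poly_apply_seq_sum poly_apply_seq_smult L_def
      mult.commute)
qed

lemma annihilates_char_poly:
  fixes u :: "nat \<Rightarrow> 'a::comm_ring_1"
  assumes u: "\<And>n. n \<ge> d \<Longrightarrow> u n = (\<Sum>i=1..d. r i * u (n - i))"
  shows "annihilates (monom 1 d - (\<Sum>i=1..d. monom (r i) (d - i))) u"
  unfolding annihilates_def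
proof
  fix k
  define v where "v = (\<lambda>n. u (n + k))"
  define g where "g = (\<Sum>i=1..d. monom (r i) (d - i))"
  have "u (d + k) = (\<Sum>i=1..d. r i * u (d + k - i))"
    by (rule u) simp
  also have "\<dots> = (\<Sum>i=1..d. r i * v (d - i))"
    by (intro sum.cong) (simp_all add: v_def)
  finally have "poly_apply_seq (monom 1 d) v = poly_apply_seq g v"
    by (simp add: g_def v_def poly_apply_seq_sum poly_apply_seq_monom)
  moreover have "poly_apply_seq (monom 1 d) v = poly_apply_seq (monom 1 d - g) v + poly_apply_seq g v"
    by (simp flip: poly_apply_seq_add)
  ultimately show "poly_apply_seq (monom 1 d - (\<Sum>i=1..d. monom (r i) (d - i))) (\<lambda>n. u (n + k)) = 0"
    unfolding g_def v_def by simp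
qed

lemma annihilates_of_int_char_poly:
  fixes U :: "nat \<Rightarrow> int"
  assumes U: "\<And>n. n \<ge> d \<Longrightarrow> U n = (\<Sum>i=1..d. r i * U (n - i))"
  shows "annihilates (map_poly of_int (monom 1 d - (\<Sum>i=1..d. monom (r i) (d - i)))) (\<lambda>n. of_int (U n) :: complex)"
proof -
  have "of_int (U n) = (\<Sum>i=1..d. of_int (r i) * of_int (U (n - i)) :: complex)" if "n \<ge> d" for n
    using U[OF that] by simp
  then show ?thesis
    using annihilates_char_poly[of d "\<lambda>n. of_int (U n) :: complex" "\<lambda>i. of_int (r i)"]
    by (simp add: hom_distribs map_poly_monom)
qed

lemma (in splitting_field) binet_formula_O_K:
  fixes U :: "nat \<Rightarrow> int"
  assumes C: "C = (\<Prod>z | poly C z = 0. [:- z, 1:])" and U: "annihilates C (\<lambda>n. of_int (U n))"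
  shows "\<exists>\<gamma>. (\<forall>z. poly C z = 0 \<longrightarrow> \<gamma> z \<in> O_K) \<and>
    (\<forall>n. (\<Prod>z | poly C z = 0. poly (pderiv C) z) * of_int (U n) = (\<Sum>z | poly C z = 0. \<gamma> z * z ^ n))"
proof -
  let ?Z = "{z. poly C z = 0}"
  define E where "E = (\<Prod>z\<in>?Z. poly (pderiv C) z)"
  define b where "b z = poly_apply_seq (\<Prod>y\<in>?Z - {z}. [:- y, 1:]) (\<lambda>n. of_int (U n))" for z
  define \<gamma> where "\<gamma> z = (\<Prod>y\<in>?Z - {z}. poly (pderiv C) y) * b z" for z
  have fin: "finite ?Z"
    using monic_C by (intro poly_roots_finite) auto
  have Z: "z \<in> O_K" if "z \<in> ?Z" for z
    using that root_mem_K algebraic_int_root by (auto simp: O_K_iff)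
  have "pderiv C \<in> polys_over O_K"
    using C_Ints polys_over_mono[OF O_K.Ints_subset]
    by (intro pderiv_polys_over O_K.comm_subring_axioms) auto
  then have deriv: "poly (pderiv C) z \<in> O_K" if "z \<in> ?Z" for z
    using Z that by (intro O_K.poly_mem)
  have "b z \<in> O_K" for z
    unfolding b_def using Z
    by (intro O_K.poly_apply_seq_mem O_K.of_int_mem OX.prod_mem O_K.linear_polys_over
      O_K.uminus_mem O_K.one_mem) auto
  then have "\<gamma> z \<in> O_K" for z
    unfolding \<gamma>_def using deriv by (intro O_K.mult_mem O_K.prod_mem) auto
  moreover have "E * of_int (U n) = (\<Sum>z\<in>?Z. \<gamma> z * z ^ n)" for n
  proof -
    have "E * (b z / poly (pderiv C) z * z ^ n) = \<gamma> z * z ^ n" if z: "z \<in> ?Z" for z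
    proof -
      have "poly (pderiv C) z \<noteq> 0"
        using fin z by (subst C) (rule poly_pderiv_prod_linear_nonzero)
      moreover have "E = poly (pderiv C) z * (\<Prod>y\<in>?Z - {z}. poly (pderiv C) y)"
        unfolding E_def using fin z by (rule prod.remove)
      ultimately show ?thesis
        by (simp add: \<gamma>_def)
    qed
    moreover have "of_int (U n) = (\<Sum>z\<in>?Z. b z / poly (pderiv C) z * z ^ n)"
      unfolding b_def using fin C U by (rule binet_formula)
    ultimately show ?thesis
      by (simp add: sum_distrib_left)
  qed
  ultimately show ?thesis
    unfolding E_def by blast
qed

section \<open>The Dold condition\<close>

lemma moebius_mu_prime_mult:
  assumes p: "prime p" and e: "\<not> p dvd e" "e > 0"
  shows "moebius_mu (p * e) = - moebius_mu e"
proof -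
  have cop: "Rings.coprime p e"
    using p e by (simp add: prime_imp_coprime)
  have "squarefree (p * e) \<longleftrightarrow> squarefree e"
    using squarefree_mult_coprime[OF cop squarefree_prime[OF p]] squarefree_multD[of p e]
    by blast
  moreover have "prime_factors (p * e) = insert p (prime_factors e)"
    using p e prime_factors_product[of p e] prime_prime_factors[OF p] by (auto simp: prime_gt_0_nat)
  moreover have "p \<notin> prime_factors e"
    using e by (auto simp: in_prime_factors_iff)
  ultimately show ?thesis
    by (simp add: moebius_mu_def)
qed

lemma squarefree_dvd_prime_power_mult:
  fixes p k s d :: nat
  assumes p: "prime p" and d: "squarefree d" "d dvd p ^ k * s"
  obtains "d dvd s" | e where "d = p * e" "e dvd s"
proof -
  have dvd_s: "e dvd s" if "\<not> p dvd e" "e dvd p ^ k * s" for e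
  proof -
    have "Rings.coprime e (p ^ k)"
      using prime_imp_coprime[OF p that(1)] coprime_commute coprime_power_right_iff by blast
    then show ?thesis
      using that(2) coprime_dvd_mult_right_iff by blast
  qed
  show ?thesis
  proof (cases "p dvd d")
    case True
    then obtain e where e: "d = p * e"
      by (rule dvdE)
    have "\<not> p dvd e"
    proof
      assume "p dvd e"
      then have "p\<^sup>2 dvd d"
        by (simp add: e power2_eq_square)
      then show False
        using d(1) p not_prime_unit unfolding squarefree_def by blast
    qed
    moreover have "e dvd p ^ k * s"
      using d(2) e dvd_mult_right by blast
    ultimately show ?thesis
      using that(2)[OF e] dvd_s by blast
  qed (use that(1) d(2) dvd_s in blast)
qed

lemma sum_divisors_prime_power_mult:
  fixes f :: "nat \<Rightarrow> 'a::comm_monoid_add"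
  assumes p: "prime p" and s: "\<not> p dvd s" "s > 0"
    and f: "\<And>d. \<not> squarefree d \<Longrightarrow> f d = 0"
  shows "(\<Sum>d | d dvd p ^ Suc l * s. f d) = (\<Sum>e | e dvd s. f e + f (p * e))"
proof -
  let ?D = "{e. e dvd s}"
  have p0: "p > 0"
    using p prime_gt_0_nat by blast
  have fin: "finite ?D" "finite {d. d dvd p ^ Suc l * s}"
    using s p0 by auto
  have "?D \<union> (*) p ` ?D \<subseteq> {d. d dvd p ^ Suc l * s}"
    by (auto intro: dvd_mult mult_dvd_mono)
  moreover have "f d = 0" if "d \<in> {d. d dvd p ^ Suc l * s} - (?D \<union> (*) p ` ?D)" for d
    using that by (intro f) (auto elim: squarefree_dvd_prime_power_mult[OF p, of d "Suc l" s])
  ultimately have "(\<Sum>d | d dvd p ^ Suc l * s. f d) = (\<Sum>d\<in>?D \<union> (*) p ` ?D. f d)"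
    using fin by (intro sum.mono_neutral_right) auto
  also have "\<dots> = (\<Sum>e\<in>?D. f e) + (\<Sum>d\<in>(*) p ` ?D. f d)"
  proof (rule sum.union_disjoint)
    show "?D \<inter> (*) p ` ?D = {}"
      using s(1) dvd_mult_left by blast
  qed (use fin in auto)
  also have "(\<Sum>d\<in>(*) p ` ?D. f d) = (\<Sum>e\<in>?D. f (p * e))"
    using p0 by (subst sum.reindex) (auto simp: inj_on_def)
  finally show ?thesis
    by (simp add: sum.distrib)
qed

lemma sum_moebius_mu_prime_split:
  assumes p: "prime p" and s: "\<not> p dvd s" "s > 0"
  shows "(\<Sum>d | d dvd p ^ Suc l * s. moebius_mu d * A (p ^ Suc l * s div d)) =
    (\<Sum>e | e dvd s. moebius_mu e * (A (p ^ Suc l * (s div e)) - A (p ^ l * (s div e))))"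
proof -
  let ?f = "\<lambda>d. moebius_mu d * A (p ^ Suc l * s div d)"
  have "(\<Sum>d | d dvd p ^ Suc l * s. ?f d) = (\<Sum>e | e dvd s. ?f e + ?f (p * e))"
    using p s by (rule sum_divisors_prime_power_mult) (simp add: moebius_mu_def)
  also have "\<dots> = (\<Sum>e | e dvd s. moebius_mu e * (A (p ^ Suc l * (s div e)) - A (p ^ l * (s div e))))"
  proof (rule sum.cong[OF refl])
    fix e assume "e \<in> {e. e dvd s}"
    then have e: "e dvd s" "\<not> p dvd e" "e > 0"
      using s by (auto intro: dvd_trans intro!: Nat.gr0I)
    then have "p ^ Suc l * s div e = p ^ Suc l * (s div e)"
      "p ^ Suc l * s div (p * e) = p ^ l * (s div e)"
      using prime_gt_0_nat[OF p] by (simp_all add: div_mult_swap[symmetric] mult.assoc)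
    then show "?f e + ?f (p * e) = moebius_mu e * (A (p ^ Suc l * (s div e)) - A (p ^ l * (s div e)))"
      using moebius_mu_prime_mult[OF p e(2,3)] by (simp add: algebra_simps)
  qed
  finally show ?thesis .
qed

lemma int_dvd_if_prime_powers_dvd:
  assumes n: "n > 0" and dvd: "\<And>p. prime p \<Longrightarrow> int p ^ multiplicity p n dvd S"
  shows "int n dvd S"
proof (cases "S = 0")
  case False
  have "n dvd nat \<bar>S\<bar>"
  proof (rule multiplicity_le_imp_dvd)
    fix p :: nat assume p: "prime p"
    have "p ^ multiplicity p n dvd nat \<bar>S\<bar>"
      using dvd[OF p] by (simp add: nat_abs_dvd_iff flip: int_dvd_int_iff)
    then show "multiplicity p n \<le> multiplicity p (nat \<bar>S\<bar>)"
      using False p not_prime_unit by (intro multiplicity_geI) auto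
  qed (use n in auto)
  then show ?thesis
    by (metis abs_ge_zero dvd_abs_iff int_dvd_int_iff int_nat_eq)
qed simp

lemma dold_condition_if_prime_power_cong:
  assumes A: "\<And>p l s. prime p \<Longrightarrow> s \<ge> 1 \<Longrightarrow> int p ^ Suc l dvd A (p ^ Suc l * s) - A (p ^ l * s)"
  shows "dold_condition A"
  unfolding dold_condition_def
proof (intro allI impI int_dvd_if_prime_powers_dvd)
  fix n p :: nat assume n: "n \<ge> 1" and p: "prime p"
  show "int p ^ multiplicity p n dvd (\<Sum>d | d dvd n. moebius_mu d * A (n div d))"
  proof (cases "multiplicity p n")
    case (Suc l)
    obtain s where s: "n = p ^ Suc l * s" "\<not> p dvd s"
      using multiplicity_decompose'[of n p] n p Suc not_prime_unit by (metis not_one_le_zero)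
    then have "s > 0"
      using n by (auto intro!: Nat.gr0I)
    then have "s div e \<ge> 1" if "e dvd s" for e
      using that dvd_imp_le[OF that] by (auto simp: Suc_le_eq div_greater_zero_iff intro!: Nat.gr0I)
    then have "int p ^ Suc l dvd
        (\<Sum>e | e dvd s. moebius_mu e * (A (p ^ Suc l * (s div e)) - A (p ^ l * (s div e))))"
      by (intro dvd_sum dvd_mult A p) auto
    moreover have "(\<Sum>d | d dvd n. moebius_mu d * A (n div d)) =
        (\<Sum>e | e dvd s. moebius_mu e * (A (p ^ Suc l * (s div e)) - A (p ^ l * (s div e))))"
      unfolding s(1) using p s(2) \<open>s > 0\<close> by (rule sum_moebius_mu_prime_split)
    ultimately show ?thesis
      by (simp only: Suc)
  qed simp
qed simp

lemma dold_condition_mult: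
  assumes "dold_condition A"
  shows "dold_condition (\<lambda>n. c * A n)"
proof -
  have "(\<Sum>d | d dvd n. moebius_mu d * (c * A (n div d))) =
      c * (\<Sum>d | d dvd n. moebius_mu d * A (n div d))" for n
    by (simp add: sum_distrib_left mult.left_commute)
  then show ?thesis
    using assms by (simp add: dold_condition_def)
qed

theorem (in splitting_field) dold_condition_rad_power_sum:
  fixes V :: "nat \<Rightarrow> int"
  assumes Z: "Z \<subseteq> O_K" and \<gamma>: "\<And>z. z \<in> Z \<Longrightarrow> \<gamma> z \<in> O_K"
    and V: "\<And>n. of_int (V n) = (\<Sum>z\<in>Z. \<gamma> z * z ^ n)" and t: "m dvd t" "t \<ge> 1"
  shows "dold_condition (\<lambda>n. rad (field_discriminant K) * V (n ^ t))"
proof (rule dold_condition_if_prime_power_cong)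
  fix p l s :: nat assume p: "prime p"
  define R where "R = rad (field_discriminant K)"
  have RV: "of_int (R * V ((p ^ k * s) ^ t)) = (\<Sum>z\<in>Z. \<gamma> z * (of_int R * (z ^ (s ^ t)) ^ (p ^ (k * t))))" for k
  proof -
    have "(p ^ k * s) ^ t = s ^ t * p ^ (k * t)"
      by (simp add: power_mult_distrib power_mult mult.commute)
    then show ?thesis
      by (simp add: V power_mult sum_distrib_left mult.left_commute)
  qed
  have "O_K.cong_mod (of_nat p ^ Suc l) (of_int (R * V ((p ^ Suc l * s) ^ t))) (of_int (R * V ((p ^ l * s) ^ t)))"
    unfolding RV
  proof (rule O_K.cong_mod_sum)
    fix z assume z: "z \<in> Z"
    then have "z ^ (s ^ t) \<in> O_K"
      using Z by (intro O_K.power_mem) auto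
    then show "O_K.cong_mod (of_nat p ^ Suc l) (\<gamma> z * (of_int R * (z ^ (s ^ t)) ^ (p ^ (Suc l * t))))
        (\<gamma> z * (of_int R * (z ^ (s ^ t)) ^ (p ^ (l * t))))"
      unfolding R_def by (intro O_K.cong_mod_mult_left[OF rad_discriminant_power_cong[OF p t]
        \<gamma>[OF z]])
  qed
  then obtain c where "c \<in> O_K"
      "of_int (R * V ((p ^ Suc l * s) ^ t) - R * V ((p ^ l * s) ^ t)) = of_int (int p ^ Suc l) * c"
    unfolding O_K.cong_mod_def by auto
  then show "int p ^ Suc l dvd rad (field_discriminant K) * V ((p ^ Suc l * s) ^ t) -
      rad (field_discriminant K) * V ((p ^ l * s) ^ t)"
    unfolding R_def by (intro of_int_dvd_O_K)
qed

lemma prod_differences_squared_eq: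
  fixes a :: "nat \<Rightarrow> 'a::idom"
  shows "\<exists>\<epsilon>::int. (\<Prod>j<n. \<Prod>i<j. (a i - a j)\<^sup>2) =
    of_int \<epsilon> * (\<Prod>i<n. \<Prod>j\<in>{..<n} - {i}. a i - a j)"
proof (induction n)
  case 0
  then show ?case
    by (intro exI[of _ 1]) simp
next
  case (Suc n)
  then obtain \<epsilon> :: int where \<epsilon>: "(\<Prod>j<n. \<Prod>i<j. (a i - a j)\<^sup>2) =
      of_int \<epsilon> * (\<Prod>i<n. \<Prod>j\<in>{..<n} - {i}. a i - a j)"
    by blast
  have "{..<Suc n} - {i} = insert n ({..<n} - {i})" if "i < n" for i
    using that by auto
  then have "(\<Prod>i<n. \<Prod>j\<in>{..<Suc n} - {i}. a i - a j) =
      (\<Prod>i<n. (a i - a n) * (\<Prod>j\<in>{..<n} - {i}. a i - a j))"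
    by (intro prod.cong) auto
  moreover have "{..<Suc n} - {n} = {..<n}"
    by auto
  moreover have "(\<Prod>j<n. a n - a j) = (-1) ^ n * (\<Prod>i<n. a i - a n)"
    using prod.distrib[of "\<lambda>_. -1" "\<lambda>i. a i - a n" "{..<n}"] by simp
  ultimately have "(\<Prod>i<Suc n. \<Prod>j\<in>{..<Suc n} - {i}. a i - a j) =
      (-1) ^ n * ((\<Prod>i<n. \<Prod>j\<in>{..<n} - {i}. a i - a j) * (\<Prod>i<n. a i - a n)\<^sup>2)"
    by (simp add: prod.distrib power2_eq_square mult_ac)
  moreover have "(\<Prod>j<Suc n. \<Prod>i<j. (a i - a j)\<^sup>2) =
      of_int \<epsilon> * ((\<Prod>i<n. \<Prod>j\<in>{..<n} - {i}. a i - a j) * (\<Prod>i<n. a i - a n)\<^sup>2)"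
    using \<epsilon> by (simp add: prod_power_distrib)
  moreover have "(-1) ^ n * ((-1) ^ n * y) = y" for y :: 'a
    by (simp flip: mult.assoc power_mult_distrib)
  ultimately show ?case
    by (intro exI[of _ "\<epsilon> * (-1) ^ n"]) (simp add: mult.assoc)
qed

lemma inj_on_if_prod_differences_nonzero:
  fixes a :: "nat \<Rightarrow> 'a::idom"
  assumes "(\<Prod>j<n. \<Prod>i<j. (a i - a j)\<^sup>2) \<noteq> 0"
  shows "inj_on a {..<n}"
proof (rule linorder_inj_onI')
  fix i j assume "i \<in> {..<n}" "j \<in> {..<n}" "i < j"
  then show "a i \<noteq> a j"
    using assms by auto
qed

lemma discriminant_eq_prod_pderiv_roots:
  fixes a :: "nat \<Rightarrow> complex"
  assumes f: "f = (\<Prod>i<n. [:- a i, 1:])" and inj: "inj_on a {..<n}"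
  shows "f = (\<Prod>z | poly f z = 0. [:- z, 1:])"
    and "\<exists>\<epsilon>::int. (\<Prod>j<n. \<Prod>i<j. (a i - a j)\<^sup>2) = of_int \<epsilon> * (\<Prod>z | poly f z = 0. poly (pderiv f) z)"
proof -
  have roots: "{z. poly f z = 0} = a ` {..<n}"
    by (auto simp: f poly_prod)
  then show fZ: "f = (\<Prod>z | poly f z = 0. [:- z, 1:])"
    by (simp add: f prod.reindex[OF inj])
  have "poly (pderiv f) (a i) = (\<Prod>j\<in>{..<n} - {i}. a i - a j)" if "i < n" for i
  proof -
    have "a ` {..<n} - {a i} = a ` ({..<n} - {i})"
      using inj that by (auto simp: inj_on_def)
    then show ?thesis
      using that inj_on_subset[OF inj, of "{..<n} - {i}"]
      by (subst fZ) (simp add: roots poly_pderiv_prod_linear poly_prod prod.reindex)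
  qed
  then have "(\<Prod>z | poly f z = 0. poly (pderiv f) z) = (\<Prod>i<n. \<Prod>j\<in>{..<n} - {i}. a i - a j)"
    by (simp add: roots prod.reindex[OF inj])
  then show "\<exists>\<epsilon>::int. (\<Prod>j<n. \<Prod>i<j. (a i - a j)\<^sup>2) = of_int \<epsilon> * (\<Prod>z | poly f z = 0. poly (pderiv f) z)"
    using prod_differences_squared_eq[where a = a] by simp
qed

theorem theorem9:
  fixes d :: nat and r :: "nat \<Rightarrow> int" and U :: "nat \<Rightarrow> int"
    and C :: "int poly" and \<alpha> :: "nat \<Rightarrow> complex" and K :: "complex set"
  assumes "d \<ge> 1"
    and "\<And>n. n \<ge> d \<Longrightarrow> U n = (\<Sum>i=1..d. r i * U (n - i))"
    and "C = monom 1 d - (\<Sum>i=1..d. monom (r i) (d - i))"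
    and "map_poly of_int C = (\<Prod>i<d. [:- \<alpha> i, 1:])"
    and "(\<Prod>j<d. \<Prod>i<j. (\<alpha> i - \<alpha> j)\<^sup>2) \<noteq> 0"
    and "K = complex_subfield hull (\<alpha> ` {..<d})"
  shows "\<exists>\<Delta>::int. of_int \<Delta> = (\<Prod>j<d. \<Prod>i<j. (\<alpha> i - \<alpha> j)\<^sup>2) \<and>
    (\<forall>t\<ge>1. rat_vs.dim K dvd t \<longrightarrow>
       dold_condition (\<lambda>n. r d * \<Delta> * rad (field_discriminant K) * U (n ^ t)))"
proof -
  let ?C = "map_poly of_int C :: complex poly"
    and ?Z = "{z. poly (map_poly of_int C) z = 0} :: complex set"
  note roots = discriminant_eq_prod_pderiv_roots[OF assms(4)
    inj_on_if_prod_differences_nonzero[OF assms(5)]]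
  interpret splitting_field ?C K
  proof
    show "lead_coeff ?C = 1"
      unfolding assms(4) lead_coeff_prod by simp
    show "K = complex_subfield hull ?Z"
      unfolding assms(6) by (rule arg_cong[of _ _ "(hull) _"]) (auto simp: assms(4) poly_prod)
  qed (simp add: polys_over_def coeff_map_poly)
  obtain E where E: "(\<Prod>z\<in>?Z. poly (pderiv ?C) z) = of_int E"
    using prod_roots_Ints[OF pderiv_polys_over[OF comm_subring_Ints C_Ints]] by (rule Ints_cases)
  have "annihilates ?C (\<lambda>n. of_int (U n))"
    unfolding assms(3) using assms(2) by (rule annihilates_of_int_char_poly)
  then obtain \<gamma> where \<gamma>: "\<forall>z. poly ?C z = 0 \<longrightarrow> \<gamma> z \<in> O_K"
      "\<forall>n. of_int E * of_int (U n) = (\<Sum>z\<in>?Z. \<gamma> z * z ^ n)"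
    using binet_formula_O_K[OF roots(1)] unfolding E by blast
  obtain \<epsilon> :: int where \<epsilon>: "(\<Prod>j<d. \<Prod>i<j. (\<alpha> i - \<alpha> j)\<^sup>2) = of_int \<epsilon> * of_int E"
    using roots(2) unfolding E by blast
  have "dold_condition (\<lambda>n. r d * \<epsilon> * (rad (field_discriminant K) * (E * U (n ^ t))))"
    if "t \<ge> 1" "m dvd t" for t
    using that \<gamma> root_mem_K algebraic_int_root
    by (intro dold_condition_mult[OF dold_condition_rad_power_sum[of ?Z \<gamma>]]) (auto simp: O_K_iff)
  then show ?thesis
    using \<epsilon> unfolding dim_K by (intro exI[of _ "\<epsilon> * E"]) (simp add: mult_ac)
qed

end
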